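(* Let $X$ be a uniformly locally finite metric space with property A, and let $\bar\xi=(\xi_n)_n$ and $\bar\zeta=(\zeta_n)_n$ be orthonormal bases of the separable infinite-dimensional Hilbert space $H$. If $\Phi\in\mathrm{Aut}(\mathrm{C}^*(X))$, then there is a unitary $v\in\mathrm{BD}(X)$ such that \[ \mathrm{Ad}(v)\circ\Phi\big(\ell_\infty(X,\bar\xi)\big)=\ell_\infty(X,\bar\zeta). \]
   Context: A metric space $(X,d)$ is uniformly locally finite (u.l.f.) if $\sup_{x\in X}|B_r(x)|<\infty$ for all $r>0$, where $B_r(x)$ is the closed ball of radius $r$ centered at $x$. $H$ is a separable infinite-dimensional Hilbert space. $\ell_2(X,H)$ is the Hilbert space of square-summable functions $X\to H$, and $\delta_x\otimes\eta$ is the function with value $\eta$ at $x$ and $0$ elsewhere. For $a\in\mathcal B(\ell_2(X,H))$ and $x,y\in X$, $a_{xy}\in\mathcal B(H)$ is determined by $\langle a_{xy}\xi,\eta\rangle=\langle a(\delta_x\otimes\xi),\delta_y\otimes\eta\rangle$, and $\mathrm{prop}(a)=\sup\{d(x,y)\mid a_{xy}\neq 0\}$. $\mathrm{BD}(X)$ is the norm closure of $\{a\in\mathcal B(\ell_2(X,H))\mid\mathrm{prop}(a)<\infty\}$, and the Roe algebra is $\mathrm{C}^*(X)=\{a\in \mathrm{BD}(X)\mid a_{xy}\text{ is compact for all }x,y\in X\}$. For a unitary $v$, $\mathrm{Ad}(v)(a)=vav^*$. For an orthonormal basis $\bar\xi=(\xi_n)_n$ of $H$, $\ell_\infty(X,\bar\xi)$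 is the algebra of all $a\in\mathcal B(\ell_2(X,H))$ such that for every $x\in X$ there is $(\lambda_n)_n\in c_0$ with $a(\delta_x\otimes\xi_n)=\lambda_n(\delta_x\otimes\xi_n)$ for all $n\in\mathbb N$. Property A is Yu's property A. For u.l.f. metric spaces it is equivalent to the operator norm localisation property (ONL), which may be taken as the definition: for all $s>0$ and $\rho\in(0,1)$ there is $r>0$ so that for every $a\in \mathcal B(\ell_2(X,H))$ with $\mathrm{prop}(a)\leq s$ there is a unit vector $\xi\in\ell_2(X,H)$ with $\mathrm{diam}(\{x\in X\mid \xi(x)\neq 0\})\leq r$ and $\|a\xi\|\geq\rho\|a\|$. *)

theory Defs
  imports "HOL-Analysis.Analysis"
begin

section \<open>Complex Hilbert spaces\<close>

class scaleC =
  fixes scaleC :: "complex \<Rightarrow> 'a \<Rightarrow> 'a" (infixr "*\<^sub>C" 75)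

text \<open>
  The real inner product (hence norm and topology) of \<open>real_inner\<close> is tied to the complex one
  by \<open>inner_eq_Re_cinner\<close>. The complex inner product is linear in its first argument.
\<close>

class complex_inner = real_inner + scaleC +
  fixes cinner :: "'a \<Rightarrow> 'a \<Rightarrow> complex"
  assumes scaleC_add_right: "c *\<^sub>C (x + y) = c *\<^sub>C x + c *\<^sub>C y"
    and scaleC_add_left: "(c + d) *\<^sub>C x = c *\<^sub>C x + d *\<^sub>C x"
    and scaleC_scaleC: "c *\<^sub>C d *\<^sub>C x = (c * d) *\<^sub>C x"
    and scaleR_eq_scaleC: "r *\<^sub>R x = complex_of_real r *\<^sub>C x"
    and cinner_commute: "cinner x y = cnj (cinner y x)"
    and cinner_add_left: "cinner (x + y) z = cinner x z + cinner y z"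
    and cinner_scaleC_left: "cinner (c *\<^sub>C x) y = c * cinner x y"
    and inner_eq_Re_cinner: "inner x y = Re (cinner x y)"

class complex_hilbert = complex_inner + complete_space

instantiation complex :: complex_hilbert
begin

definition scaleC_complex :: "complex \<Rightarrow> complex \<Rightarrow> complex" where
  "scaleC_complex c x = c * x"

definition cinner_complex :: "complex \<Rightarrow> complex \<Rightarrow> complex" where
  "cinner_complex x y = x * cnj y"

instance
proof
  fix c d x y z :: complex and r :: real
  show "c *\<^sub>C (x + y) = c *\<^sub>C x + c *\<^sub>C y" by (simp add: scaleC_complex_def distrib_left)
  show "(c + d) *\<^sub>C x = c *\<^sub>C x + d *\<^sub>C x" by (simp add: scaleC_complex_def distrib_right)
  show "c *\<^sub>C d *\<^sub>C x = (c * d) *\<^sub>C x" by (simp add: scaleC_complex_def mult.assoc)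
  show "r *\<^sub>R x = complex_of_real r *\<^sub>C x"
    unfolding scaleC_complex_def by (rule scaleR_conv_of_real)
  show "cinner x y = cnj (cinner y x)" by (simp add: cinner_complex_def mult.commute)
  show "cinner (x + y) z = cinner x z + cinner y z"
    by (simp add: cinner_complex_def distrib_right)
  show "cinner (c *\<^sub>C x) y = c * cinner x y"
    by (simp add: cinner_complex_def scaleC_complex_def mult.assoc)
  show "inner x y = Re (cinner x y)" by (simp add: cinner_complex_def inner_complex_def)
qed

end

lemma scaleC_one [simp]: "1 *\<^sub>C x = (x :: 'a::complex_inner)"
  using scaleR_eq_scaleC[of 1 x] by simp

global_interpretation complex_vector:
  vector_space "scaleC :: complex \<Rightarrow> 'a \<Rightarrow> 'a::complex_inner"
  defines cspan = complex_vector.span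
  by unfold_locales (simp_all add: scaleC_add_right scaleC_add_left scaleC_scaleC)

lemma cinner_add_right: "cinner x (y + z) = cinner x y + cinner x (z :: 'a::complex_inner)"
  by (metis cinner_commute cinner_add_left complex_cnj_add)

lemma cinner_scaleC_right: "cinner x (c *\<^sub>C y) = cnj c * cinner x (y :: 'a::complex_inner)"
  by (metis cinner_commute cinner_scaleC_left complex_cnj_mult)

lemma cinner_zero [simp]: "cinner 0 y = 0" "cinner y (0 :: 'a::complex_inner) = 0"
  using cinner_scaleC_left[of 0 0 y] cinner_scaleC_right[of y 0 0] by simp_all

lemma cinner_self: "cinner x x = complex_of_real ((norm (x :: 'a::complex_inner))\<^sup>2)"
proof (rule complex_eqI)
  show "Re (cinner x x) = Re (complex_of_real ((norm x)\<^sup>2))"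
    by (simp add: inner_eq_Re_cinner[symmetric] power2_norm_eq_inner)
  have "Im (cinner x x) = Im (cnj (cinner x x))" using cinner_commute[of x x] by (rule arg_cong)
  then show "Im (cinner x x) = Im (complex_of_real ((norm x)\<^sup>2))" by simp
qed

lemma Im_cinner: "Im (cinner x y) = inner x (\<i> *\<^sub>C (y :: 'a::complex_inner))"
  by (simp add: inner_eq_Re_cinner cinner_scaleC_right)

lemma norm_scaleC: "norm (c *\<^sub>C x) = norm c * norm (x :: 'a::complex_inner)"
proof -
  have "complex_of_real ((norm (c *\<^sub>C x))\<^sup>2) = c * cnj c * cinner x x"
    unfolding cinner_self[symmetric] cinner_scaleC_left cinner_scaleC_right by simp
  also have "\<dots> = complex_of_real ((norm c * norm x)\<^sup>2)"
    by (simp only: complex_norm_square[symmetric] cinner_self of_real_power of_real_mult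
        power_mult_distrib)
  finally have "(norm (c *\<^sub>C x))\<^sup>2 = (norm c * norm x)\<^sup>2"
    using of_real_eq_iff by blast
  then show ?thesis by (simp add: power2_eq_iff_nonneg)
qed

lemma norm_cinner_le: "norm (cinner x y) \<le> norm x * norm (y :: 'a::complex_inner)"
proof (cases "cinner x y = 0")
  case False
  define c where "c = cnj (sgn (cinner x y))"
  have n: "norm c = 1" using False by (simp add: c_def norm_sgn)
  have "c * cinner x y = complex_of_real (norm (cinner x y))"
    using False by (simp add: c_def sgn_div_norm scaleR_conv_of_real complex_norm_square[symmetric]
        mult.commute[of "cnj _"] power2_eq_square divide_simps)
  then have "norm (cinner x y) = inner (c *\<^sub>C x) y"
    by (simp add: inner_eq_Re_cinner cinner_scaleC_left)
  also have "\<dots> \<le> norm (c *\<^sub>C x) * norm y" by (rule norm_cauchy_schwarz)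
  finally show ?thesis by (simp add: norm_scaleC n)
qed simp

lemma bounded_linear_scaleC: "bounded_linear (scaleC c :: 'a \<Rightarrow> 'a::complex_inner)"
  by (rule bounded_linear_intro[where K = "norm c"])
    (simp_all add: scaleC_add_right scaleR_eq_scaleC scaleC_scaleC mult.commute norm_scaleC)

lemma cinner_eqI:
  assumes "\<And>z. cinner x z = cinner y (z :: 'a::complex_inner)"
  shows "x = y"
proof -
  have "inner x (x - y) = inner y (x - y)"
    using assms by (simp add: inner_eq_Re_cinner)
  then have "inner (x - y) (x - y) = 0" by (simp add: inner_diff_left)
  then show ?thesis by simp
qed

definition orthonormal_basis :: "(nat \<Rightarrow> 'a::complex_inner) \<Rightarrow> bool" where
  "orthonormal_basis \<xi> \<longleftrightarrow>
     (\<forall>m n. cinner (\<xi> m) (\<xi> n) = (if m = n then 1 else 0)) \<and> closure (cspan (range \<xi>)) = UNIV"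

definition infinite_dimensional :: "'a::complex_inner itself \<Rightarrow> bool" where
  "infinite_dimensional _ \<longleftrightarrow> (\<nexists>B :: 'a set. finite B \<and> cspan B = UNIV)"


section \<open>Bounded operators\<close>

text \<open>
  \<open>'a \<Rightarrow>\<^sub>L 'b\<close> consists of the real-linear bounded maps with the operator norm;
  the complex-linear ones form the closed subspace \<open>\<B>\<close>.
\<close>

definition cblinfuns :: "('a::complex_inner \<Rightarrow>\<^sub>L 'b::complex_inner) set" ("\<B>") where
  "\<B> = {a. \<forall>c x. blinfun_apply a (c *\<^sub>C x) = c *\<^sub>C blinfun_apply a x}"

instantiation blinfun :: (real_normed_vector, complex_inner) scaleC
begin

lift_definition scaleC_blinfun :: "complex \<Rightarrow> ('a \<Rightarrow>\<^sub>L 'b) \<Rightarrow> 'a \<Rightarrow>\<^sub>L 'b" is "\<lambda>c f x. c *\<^sub>C f x"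
  by (rule bounded_linear_compose[OF bounded_linear_scaleC])

instance ..

end

definition adj :: "('a::complex_hilbert \<Rightarrow>\<^sub>L 'b::complex_hilbert) \<Rightarrow> 'b \<Rightarrow>\<^sub>L 'a" where
  "adj a = (THE b. \<forall>x y. cinner (blinfun_apply a x) y = cinner x (blinfun_apply b y))"

lemma riesz_real:
  fixes f :: "'a::{real_inner, complete_space} \<Rightarrow> real"
  assumes f: "bounded_linear f"
  obtains y where "\<And>x. f x = inner x y"
proof -
  interpret f: bounded_linear f by (rule f)
  obtain K where K: "\<And>x. norm (f x) \<le> norm x * K" using f.bounded by blast
  define q where "q x = (norm x)\<^sup>2 - 2 * f x" for x
  have q_lb: "- K\<^sup>2 \<le> q x" for x
  proof -
    have "f x \<le> norm x * K" using K[of x] by simp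
    moreover have "0 \<le> (norm x - K)\<^sup>2" by simp
    ultimately show ?thesis by (simp add: q_def power2_diff)
  qed
  define m where "m = (INF x. q x)"
  have bdd: "bdd_below (range q)" by (rule bdd_belowI2[of _ "- K\<^sup>2"]) (rule q_lb)
  have m_le: "m \<le> q x" for x unfolding m_def by (rule cINF_lower[OF bdd]) simp
  have "\<exists>x. q x < m + inverse (real (Suc n))" for n
    using cINF_less_iff[OF _ bdd, of "m + inverse (real (Suc n))"] unfolding m_def by auto
  then obtain X where X: "\<And>n. q (X n) < m + inverse (real (Suc n))" by metis
  have par: "(norm (x - y))\<^sup>2 = 2 * q x + 2 * q y - 4 * q ((1/2) *\<^sub>R (x + y))" for x y
    unfolding q_def power2_norm_eq_inner f.add f.scale
    by (simp add: inner_simps algebra_simps inner_commute)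
  have near: "(norm (X i - X j))\<^sup>2 \<le> 2 * inverse (real (Suc i)) + 2 * inverse (real (Suc j))" for i j
    using X[of i] X[of j] m_le[of "(1/2) *\<^sub>R (X i + X j)"] unfolding par by linarith
  have "Cauchy X"
  proof (rule CauchyI)
    fix e :: real assume e: "0 < e"
    obtain N where N: "inverse (real (Suc N)) < e\<^sup>2 / 4"
      using reals_Archimedean[of "e\<^sup>2/4"] e by auto
    show "\<exists>M. \<forall>m\<ge>M. \<forall>n\<ge>M. norm (X m - X n) < e"
    proof (intro exI allI impI)
      fix i j assume "N \<le> i" "N \<le> j"
      then have "inverse (real (Suc i)) \<le> inverse (real (Suc N))"
        "inverse (real (Suc j)) \<le> inverse (real (Suc N))"
        by (simp_all add: le_imp_inverse_le)
      then have "(norm (X i - X j))\<^sup>2 < e\<^sup>2" using near[of i j] N by linarith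
      then show "norm (X i - X j) < e" using e by (simp add: power_less_imp_less_base)
    qed
  qed
  then obtain y where y: "X \<longlonglongrightarrow> y" by (auto simp: Cauchy_convergent_iff convergent_def)
  have "(\<lambda>n. q (X n)) \<longlonglongrightarrow> q y"
    unfolding q_def by (intro tendsto_intros f.tendsto y)
  moreover have "(\<lambda>n. m + inverse (real (Suc n))) \<longlonglongrightarrow> m + 0"
    by (intro tendsto_intros LIMSEQ_inverse_real_of_nat)
  ultimately have "q y \<le> m" using X by (simp add: LIMSEQ_le less_imp_le)
  then have ymin: "q y \<le> q x" for x using m_le[of x] by linarith
  have "f x = inner x y" for x
  proof (cases "x = 0")
    case False
    define d where "d = f x - inner x y"
    define t where "t = d / (norm x)\<^sup>2"
    have nx: "(norm x)\<^sup>2 \<noteq> 0" using False by simp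
    have "q (y + t *\<^sub>R x) = q y + t\<^sup>2 * (norm x)\<^sup>2 - 2 * t * d"
      unfolding q_def d_def power2_norm_eq_inner f.add f.scale
      by (simp add: inner_simps algebra_simps inner_commute power2_eq_square)
    also have "\<dots> = q y - d\<^sup>2 / (norm x)\<^sup>2"
      using nx by (simp add: t_def power2_eq_square field_simps)
    finally have "d\<^sup>2 / (norm x)\<^sup>2 \<le> 0" using ymin[of "y + t *\<^sub>R x"] by linarith
    then have "d = 0" using nx False by (simp add: divide_le_0_iff)
    then show ?thesis by (simp add: d_def)
  qed (simp add: f.zero)
  then show thesis by (rule that)
qed

lemma cinner_adj:
  fixes a :: "'a::complex_hilbert \<Rightarrow>\<^sub>L 'b::complex_hilbert"
  assumes a: "a \<in> \<B>"
  shows "cinner (blinfun_apply a x) y = cinner x (blinfun_apply (adj a) y)"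
proof -
  have "\<exists>z. \<forall>x. inner (blinfun_apply a x) y = inner x z" for y
    using riesz_real[OF bounded_linear_compose[OF bounded_linear_inner_left[of y] blinfun.bounded_linear_right[of a]]]
    by blast
  then obtain g where g: "\<And>x y. inner (blinfun_apply a x) y = inner x (g y)" by metis
  have g_add: "g (y + z) = g y + g z" for y z
    by (rule vector_eq_ldot[THEN iffD1]) (simp add: g[symmetric] inner_add_right)
  have g_scale: "g (r *\<^sub>R y) = r *\<^sub>R g y" for r y
    by (rule vector_eq_ldot[THEN iffD1]) (simp add: g[symmetric])
  have g_norm: "norm (g y) \<le> norm y * norm a" for y
  proof (cases "g y = 0")
    case False
    have "norm (g y) * norm (g y) = inner (blinfun_apply a (g y)) y"
      by (simp add: g power2_norm_eq_inner[symmetric] power2_eq_square)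
    also have "\<dots> \<le> norm (blinfun_apply a (g y)) * norm y" by (rule norm_cauchy_schwarz)
    also have "\<dots> \<le> norm a * norm (g y) * norm y"
      by (intro mult_right_mono norm_blinfun) simp
    finally have "norm (g y) * norm (g y) \<le> norm (g y) * (norm y * norm a)"
      by (simp add: mult.commute mult.left_commute)
    then show ?thesis using False by simp
  qed simp
  have bl: "bounded_linear g" by (rule bounded_linear_intro[OF g_add g_scale g_norm])
  have gc: "cinner (blinfun_apply a x) y = cinner x (g y)" for x y
  proof (rule complex_eqI)
    show "Re (cinner (blinfun_apply a x) y) = Re (cinner x (g y))"
      using g by (simp add: inner_eq_Re_cinner)
    have "Re (cinner (\<i> *\<^sub>C blinfun_apply a x) y) = Re (cinner (\<i> *\<^sub>C x) (g y))"
      using g[of "\<i> *\<^sub>C x" y] a by (simp add: inner_eq_Re_cinner cblinfuns_def)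
    then show "Im (cinner (blinfun_apply a x) y) = Im (cinner x (g y))"
      by (simp add: cinner_scaleC_left)
  qed
  have "\<forall>x y. cinner (blinfun_apply a x) y = cinner x (blinfun_apply (adj a) y)"
    unfolding adj_def
  proof (rule theI)
    show "\<forall>x y. cinner (blinfun_apply a x) y = cinner x (blinfun_apply (Blinfun g) y)"
      by (simp add: bounded_linear_Blinfun_apply[OF bl] gc)
    fix b assume b: "\<forall>x y. cinner (blinfun_apply a x) y = cinner x (blinfun_apply b y)"
    show "b = Blinfun g"
    proof (rule blinfun_eqI)
      fix y
      have "cinner x (blinfun_apply b y) = cinner x (g y)" for x
        unfolding gc[symmetric] using b by simp
      then have "cinner (blinfun_apply b y) z = cinner (g y) z" for z
        by (subst (1 2) cinner_commute) simp
      then have "blinfun_apply b y = g y" by (rule cinner_eqI)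
      then show "blinfun_apply b y = blinfun_apply (Blinfun g) y"
        by (simp add: bounded_linear_Blinfun_apply[OF bl])
    qed
  qed
  then show ?thesis by blast
qed

definition unitary :: "('a::complex_hilbert \<Rightarrow>\<^sub>L 'a) \<Rightarrow> bool" where
  "unitary v \<longleftrightarrow> v \<in> \<B> \<and> adj v o\<^sub>L v = id_blinfun \<and> v o\<^sub>L adj v = id_blinfun"

definition Ad :: "('a::complex_hilbert \<Rightarrow>\<^sub>L 'a) \<Rightarrow> ('a \<Rightarrow>\<^sub>L 'a) \<Rightarrow> 'a \<Rightarrow>\<^sub>L 'a" where
  "Ad v a = v o\<^sub>L a o\<^sub>L adj v"

definition compact_operator :: "('a::complex_inner \<Rightarrow>\<^sub>L 'b::complex_inner) \<Rightarrow> bool" where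
  "compact_operator a \<longleftrightarrow> compact (closure (blinfun_apply a ` cball 0 1))"

text \<open>
  \<open>\<Phi>\<close> is only constrained on \<open>A\<close>, so it represents an automorphism of the algebra \<open>A\<close>.
\<close>

definition star_automorphism ::
    "('a::complex_hilbert \<Rightarrow>\<^sub>L 'a) set \<Rightarrow> (('a \<Rightarrow>\<^sub>L 'a) \<Rightarrow> 'a \<Rightarrow>\<^sub>L 'a) \<Rightarrow> bool" where
  "star_automorphism A \<Phi> \<longleftrightarrow>
     bij_betw \<Phi> A A \<and>
     (\<forall>a\<in>A. \<forall>b\<in>A. \<Phi> (a + b) = \<Phi> a + \<Phi> b) \<and>
     (\<forall>a\<in>A. \<forall>c. \<Phi> (c *\<^sub>C a) = c *\<^sub>C \<Phi> a) \<and>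
     (\<forall>a\<in>A. \<forall>b\<in>A. \<Phi> (a o\<^sub>L b) = \<Phi> a o\<^sub>L \<Phi> b) \<and>
     (\<forall>a\<in>A. \<Phi> (adj a) = adj (\<Phi> a))"


section \<open>Square-summable functions\<close>

typedef (overloaded) ('x, 'h) ell2 =
  "{f :: 'x \<Rightarrow> 'h::complex_inner. (\<lambda>x. (norm (f x))\<^sup>2) summable_on UNIV}"
  morphisms ell2_apply Abs_ell2
  by (rule exI[of _ "\<lambda>_. 0"]) simp

setup_lifting type_definition_ell2

lemma of_real_infsum:
  assumes "f summable_on A"
  shows "complex_of_real (infsum f A) = (\<Sum>\<^sub>\<infinity>x\<in>A. complex_of_real (f x))"
  by (rule infsumI[symmetric], rule has_sum_of_real, rule has_sum_infsum, rule assms)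

lemma square_summable_add:
  fixes f g :: "'x \<Rightarrow> 'h::complex_inner"
  assumes "(\<lambda>x. (norm (f x))\<^sup>2) summable_on UNIV" "(\<lambda>x. (norm (g x))\<^sup>2) summable_on UNIV"
  shows "(\<lambda>x. (norm (f x + g x))\<^sup>2) summable_on UNIV"
proof (rule summable_on_comparison_test)
  show "(\<lambda>x. 2 * (norm (f x))\<^sup>2 + 2 * (norm (g x))\<^sup>2) summable_on UNIV"
    by (intro summable_on_add summable_on_cmult_right assms)
  fix x
  have "(norm (f x + g x))\<^sup>2 \<le> (norm (f x) + norm (g x))\<^sup>2"
    by (intro power_mono norm_triangle_ineq) simp
  also have "\<dots> \<le> 2 * (norm (f x))\<^sup>2 + 2 * (norm (g x))\<^sup>2"
    using sum_squares_bound[of "norm (f x)" "norm (g x)"] by (simp add: power2_sum)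
  finally show "(norm (f x + g x))\<^sup>2 \<le> 2 * (norm (f x))\<^sup>2 + 2 * (norm (g x))\<^sup>2" .
qed simp

lemma square_summable_scaleC:
  fixes f :: "'x \<Rightarrow> 'h::complex_inner"
  assumes "(\<lambda>x. (norm (f x))\<^sup>2) summable_on UNIV"
  shows "(\<lambda>x. (norm (c *\<^sub>C f x))\<^sup>2) summable_on UNIV"
  using summable_on_cmult_right[OF assms, of "(norm c)\<^sup>2"]
  by (simp add: norm_scaleC power_mult_distrib)

lemma square_summable_cinner:
  fixes f g :: "'x \<Rightarrow> 'h::complex_inner"
  assumes "(\<lambda>x. (norm (f x))\<^sup>2) summable_on UNIV" "(\<lambda>x. (norm (g x))\<^sup>2) summable_on UNIV"
  shows "(\<lambda>x. cinner (f x) (g x)) summable_on UNIV"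
proof -
  have s: "(\<lambda>x. (norm (f x))\<^sup>2 + (norm (g x))\<^sup>2) summable_on UNIV"
    by (intro summable_on_add assms)
  have "norm (cinner (f x) (g x)) \<le> (norm (f x))\<^sup>2 + (norm (g x))\<^sup>2" for x
  proof -
    have "0 \<le> norm (f x) * norm (g x)" by simp
    then show ?thesis
      using norm_cinner_le[of "f x" "g x"] sum_squares_bound[of "norm (f x)" "norm (g x)"]
      by linarith
  qed
  then have "(\<lambda>x. norm (cinner (f x) (g x))) summable_on UNIV"
    by (rule Infinite_Sum.abs_summable_on_comparison_test'[OF s])
  then show ?thesis by (rule Infinite_Sum.abs_summable_summable)
qed

instantiation ell2 :: (type, complex_inner) complex_inner
begin

lift_definition zero_ell2 :: "('a, 'b) ell2" is "\<lambda>_. 0" by simp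

lift_definition plus_ell2 :: "('a, 'b) ell2 \<Rightarrow> ('a, 'b) ell2 \<Rightarrow> ('a, 'b) ell2"
  is "\<lambda>f g x. f x + g x" by (rule square_summable_add)

lift_definition uminus_ell2 :: "('a, 'b) ell2 \<Rightarrow> ('a, 'b) ell2" is "\<lambda>f x. - f x" by simp

lift_definition minus_ell2 :: "('a, 'b) ell2 \<Rightarrow> ('a, 'b) ell2 \<Rightarrow> ('a, 'b) ell2"
  is "\<lambda>f g x. f x - g x"
  using square_summable_add[of _ "\<lambda>x. - _ x"] by simp

lift_definition scaleC_ell2 :: "complex \<Rightarrow> ('a, 'b) ell2 \<Rightarrow> ('a, 'b) ell2"
  is "\<lambda>c f x. c *\<^sub>C f x" by (rule square_summable_scaleC)

lift_definition scaleR_ell2 :: "real \<Rightarrow> ('a, 'b) ell2 \<Rightarrow> ('a, 'b) ell2"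
  is "\<lambda>r f x. r *\<^sub>R f x" unfolding scaleR_eq_scaleC by (rule square_summable_scaleC)

lift_definition cinner_ell2 :: "('a, 'b) ell2 \<Rightarrow> ('a, 'b) ell2 \<Rightarrow> complex"
  is "\<lambda>f g. \<Sum>\<^sub>\<infinity>x. cinner (f x) (g x)" .

definition inner_ell2 :: "('a, 'b) ell2 \<Rightarrow> ('a, 'b) ell2 \<Rightarrow> real" where
  "inner_ell2 f g = Re (cinner f g)"

definition norm_ell2 :: "('a, 'b) ell2 \<Rightarrow> real" where
  "norm_ell2 f = sqrt (inner f f)"

definition sgn_ell2 :: "('a, 'b) ell2 \<Rightarrow> ('a, 'b) ell2" where
  "sgn_ell2 f = inverse (norm f) *\<^sub>R f"

definition dist_ell2 :: "('a, 'b) ell2 \<Rightarrow> ('a, 'b) ell2 \<Rightarrow> real" where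
  "dist_ell2 f g = norm (f - g)"

definition uniformity_ell2 :: "(('a, 'b) ell2 \<times> ('a, 'b) ell2) filter" where
  "uniformity_ell2 = (INF e\<in>{0 <..}. principal {(f, g). dist f g < e})"

definition open_ell2 :: "('a, 'b) ell2 set \<Rightarrow> bool" where
  "open_ell2 U \<longleftrightarrow> (\<forall>f\<in>U. \<forall>\<^sub>F (f', g) in uniformity. f' = f \<longrightarrow> g \<in> U)"

instance
proof
  fix f g h :: "('a, 'b) ell2" and r s :: real and c d :: complex
  show "f + g + h = f + (g + h)" by transfer (simp add: add.assoc)
  show "f + g = g + f" by transfer (simp add: add.commute)
  show "0 + f = f" by transfer simp
  show "- f + f = 0" by transfer simp
  show "f - g = f + - g" by transfer simp
  show "r *\<^sub>R (f + g) = r *\<^sub>R f + r *\<^sub>R g" by transfer (simp add: scaleR_add_right)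
  show "(r + s) *\<^sub>R f = r *\<^sub>R f + s *\<^sub>R f" by transfer (simp add: scaleR_add_left)
  show "r *\<^sub>R s *\<^sub>R f = (r * s) *\<^sub>R f" by transfer simp
  show "1 *\<^sub>R f = f" by transfer simp
  show "c *\<^sub>C (f + g) = c *\<^sub>C f + c *\<^sub>C g" by transfer (simp add: scaleC_add_right)
  show "(c + d) *\<^sub>C f = c *\<^sub>C f + d *\<^sub>C f" by transfer (simp add: scaleC_add_left)
  show "c *\<^sub>C d *\<^sub>C f = (c * d) *\<^sub>C f" by transfer (simp add: scaleC_scaleC)
  show "r *\<^sub>R f = complex_of_real r *\<^sub>C f" by transfer (simp add: scaleR_eq_scaleC)
  show sgn: "sgn f = inverse (norm f) *\<^sub>R f" by (rule sgn_ell2_def)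
  show "dist f g = norm (f - g)" by (rule dist_ell2_def)
  show "(uniformity :: (('a, 'b) ell2 \<times> ('a, 'b) ell2) filter)
      = (INF e\<in>{0 <..}. principal {(x, y). dist x y < e})" by (rule uniformity_ell2_def)
  show "open U \<longleftrightarrow> (\<forall>x\<in>U. \<forall>\<^sub>F (x', y) in uniformity. x' = x \<longrightarrow> y \<in> U)"
    for U :: "('a, 'b) ell2 set" by (rule open_ell2_def)
  show comm: "cinner f g = cnj (cinner g f)"
    by transfer (simp add: infsum_cnj[symmetric] cinner_commute[symmetric])
  show add: "cinner (f + g) h = cinner f h + cinner g h"
    by transfer (simp add: cinner_add_left infsum_add square_summable_cinner)
  show scale: "cinner (c *\<^sub>C f) g = c * cinner f g" for c
    by transfer (simp add: cinner_scaleC_left infsum_cmult_right square_summable_cinner)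
  show "inner f g = Re (cinner f g)" by (rule inner_ell2_def)
  show "inner f g = inner g f" unfolding inner_ell2_def by (subst comm) simp
  show "inner (f + g) h = inner f h + inner g h" by (simp add: inner_ell2_def add)
  have "r *\<^sub>R f = complex_of_real r *\<^sub>C f" by transfer (simp add: scaleR_eq_scaleC)
  then show "inner (r *\<^sub>R f) g = r * inner f g" by (simp add: inner_ell2_def scale)
  have sq: "inner f f = (\<Sum>\<^sub>\<infinity>x. (norm (ell2_apply f x))\<^sup>2)"
    using ell2_apply[of f]
    by (simp add: inner_ell2_def cinner_ell2.rep_eq cinner_self of_real_infsum[symmetric]
        del: of_real_power)
  show "0 \<le> inner f f" unfolding sq by (rule infsum_nonneg) simp
  show "inner f f = 0 \<longleftrightarrow> f = 0"
  proof
    assume "inner f f = 0"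
    then have "(norm (ell2_apply f x))\<^sup>2 = 0" for x
      unfolding sq using ell2_apply[of f] by (intro nonneg_infsum_le_0D[of _ UNIV]) auto
    then show "f = 0"
      by (intro ell2_apply_inject[THEN iffD1]) (simp add: fun_eq_iff zero_ell2.rep_eq)
  next
    assume "f = 0"
    then show "inner f f = 0" unfolding sq by (simp add: zero_ell2.rep_eq)
  qed
  show "norm f = sqrt (inner f f)" by (rule norm_ell2_def)
qed

end

lemma norm_ell2_square: "(norm f)\<^sup>2 = (\<Sum>\<^sub>\<infinity>x. (norm (ell2_apply f x))\<^sup>2)"
  using ell2_apply[of f]
  by (simp add: power2_norm_eq_inner inner_ell2_def cinner_ell2.rep_eq cinner_self
      of_real_infsum[symmetric] del: of_real_power)

lemma sum_le_norm_ell2: "finite S \<Longrightarrow> (\<Sum>x\<in>S. (norm (ell2_apply f x))\<^sup>2) \<le> (norm f)\<^sup>2"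
  unfolding norm_ell2_square using ell2_apply[of f] by (intro finite_sum_le_infsum) auto

lemma norm_ell2_apply_le: "norm (ell2_apply f x) \<le> norm f"
  using sum_le_norm_ell2[of "{x}" f] by (simp add: power2_le_iff_abs_le)

instance ell2 :: (type, complex_hilbert) complex_hilbert
proof
  fix X :: "nat \<Rightarrow> ('a, 'b) ell2"
  assume X: "Cauchy X"
  have "Cauchy (\<lambda>n. ell2_apply (X n) x)" for x
  proof (rule CauchyI)
    fix e :: real assume "0 < e"
    then obtain M where M: "\<And>m n. m \<ge> M \<Longrightarrow> n \<ge> M \<Longrightarrow> norm (X m - X n) < e"
      using CauchyD[OF X] by metis
    have "norm (ell2_apply (X m) x - ell2_apply (X n) x) < e" if "m \<ge> M" "n \<ge> M" for m n
      using norm_ell2_apply_le[of "X m - X n" x] M[OF that] by (simp add: minus_ell2.rep_eq)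
    then show "\<exists>M. \<forall>m\<ge>M. \<forall>n\<ge>M. norm (ell2_apply (X m) x - ell2_apply (X n) x) < e" by blast
  qed
  then have "\<exists>l. (\<lambda>n. ell2_apply (X n) x) \<longlonglongrightarrow> l" for x
    by (simp add: Cauchy_convergent_iff convergent_def)
  then obtain F where F: "\<And>x. (\<lambda>n. ell2_apply (X n) x) \<longlonglongrightarrow> F x" by metis
  have tail: "\<exists>M. \<forall>n\<ge>M. \<forall>S. finite S \<longrightarrow> (\<Sum>x\<in>S. (norm (ell2_apply (X n) x - F x))\<^sup>2) \<le> e\<^sup>2"
    if e: "0 < e" for e :: real
  proof -
    obtain M where M: "\<And>m n. m \<ge> M \<Longrightarrow> n \<ge> M \<Longrightarrow> norm (X m - X n) < e"
      using CauchyD[OF X e] by metis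
    show ?thesis
    proof (intro exI allI impI)
      fix n and S :: "'a set" assume n: "n \<ge> M" and S: "finite S"
      have "(\<lambda>m. \<Sum>x\<in>S. (norm (ell2_apply (X n) x - ell2_apply (X m) x))\<^sup>2)
          \<longlonglongrightarrow> (\<Sum>x\<in>S. (norm (ell2_apply (X n) x - F x))\<^sup>2)"
        by (intro tendsto_intros F)
      moreover have "(\<Sum>x\<in>S. (norm (ell2_apply (X n) x - ell2_apply (X m) x))\<^sup>2) \<le> e\<^sup>2"
        if "m \<ge> M" for m
      proof -
        have "(\<Sum>x\<in>S. (norm (ell2_apply (X n) x - ell2_apply (X m) x))\<^sup>2) \<le> (norm (X n - X m))\<^sup>2"
          using sum_le_norm_ell2[OF S, of "X n - X m"] by (simp add: minus_ell2.rep_eq)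
        also have "\<dots> \<le> e\<^sup>2" using M[OF n that] by (intro power_mono) auto
        finally show ?thesis .
      qed
      ultimately show "(\<Sum>x\<in>S. (norm (ell2_apply (X n) x - F x))\<^sup>2) \<le> e\<^sup>2"
        by (blast intro: LIMSEQ_le_const2)
    qed
  qed
  have diff: "(\<lambda>x. (norm (ell2_apply (X n) x - F x))\<^sup>2) summable_on UNIV"
    if "\<forall>S. finite S \<longrightarrow> (\<Sum>x\<in>S. (norm (ell2_apply (X n) x - F x))\<^sup>2) \<le> e\<^sup>2" for n e
    using that by (intro nonneg_bdd_above_summable_on bdd_aboveI2[where M = "e\<^sup>2"]) auto
  obtain N where N: "\<forall>n\<ge>N. \<forall>S. finite S \<longrightarrow>
      (\<Sum>x\<in>S. (norm (ell2_apply (X n) x - F x))\<^sup>2) \<le> 1\<^sup>2"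
    using tail[OF zero_less_one] by (rule exE)
  have "(\<lambda>x. (norm (ell2_apply (X N) x - F x))\<^sup>2) summable_on UNIV"
    by (rule diff[OF spec[OF N, THEN mp, OF order_refl]])
  then have "(\<lambda>x. (norm (F x - ell2_apply (X N) x + ell2_apply (X N) x))\<^sup>2) summable_on UNIV"
    using ell2_apply[of "X N"]
    by (intro square_summable_add[of "\<lambda>x. F x - ell2_apply (X N) x" "ell2_apply (X N)"])
      (simp_all add: norm_minus_commute)
  then have Fs: "(\<lambda>x. (norm (F x))\<^sup>2) summable_on UNIV" by simp
  define L where "L = Abs_ell2 F"
  have L: "ell2_apply L = F" using Fs by (simp add: L_def Abs_ell2_inverse)
  have "X \<longlonglongrightarrow> L"
  proof (rule LIMSEQ_I)
    fix e :: real assume e: "0 < e"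
    then obtain M where M: "\<forall>n\<ge>M. \<forall>S. finite S \<longrightarrow>
        (\<Sum>x\<in>S. (norm (ell2_apply (X n) x - F x))\<^sup>2) \<le> (e/2)\<^sup>2"
      using tail[of "e/2"] by auto
    have "norm (X n - L) < e" if n: "n \<ge> M" for n
    proof -
      have "(norm (X n - L))\<^sup>2 \<le> (e/2)\<^sup>2"
        unfolding norm_ell2_square minus_ell2.rep_eq L
        using spec[OF M, THEN mp, OF n] by (intro infsum_le_finite_sums diff) simp_all
      then have "norm (X n - L) \<le> e/2" using e by (simp add: power2_le_iff_abs_le)
      then show ?thesis using e by linarith
    qed
    then show "\<exists>M. \<forall>n\<ge>M. norm (X n - L) < e" by blast
  qed
  then show "convergent X" by (rule convergentI)
qed

text \<open>\<open>delta x \<eta>\<close> is the function with value \<open>\<eta>\<close> at \<open>x\<close> and 0 elsewhere.\<close>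

lift_definition delta :: "'x \<Rightarrow> 'h::complex_inner \<Rightarrow> ('x, 'h) ell2"
  is "\<lambda>x \<eta> y. if y = x then \<eta> else 0"
proof -
  fix x :: 'x and \<eta> :: 'h
  have "(\<lambda>y. (norm (if y = x then \<eta> else 0))\<^sup>2) summable_on {x}" by simp
  then show "(\<lambda>y. (norm (if y = x then \<eta> else 0))\<^sup>2) summable_on UNIV"
    by (rule summable_on_cong_neutral[THEN iffD1, rotated -1]) auto
qed

definition support :: "('x, 'h::complex_inner) ell2 \<Rightarrow> 'x set" where
  "support \<xi> = {x. ell2_apply \<xi> x \<noteq> 0}"


section \<open>Roe algebras\<close>

type_synonym ('x, 'h) operator = "('x, 'h) ell2 \<Rightarrow>\<^sub>L ('x, 'h) ell2"

definition entry :: "('x, 'h::complex_hilbert) operator \<Rightarrow> 'x \<Rightarrow> 'x \<Rightarrow> 'h \<Rightarrow>\<^sub>L 'h" where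
  "entry a x y = (THE b. \<forall>\<xi> \<eta>.
     cinner (blinfun_apply b \<xi>) \<eta> = cinner (blinfun_apply a (delta x \<xi>)) (delta y \<eta>))"

lemma cinner_delta: "cinner f (delta y \<eta>) = cinner (ell2_apply f y) (\<eta> :: 'h::complex_inner)"
proof -
  have "cinner f (delta y \<eta>) = (\<Sum>\<^sub>\<infinity>x\<in>{y}. cinner (ell2_apply f x) (ell2_apply (delta y \<eta>) x))"
    unfolding cinner_ell2.rep_eq by (rule infsum_cong_neutral) (auto simp: delta.rep_eq)
  then show ?thesis by (simp add: delta.rep_eq)
qed

lemma norm_delta: "norm (delta x \<xi>) = norm (\<xi> :: 'h::complex_inner)"
proof -
  have "complex_of_real ((norm (delta x \<xi>))\<^sup>2) = complex_of_real ((norm \<xi>)\<^sup>2)"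
    unfolding cinner_self[symmetric] cinner_delta by (simp add: delta.rep_eq)
  then have "(norm (delta x \<xi>))\<^sup>2 = (norm \<xi>)\<^sup>2" using of_real_eq_iff by blast
  then show ?thesis by simp
qed

lemma entry_apply:
  fixes a :: "('x, 'h::complex_hilbert) operator"
  shows "blinfun_apply (entry a x y) \<xi> = ell2_apply (blinfun_apply a (delta x \<xi>)) y"
proof -
  have d: "bounded_linear (delta x :: 'h \<Rightarrow> ('x, 'h) ell2)"
  proof (rule bounded_linear_intro[where K = 1])
    show "delta x (\<xi> + \<eta>) = delta x \<xi> + delta x \<eta>" for \<xi> \<eta> :: 'h
      by (rule ell2_apply_inject[THEN iffD1]) (simp add: fun_eq_iff plus_ell2.rep_eq delta.rep_eq)
    show "delta x (r *\<^sub>R \<xi>) = r *\<^sub>R delta x \<xi>" for r and \<xi> :: 'h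
      by (rule ell2_apply_inject[THEN iffD1]) (simp add: fun_eq_iff scaleR_ell2.rep_eq delta.rep_eq)
    show "norm (delta x \<xi>) \<le> norm \<xi> * 1" for \<xi> :: 'h
      by (simp add: norm_delta)
  qed
  have e: "bounded_linear (\<lambda>f :: ('x, 'h) ell2. ell2_apply f y)"
    by (rule bounded_linear_intro[where K = 1])
      (simp_all add: plus_ell2.rep_eq scaleR_ell2.rep_eq norm_ell2_apply_le)
  define b where "b = Blinfun (\<lambda>\<xi>. ell2_apply (blinfun_apply a (delta x \<xi>)) y)"
  have b: "blinfun_apply b \<xi> = ell2_apply (blinfun_apply a (delta x \<xi>)) y" for \<xi>
    unfolding b_def
    by (rule bounded_linear_Blinfun_apply[THEN fun_cong], rule bounded_linear_compose[OF e],
        rule bounded_linear_compose[OF blinfun.bounded_linear_right d])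
  have "entry a x y = b"
    unfolding entry_def
  proof (rule the_equality)
    show "\<forall>\<xi> \<eta>. cinner (blinfun_apply b \<xi>) \<eta> = cinner (blinfun_apply a (delta x \<xi>)) (delta y \<eta>)"
      by (simp add: b cinner_delta)
    fix b' assume "\<forall>\<xi> \<eta>.
      cinner (blinfun_apply b' \<xi>) \<eta> = cinner (blinfun_apply a (delta x \<xi>)) (delta y \<eta>)"
    then show "b' = b" by - (rule blinfun_eqI, rule cinner_eqI, simp add: b cinner_delta)
  qed
  then show ?thesis by (simp add: b)
qed

text \<open>The propagation takes values in \<open>ennreal\<close>, so it is \<open>\<infinity>\<close> if unbounded and \<open>0\<close> for the zero operator.\<close>

definition propagation :: "('x::metric_space, 'h::complex_hilbert) operator \<Rightarrow> ennreal" where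
  "propagation a = Sup {ennreal (dist x y) | x y. entry a x y \<noteq> 0}"

definition BD :: "('x::metric_space, 'h::complex_hilbert) operator set" where
  "BD = closure {a \<in> \<B>. propagation a < \<infinity>}"

definition roe_algebra :: "('x::metric_space, 'h::complex_hilbert) operator set" where
  "roe_algebra = {a \<in> BD. \<forall>x y. compact_operator (entry a x y)}"

definition ell_infty :: "(nat \<Rightarrow> 'h::complex_hilbert) \<Rightarrow> ('x::metric_space, 'h) operator set" where
  "ell_infty \<xi> = {a \<in> \<B>. \<forall>x. \<exists>l :: nat \<Rightarrow> complex. l \<longlonglongrightarrow> 0 \<and>
     (\<forall>n. blinfun_apply a (delta x (\<xi> n)) = l n *\<^sub>C delta x (\<xi> n))}"

definition uniformly_locally_finite :: "'x::metric_space itself \<Rightarrow> bool" where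
  "uniformly_locally_finite _ \<longleftrightarrow>
     (\<forall>r>0. \<exists>N. \<forall>x :: 'x. finite (cball x r) \<and> card (cball x r) \<le> N)"

text \<open>
  Property A in the form of the operator norm localisation property. Boundedness of the
  support is required explicitly since \<open>diameter\<close> is only meaningful on bounded sets.
\<close>

definition property_A :: "'x::metric_space itself \<Rightarrow> 'h::complex_hilbert itself \<Rightarrow> bool" where
  "property_A _ _ \<longleftrightarrow>
     (\<forall>s>0. \<forall>\<rho>\<in>{0<..<1}. \<exists>r>0. \<forall>a :: ('x, 'h) operator.
        a \<in> \<B> \<longrightarrow> propagation a \<le> ennreal s \<longrightarrow>
        (\<exists>\<xi>. norm \<xi> = 1 \<and> bounded (support \<xi>) \<and> diameter (support \<xi>) \<le> r \<and>
             norm (blinfun_apply a \<xi>) \<ge> \<rho> * norm a))"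

end

theory Submission
  imports Defs
begin

text \<open>
  The Roe algebra contains every rank-one operator, so an automorphism \<open>\<Phi>\<close> of it is conjugation by a
  unitary \<open>u\<close> (\<open>star_automorphism_roe_implemented\<close>), and the question is how \<open>u\<close> moves the blocks
  \<open>\<delta>\<^sub>x \<otimes> H\<close>. Up to a factor in \<open>BD\<close> it moves them along a map \<open>f\<close> from \<open>X\<close> to itself: if \<open>w\<close> is a
  unitary that permutes the bases, sending \<open>\<delta>\<^sub>x \<otimes> \<xi>\<^sub>n\<close> to some \<open>\<delta>\<^sub>y \<otimes> \<zeta>\<^sub>m\<close> with \<open>y\<close> at bounded
  distance from \<open>f x\<close>, then \<open>u w\<^sup>*\<close> lies in \<open>BD\<close> (\<open>covering_unitary_mod_BD\<close>). Hence so does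
  \<open>v = w u\<^sup>*\<close>, and \<open>Ad v \<circ> \<Phi> = Ad w\<close> carries the operators that are diagonal in the first basis onto
  those that are diagonal in the second. Null sequences go to null sequences because every block is
  fed by finitely many blocks only, in both directions (\<open>Ad_ell_infty\<close>).

  Uniformity (\<open>blocks_uniformly_approximable\<close>). For each \<open>e > 0\<close> a single \<open>s\<close> works for all
  block-diagonal contractions \<open>a\<close>: the operator \<open>u a u\<^sup>*\<close> is within \<open>e\<close> of one of propagation at most
  \<open>s\<close>. For compact blocks \<open>a\<close> lies in the Roe algebra, so that each single \<open>u a u\<^sup>*\<close> has some \<open>s\<close>; a
  Baire category argument over the product of the unit balls of the blocks makes \<open>s\<close> uniform, and
  weak limits remove compactness. The category argument leaves finitely many blocks uncontrolled;
  those are handled by \<open>column_decay\<close>: each \<open>u (\<delta>\<^sub>x \<otimes> H)\<close> is supported in a finite set up to a small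
  error.

  Concentration (\<open>roe_normalizer_concentrated\<close>). Norm localisation, applied to the rank-one
  projections onto the vectors \<open>u (\<delta>\<^sub>x \<otimes> \<eta>)\<close>, shows that each of these vectors is nearly supported in
  a ball whose radius does not depend on \<open>x\<close> and \<open>\<eta>\<close>. The rank-one operators between two vectors with
  the same \<open>x\<close> are uniformly approximable as well, hence their balls are close, and one centre \<open>f x\<close>
  serves the whole block. The same statement for \<open>u\<^sup>*\<close> shows that \<open>f\<close> has fibres of bounded
  size (\<open>concentrated_fibres_bounded\<close>) and cobounded range (\<open>concentrated_cobounded\<close>), which is
  what the construction of \<open>w\<close> needs.

  Comparison. Let \<open>q\<^sub>x\<close> be the conjugate by \<open>u\<close> of the projection \<open>\<chi>\<^sub>x\<close> onto the block at \<open>x\<close>, and let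
  \<open>y\<^sub>x = \<chi>\<^bsub>B(f x)\<^esub> u \<chi>\<^sub>x w\<^sup>*\<close>, with a ball of fixed radius around \<open>f x\<close>. For signs \<open>\<lambda>\<^sub>x\<close> the operator
  \<open>\<Sum> \<lambda>\<^sub>x q\<^sub>x\<close> is uniformly approximable, and \<open>\<Sum> \<lambda>\<^sub>x y\<^sub>x\<close> has bounded propagation and bounded norm because
  the balls overlap boundedly often. Averaging the product of the two sums over all signs leaves
  \<open>\<Sum> q\<^sub>x y\<^sub>x\<close>, which is therefore in \<open>BD\<close>. It equals \<open>u l w\<^sup>*\<close> for a block-diagonal \<open>l\<close> at distance at
  most \<open>1/2\<close> from the identity, and a geometric series recovers \<open>u w\<^sup>*\<close>.
\<close>

section \<open>Complex-linear bounded operators\<close>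

lemma bounded_bilinear_cinner: "bounded_bilinear (cinner :: 'a::complex_inner \<Rightarrow> 'a \<Rightarrow> complex)"
proof
  show "\<exists>K. \<forall>a b :: 'a. norm (cinner a b) \<le> norm a * norm b * K"
    by (rule exI[of _ 1]) (simp add: norm_cinner_le)
qed (simp_all add: cinner_add_left cinner_add_right scaleR_eq_scaleC[where 'a='a]
    cinner_scaleC_left cinner_scaleC_right scaleR_conv_of_real)

lemmas cinner_diff_left = bounded_bilinear.diff_left[OF bounded_bilinear_cinner]
  and cinner_diff_right = bounded_bilinear.diff_right[OF bounded_bilinear_cinner]
  and cinner_sum_left = bounded_bilinear.sum_left[OF bounded_bilinear_cinner]
  and tendsto_cinner = bounded_bilinear.tendsto[OF bounded_bilinear_cinner]

lemma cinner_eqI_right: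
  assumes "\<And>z. cinner z x = cinner z (y :: 'a::complex_inner)"
  shows "x = y"
  by (rule cinner_eqI) (metis assms cinner_commute)

lemma cblinfunD: "a \<in> \<B> \<Longrightarrow> a (c *\<^sub>C x) = c *\<^sub>C a x"
  by (simp add: cblinfuns_def)

lemma scaleC_zero_right [simp]: "c *\<^sub>C (0 :: 'a::complex_inner) = 0"
  using norm_scaleC[of c "0 :: 'a"] by simp

lemma scaleC_zero_left [simp]: "0 *\<^sub>C (x :: 'a::complex_inner) = 0"
  using norm_scaleC[of 0 x] by simp

lemma scaleC_diff_right: "c *\<^sub>C (x - y) = c *\<^sub>C x - c *\<^sub>C (y :: 'a::complex_inner)"
  by (metis add_diff_cancel diff_add_cancel scaleC_add_right)

lemma cblin_0 [simp]: "0 \<in> \<B>"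
  and cblin_id [simp]: "id_blinfun \<in> \<B>"
  and cblin_add: "a \<in> \<B> \<Longrightarrow> b \<in> \<B> \<Longrightarrow> a + b \<in> \<B>"
  and cblin_diff: "a \<in> \<B> \<Longrightarrow> b \<in> \<B> \<Longrightarrow> a - b \<in> \<B>"
  and cblin_scaleR: "a \<in> \<B> \<Longrightarrow> r *\<^sub>R a \<in> \<B>"
  by (simp_all add: cblinfuns_def blinfun.add_left blinfun.diff_left
      blinfun.scaleR_left scaleC_add_right scaleC_diff_right
      scaleR_eq_scaleC scaleC_scaleC mult.commute)

lemma cblin_compose: "a \<in> \<B> \<Longrightarrow> b \<in> \<B> \<Longrightarrow> a o\<^sub>L b \<in> \<B>"
  by (simp add: cblinfuns_def)

lemma cblin_sum: "(\<And>i. i \<in> I \<Longrightarrow> a i \<in> \<B>) \<Longrightarrow> (\<Sum>i\<in>I. a i) \<in> \<B>"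
  by (induction I rule: infinite_finite_induct) (simp_all add: cblin_add)

lemma closed_cblinfuns: "closed (\<B> :: ('a::complex_inner \<Rightarrow>\<^sub>L 'b::complex_inner) set)"
proof -
  have eq: "\<B> = (\<Inter>c. \<Inter>x. {a :: 'a \<Rightarrow>\<^sub>L 'b. a (c *\<^sub>C x) = c *\<^sub>C a x})"
    by (auto simp: cblinfuns_def)
  have "closed {a :: 'a \<Rightarrow>\<^sub>L 'b. a (c *\<^sub>C x) = c *\<^sub>C a x}" for c x
    by (intro closed_Collect_eq bounded_linear.continuous_on[OF bounded_linear_scaleC]
        continuous_intros)
  then show ?thesis unfolding eq by blast
qed

lemma norm_blinfun_le:
  fixes a :: "'a::real_normed_vector \<Rightarrow>\<^sub>L 'b::real_normed_vector"
  shows "norm a \<le> M \<Longrightarrow> norm (a x) \<le> M * norm x"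
  by (meson mult_right_mono norm_blinfun norm_ge_zero order_trans)

text \<open>
  Norm bounds read off from matrix coefficients survive weak limits.
\<close>

lemma norm_blinfun_cinner_bound:
  fixes a :: "'a::complex_inner \<Rightarrow>\<^sub>L 'b::complex_inner"
  assumes "0 \<le> M" and "\<And>x y. norm (cinner (a x) y) \<le> M * norm x * norm y"
  shows "norm a \<le> M"
proof (rule norm_blinfun_bound[OF \<open>0 \<le> M\<close>])
  fix x
  have "norm (a x) * norm (a x) = norm (cinner (a x) (a x))"
    unfolding cinner_self norm_of_real by (simp add: power2_eq_square)
  also have "\<dots> \<le> (M * norm x) * norm (a x)" by (rule assms)
  finally show "norm (a x) \<le> M * norm x"
    using assms(1) by (cases "a x = 0") simp_all
qed

text \<open>
  The Riesz theorem as a construction principle. Weak limits of operators and unitaries between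
  orthonormal bases are both obtained by first writing down their matrix coefficients.
\<close>

lemma cblinfun_of_form:
  fixes B :: "'a::complex_inner \<Rightarrow> 'b::complex_hilbert \<Rightarrow> complex"
  assumes add_left: "\<And>x y z. B (x + y) z = B x z + B y z"
    and add_right: "\<And>x y z. B x (y + z) = B x y + B x z"
    and scale_left: "\<And>c x y. B (c *\<^sub>C x) y = c * B x y"
    and scale_right: "\<And>c x y. B x (c *\<^sub>C y) = cnj c * B x y"
    and "0 \<le> M" and bound: "\<And>x y. norm (B x y) \<le> M * norm x * norm y"
  obtains a where "a \<in> \<B>" "\<And>x y. cinner (a x) y = B x y"
proof -
  have "\<exists>z. \<forall>y. Re (B x y) = inner y z" for x
  proof -
    have "bounded_linear (\<lambda>y. Re (B x y))"
    proof (rule bounded_linear_intro[where K = "M * norm x"])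
      show "norm (Re (B x y)) \<le> norm y * (M * norm x)" for y
        using order_trans[OF abs_Re_le_cmod bound[of x y]] by (simp add: mult.commute)
    qed (simp_all add: add_right scaleR_eq_scaleC[where 'a='b] scale_right)
    then show ?thesis by (metis riesz_real)
  qed
  then obtain g where g: "\<And>x y. Re (B x y) = inner y (g x)" by metis
  have gB: "cinner (g x) y = B x y" for x y
  proof (rule complex_eqI)
    show "Re (cinner (g x) y) = Re (B x y)"
      unfolding g by (subst inner_commute) (simp add: inner_eq_Re_cinner)
    have "Re (cinner (g x) (\<i> *\<^sub>C y)) = Re (B x (\<i> *\<^sub>C y))"
      unfolding g by (subst inner_commute) (simp add: inner_eq_Re_cinner)
    then show "Im (cinner (g x) y) = Im (B x y)"
      by (simp add: cinner_scaleC_right scale_right)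
  qed
  have bl: "bounded_linear g"
  proof (rule bounded_linear_intro[where K = M])
    show "g (x + y) = g x + g y" for x y
      by (rule cinner_eqI) (simp add: gB add_left cinner_add_left)
    show "g (r *\<^sub>R x) = r *\<^sub>R g x" for r x
      by (rule cinner_eqI) (simp add: gB scaleR_eq_scaleC scale_left cinner_scaleC_left)
    show "norm (g x) \<le> norm x * M" for x
    proof (cases "g x = 0")
      case True
      then show ?thesis using \<open>0 \<le> M\<close> by simp
    next
      case False
      have "norm (g x) * norm (g x) = norm (cinner (g x) (g x))"
        unfolding cinner_self norm_of_real by (simp add: power2_eq_square)
      also have "\<dots> \<le> (M * norm x) * norm (g x)" unfolding gB by (rule bound)
      finally show ?thesis using False by (simp add: mult.commute)
    qed
  qed
  show thesis
  proof
    show "Blinfun g \<in> \<B>"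
      unfolding cblinfuns_def mem_Collect_eq bounded_linear_Blinfun_apply[OF bl]
      by (rule allI, rule allI, rule cinner_eqI) (simp add: gB cinner_scaleC_left scale_left)
    show "cinner (Blinfun g x) y = B x y" for x y
      by (simp add: bounded_linear_Blinfun_apply[OF bl] gB)
  qed
qed

lemma adj_unique:
  fixes a :: "'a::complex_hilbert \<Rightarrow>\<^sub>L 'b::complex_hilbert" and b :: "'b \<Rightarrow>\<^sub>L 'a"
  assumes "a \<in> \<B>" and "\<And>x y. cinner (a x) y = cinner x (b y)"
  shows "adj a = b"
  by (rule blinfun_eqI, rule cinner_eqI_right) (simp add: assms(2)[symmetric] cinner_adj[OF assms(1)])

lemma cblin_adj: "a \<in> \<B> \<Longrightarrow> adj a \<in> \<B>"
  unfolding cblinfuns_def[where 'b='a] mem_Collect_eq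
  by (rule allI, rule allI, rule cinner_eqI_right)
    (simp add: cinner_adj[symmetric] cinner_scaleC_right)

lemma cinner_adj': "a \<in> \<B> \<Longrightarrow> cinner (adj a x) y = cinner x (a y)"
  by (metis cinner_adj cinner_commute)

lemma adj_adj: "a \<in> \<B> \<Longrightarrow> adj (adj a) = a"
  by (rule adj_unique) (simp_all add: cblin_adj cinner_adj')

lemma adj_compose: "a \<in> \<B> \<Longrightarrow> b \<in> \<B> \<Longrightarrow> adj (a o\<^sub>L b) = adj b o\<^sub>L adj a"
  by (rule adj_unique) (simp_all add: cblin_compose cinner_adj)

lemma adj_diff: "a \<in> \<B> \<Longrightarrow> b \<in> \<B> \<Longrightarrow> adj (a - b) = adj a - adj b"
  by (rule adj_unique)
    (simp_all add: cblin_diff cinner_adj blinfun.diff_left cinner_diff_left cinner_diff_right)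

lemma norm_adj_le:
  assumes "a \<in> \<B>" shows "norm (adj a) \<le> norm a"
proof (rule norm_blinfun_cinner_bound)
  fix x y
  have "norm (cinner (adj a x) y) = norm (cinner x (a y))" by (simp add: cinner_adj'[OF assms])
  also have "\<dots> \<le> norm x * (norm a * norm y)"
    by (rule order_trans[OF norm_cinner_le mult_left_mono[OF norm_blinfun]]) simp
  finally show "norm (cinner (adj a x) y) \<le> norm a * norm x * norm y" by (simp add: ac_simps)
qed simp

lemma unitary_cblin: "unitary u \<Longrightarrow> u \<in> \<B>"
  by (simp add: unitary_def)

lemma unitary_adj_apply [simp]:
  assumes "unitary u" shows "adj u (u x) = x" "u (adj u x) = x"
  using assms unfolding unitary_def
  by (metis blinfun_apply_blinfun_compose blinfun_apply_id_blinfun id_apply)+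

lemma unitary_adj: "unitary u \<Longrightarrow> unitary (adj u)"
  by (simp add: unitary_def cblin_adj adj_adj)

lemma unitary_norm:
  assumes "unitary u" shows "norm (u x) = norm x"
proof -
  have "complex_of_real ((norm (u x))\<^sup>2) = complex_of_real ((norm x)\<^sup>2)"
    using assms by (simp only: cinner_self[symmetric])
      (simp add: cinner_adj[OF unitary_cblin[OF assms]])
  then have "(norm (u x))\<^sup>2 = (norm x)\<^sup>2" using of_real_eq_iff by blast
  then show ?thesis by simp
qed

lemma unitary_norm_le: "unitary u \<Longrightarrow> norm u \<le> 1"
  by (rule norm_blinfun_bound) (simp_all add: unitary_norm)

lemma unitaryI:
  fixes u :: "'a::complex_hilbert \<Rightarrow>\<^sub>L 'a"
  assumes "u \<in> \<B>" and iso: "\<And>x y. cinner (u x) (u y) = cinner x y"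
    and surj: "\<And>y. \<exists>x. u x = y"
  shows "unitary u"
proof -
  have 1: "adj u (u x) = x" for x
    by (rule cinner_eqI) (simp add: cinner_adj'[OF assms(1)] iso)
  have "u (adj u y) = y" for y
    using surj[of y] 1 by auto
  with 1 show ?thesis
    using assms(1) by (auto simp: unitary_def intro: blinfun_eqI)
qed

definition rank_one :: "'a::complex_inner \<Rightarrow> 'b::complex_inner \<Rightarrow> 'b \<Rightarrow>\<^sub>L 'a" where
  "rank_one h k = Blinfun (\<lambda>z. cinner z k *\<^sub>C h)"

lemma rank_one_apply [simp]: "rank_one h k z = cinner z k *\<^sub>C h"
proof -
  have "bounded_linear (\<lambda>z. cinner z k *\<^sub>C h)"
  proof (rule bounded_linear_intro[where K = "norm k * norm h"])
    show "norm (cinner z k *\<^sub>C h) \<le> norm z * (norm k * norm h)" for z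
      using mult_right_mono[OF norm_cinner_le[of z k], of "norm h"]
      by (simp add: norm_scaleC mult.assoc)
  qed (simp_all add: cinner_add_left scaleC_add_left scaleR_eq_scaleC scaleC_scaleC
      cinner_scaleC_left)
  then show ?thesis by (simp add: rank_one_def bounded_linear_Blinfun_apply)
qed

lemma cblin_rank_one [simp]: "rank_one h k \<in> \<B>"
  by (simp add: cblinfuns_def cinner_scaleC_left scaleC_scaleC)

lemma norm_rank_one_le: "norm (rank_one h k) \<le> norm h * norm k"
proof (rule norm_blinfun_bound)
  show "norm (rank_one h k z) \<le> norm h * norm k * norm z" for z
    using mult_right_mono[OF norm_cinner_le[of z k], of "norm h"]
    by (simp add: norm_scaleC ac_simps)
qed simp

lemma adj_rank_one: "adj (rank_one h k) = rank_one k h"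
proof (rule adj_unique)
  show "cinner (rank_one h k x) y = cinner x (rank_one k h y)" for x y
    by (simp add: cinner_scaleC_left cinner_scaleC_right)
      (metis cinner_commute mult.commute)
qed simp

lemma compact_operatorI:
  fixes a :: "'a::complex_inner \<Rightarrow>\<^sub>L 'b::complex_inner"
  assumes "compact K" and "\<And>x. norm x \<le> 1 \<Longrightarrow> a x \<in> K"
  shows "compact_operator a"
proof -
  have "a ` cball 0 1 \<subseteq> K" using assms(2) by auto
  then have "closure (a ` cball 0 1) \<subseteq> K"
    by (rule closure_minimal) (rule compact_imp_closed[OF assms(1)])
  then show ?thesis
    unfolding compact_operator_def
    by (metis assms(1) closed_Int_compact closed_closure inf.absorb1)
qed

lemma compact_operator_0 [simp]: "compact_operator 0"
  by (rule compact_operatorI[of "{0}"]) simp_all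

text \<open>
  A Minkowski sum of finitely many compact sets is compact. This turns compactness of finitely
  many entries, or of finitely many coordinates, into compactness of the whole operator.
\<close>

lemma compact_finite_sums:
  fixes C :: "'i \<Rightarrow> 'a::real_normed_vector set"
  assumes "finite J" and "\<And>i. compact (C i)"
  shows "\<exists>L. compact L \<and> (\<forall>f. (\<forall>i\<in>J. f i \<in> C i) \<longrightarrow> (\<Sum>i\<in>J. f i) \<in> L)"
  using assms(1)
proof (induction J rule: finite_induct)
  case empty
  show ?case by (rule exI[of _ "{0}"]) simp
next
  case (insert j J)
  then obtain L where L: "compact L" "\<And>f. (\<forall>i\<in>J. f i \<in> C i) \<Longrightarrow> (\<Sum>i\<in>J. f i) \<in> L" by blast
  have "(\<Sum>i\<in>insert j J. f i) \<in> {x + y | x y. x \<in> C j \<and> y \<in> L}"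
    if "\<forall>i\<in>insert j J. f i \<in> C i" for f
    using that L(2)[of f] insert.hyps by (simp add: mem_Collect_eq) blast
  moreover have "compact {x + y | x y. x \<in> C j \<and> y \<in> L}"
    by (rule compact_sums[OF assms(2) L(1)])
  ultimately show ?case by blast
qed

lemma compact_operator_finite_rank:
  fixes a :: "'a::complex_inner \<Rightarrow>\<^sub>L 'b::complex_inner"
  assumes "finite I" and "\<And>x. a x = (\<Sum>i\<in>I. c i x *\<^sub>C v i)"
    and "\<And>i x. i \<in> I \<Longrightarrow> norm (c i x) \<le> M * norm x"
  shows "compact_operator a"
proof (cases "M \<ge> 0")
  case False
  { fix x :: 'a assume "norm x \<le> 1"
    have "c i x = 0" if "i \<in> I" for i
      using assms(3)[OF that, of x] False
      by (metis linorder_not_le mult_nonpos_nonneg norm_ge_zero norm_le_zero_iff order.trans less_imp_le)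
    then have "a x = 0" by (simp add: assms(2)) }
  then show ?thesis by (intro compact_operatorI[of "{0}"]) simp_all
next
  case True
  have cont: "continuous_on UNIV (\<lambda>t. t *\<^sub>C v i)" for i
    by (rule bounded_linear.continuous_on[OF _ continuous_on_id])
      (rule bounded_linear_intro[where K = "norm (v i)"],
       simp_all add: scaleC_add_left scaleR_eq_scaleC scaleC_scaleC scaleC_complex_def norm_scaleC)
  have cK: "compact ((\<lambda>t. t *\<^sub>C v i) ` cball 0 M)" for i
    by (rule compact_continuous_image[OF continuous_on_subset[OF cont]]) auto
  obtain L where L: "compact L \<and>
      (\<forall>f. (\<forall>i\<in>I. f i \<in> (\<lambda>t. t *\<^sub>C v i) ` cball 0 M) \<longrightarrow> (\<Sum>i\<in>I. f i) \<in> L)"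
    using compact_finite_sums[OF assms(1) cK] by (rule exE)
  show ?thesis
  proof (rule compact_operatorI[OF conjunct1[OF L]])
    fix x :: 'a assume x: "norm x \<le> 1"
    show "a x \<in> L"
      unfolding assms(2)
    proof (rule mp[OF spec[OF conjunct2[OF L]]], intro ballI imageI)
      fix i assume "i \<in> I"
      then have "norm (c i x) \<le> M * norm x" by (rule assms(3))
      also have "\<dots> \<le> M * 1" by (rule mult_left_mono[OF x True])
      finally show "c i x \<in> cball 0 M" by simp
    qed
  qed
qed

section \<open>Square-summable functions and block-diagonal operators\<close>

lemma ell2_eqI: "(\<And>x. ell2_apply f x = ell2_apply g x) \<Longrightarrow> f = g"
  by (rule ell2_apply_inject[THEN iffD1], rule ext)

lemmas ell2_simps [simp] = zero_ell2.rep_eq plus_ell2.rep_eq minus_ell2.rep_eq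
  uminus_ell2.rep_eq scaleC_ell2.rep_eq scaleR_ell2.rep_eq delta.rep_eq

lemma ell2_sum [simp]: "ell2_apply (\<Sum>i\<in>I. f i) x = (\<Sum>i\<in>I. ell2_apply (f i) x)"
  by (induction I rule: infinite_finite_induct) simp_all

lemma ell2_summable: "(\<lambda>x. (norm (ell2_apply f x))\<^sup>2) summable_on UNIV"
  using ell2_apply[of f] by simp

lemma delta_0 [simp]: "delta x 0 = 0"
  by (rule ell2_eqI) simp

lemma delta_scaleC: "delta x (c *\<^sub>C \<eta>) = c *\<^sub>C delta x \<eta>"
  by (rule ell2_eqI) simp

lemma norm_ell2_le:
  fixes f :: "('x, 'a::complex_inner) ell2" and g :: "('x, 'b::complex_inner) ell2"
  assumes "0 \<le> K" and "\<And>x. norm (ell2_apply f x) \<le> K * norm (ell2_apply g x)"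
  shows "norm f \<le> K * norm g"
proof -
  have "(norm f)\<^sup>2 \<le> (\<Sum>\<^sub>\<infinity>x. K\<^sup>2 * (norm (ell2_apply g x))\<^sup>2)"
    unfolding norm_ell2_square
    by (intro infsum_mono ell2_summable summable_on_cmult_right)
      (metis assms(2) norm_ge_zero power_mono power_mult_distrib)
  also have "\<dots> = (K * norm g)\<^sup>2"
    by (simp add: infsum_cmult_right' norm_ell2_square power_mult_distrib)
  finally show ?thesis using assms(1) by (simp add: power2_le_iff_abs_le)
qed

text \<open>
  The function \<open>x \<mapsto> a x (f x)\<close> is square-summable when the blocks are uniformly bounded; without a
  bound the value is arbitrary, so the lemmas about \<open>bdiag\<close> carry one.
\<close>

definition bdiag :: "('x \<Rightarrow> 'h \<Rightarrow>\<^sub>L 'h) \<Rightarrow> ('x, 'h::complex_hilbert) operator" where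
  "bdiag a = Blinfun (\<lambda>f. Abs_ell2 (\<lambda>x. a x (ell2_apply f x)))"

lemma bdiag_apply:
  fixes a :: "'x \<Rightarrow> 'h::complex_hilbert \<Rightarrow>\<^sub>L 'h"
  assumes a: "\<And>x. norm (a x) \<le> K"
  shows "ell2_apply (bdiag a f) x = a x (ell2_apply f x)"
proof -
  have K: "0 \<le> K" using a norm_ge_zero order_trans by blast
  have rep: "ell2_apply (Abs_ell2 (\<lambda>x. a x (ell2_apply f x))) = (\<lambda>x. a x (ell2_apply f x))" for f
  proof (rule Abs_ell2_inverse, simp only: mem_Collect_eq, rule summable_on_comparison_test)
    show "(\<lambda>x. K\<^sup>2 * (norm (ell2_apply f x))\<^sup>2) summable_on UNIV"
      by (intro summable_on_cmult_right ell2_summable)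
    show "(norm (a x (ell2_apply f x)))\<^sup>2 \<le> K\<^sup>2 * (norm (ell2_apply f x))\<^sup>2" for x
      using power_mono[OF norm_blinfun_le[OF a[of x], of "ell2_apply f x"], of 2]
      by (simp add: power_mult_distrib)
  qed simp
  define T where "T f = Abs_ell2 (\<lambda>x. a x (ell2_apply f x))" for f
  have T: "ell2_apply (T f) x = a x (ell2_apply f x)" for f x by (simp add: T_def rep)
  have "bounded_linear T"
  proof (rule bounded_linear_intro[where K = K])
    show "norm (T f) \<le> norm f * K" for f
      by (subst mult.commute, rule norm_ell2_le[OF K]) (simp add: T norm_blinfun_le a)
  qed (rule ell2_eqI, simp add: T blinfun.add_right blinfun.scaleR_right)+
  then show ?thesis by (simp add: bdiag_def T_def[symmetric] bounded_linear_Blinfun_apply T)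
qed

lemma norm_bdiag_le:
  assumes "\<And>x. norm (a x) \<le> K" shows "norm (bdiag a) \<le> K"
proof -
  have K: "0 \<le> K" using assms norm_ge_zero order_trans by blast
  show ?thesis
    by (intro norm_blinfun_bound norm_ell2_le K)
      (simp add: bdiag_apply[OF assms] norm_blinfun_le assms)
qed

lemma cblin_bdiag:
  assumes "\<And>x. norm (a x) \<le> K" "\<And>x. a x \<in> \<B>" shows "bdiag a \<in> \<B>"
  unfolding cblinfuns_def mem_Collect_eq
  by (rule allI, rule allI, rule ell2_eqI) (simp add: bdiag_apply[OF assms(1)] cblinfunD assms(2))

text \<open>
Multiplication by the characteristic function of \<open>A\<close>.
\<close>

definition chi :: "'x set \<Rightarrow> ('x, 'h::complex_hilbert) operator" where
  "chi A = bdiag (\<lambda>x. if x \<in> A then id_blinfun else 0)"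

lemma chi_apply [simp]:
  fixes f :: "('x, 'h::complex_hilbert) ell2"
  shows "ell2_apply (chi A f) x = (if x \<in> A then ell2_apply f x else 0)"
proof -
  have "norm (if x \<in> A then id_blinfun else 0 :: 'h \<Rightarrow>\<^sub>L 'h) \<le> 1" for x
    by (simp add: norm_blinfun_id_le)
  then show ?thesis unfolding chi_def by (subst bdiag_apply) auto
qed

lemma cblin_chi [simp]: "chi A \<in> \<B>"
  unfolding cblinfuns_def mem_Collect_eq by (rule allI, rule allI, rule ell2_eqI) simp

lemma norm_chi_le: "norm (chi A f) \<le> norm f"
  using norm_ell2_le[of 1 "chi A f" f] by simp

lemma norm_chi_le_1: "norm (chi A) \<le> 1"
  by (rule norm_blinfun_bound) (simp_all add: norm_chi_le)

lemma norm_chi_mono: "A \<subseteq> B \<Longrightarrow> norm (chi A f) \<le> norm (chi B f)"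
  by (rule norm_ell2_le[of 1, unfolded mult_1]) auto

lemma chi_chi [simp]: "chi A (chi B f) = chi (A \<inter> B) f"
  by (rule ell2_eqI) simp

lemma chi_UNIV [simp]: "chi UNIV f = f" and chi_empty [simp]: "chi {} f = 0"
  by (rule ell2_eqI, simp)+

lemma chi_compl: "chi (- A) f = f - chi A f"
  by (rule ell2_eqI) simp

lemma chi_delta [simp]: "chi A (delta x \<eta>) = (if x \<in> A then delta x \<eta> else 0)"
  by (rule ell2_eqI) simp

lemma chi_finite: "finite F \<Longrightarrow> chi F f = (\<Sum>x\<in>F. delta x (ell2_apply f x))"
  by (rule ell2_eqI) (simp add: if_distrib cong: if_cong)

lemma cinner_chi: "cinner (chi A f) g = cinner f (chi A g)"
  unfolding cinner_ell2.rep_eq by (rule infsum_cong) simp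

lemma adj_chi: "adj (chi A) = chi A"
  by (rule adj_unique) (simp_all add: cinner_chi)

lemma norm_chi_square_add:
  "A \<inter> B = {} \<Longrightarrow> (norm (chi (A \<union> B) f))\<^sup>2 = (norm (chi A f))\<^sup>2 + (norm (chi B f))\<^sup>2"
proof -
  assume AB: "A \<inter> B = {}"
  have *: "chi (A \<union> B) f = chi A f + chi B f"
    using AB by (intro ell2_eqI) auto
  have "cinner (chi A f) (chi B f) = 0"
    using AB by (simp add: cinner_chi)
  then have "orthogonal (chi A f) (chi B f)"
    by (simp add: orthogonal_def inner_eq_Re_cinner)
  then show ?thesis unfolding * by (rule norm_add_Pythagorean)
qed

lemma norm_square_chi: "(norm f)\<^sup>2 = (norm (chi A f))\<^sup>2 + (norm (chi (- A) f))\<^sup>2"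
  using norm_chi_square_add[of A "- A" f] by simp

lemma norm_square_le_chi_cover:
  assumes "A \<union> B = UNIV"
  shows "(norm f)\<^sup>2 \<le> (norm (chi A f))\<^sup>2 + (norm (chi B f))\<^sup>2"
proof -
  have "(norm (chi (- A) f))\<^sup>2 \<le> (norm (chi B f))\<^sup>2"
    using assms by (intro power_mono norm_chi_mono) auto
  then show ?thesis using norm_square_chi[of f A] by linarith
qed

lemma norm_chi_finite_square:
  assumes "finite F"
  shows "(norm (chi F f))\<^sup>2 = (\<Sum>x\<in>F. (norm (ell2_apply f x))\<^sup>2)"
proof -
  have "(norm (chi F f))\<^sup>2 = (\<Sum>\<^sub>\<infinity>x\<in>F. (norm (ell2_apply f x))\<^sup>2)"
    unfolding norm_ell2_square by (rule infsum_cong_neutral) auto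
  then show ?thesis using assms by simp
qed

lemma chi_tendsto: "((\<lambda>F. chi F f) \<longlongrightarrow> f) (finite_subsets_at_top UNIV)"
proof -
  have "((\<lambda>F. \<Sum>x\<in>F. (norm (ell2_apply f x))\<^sup>2) \<longlongrightarrow> (norm f)\<^sup>2) (finite_subsets_at_top UNIV)"
    using has_sum_infsum[OF ell2_summable[of f]]
    unfolding has_sum_def norm_ell2_square .
  then have "((\<lambda>F. sqrt ((norm f)\<^sup>2 - (\<Sum>x\<in>F. (norm (ell2_apply f x))\<^sup>2)))
      \<longlongrightarrow> sqrt ((norm f)\<^sup>2 - (norm f)\<^sup>2)) (finite_subsets_at_top UNIV)"
    by (intro tendsto_intros)
  moreover have "\<forall>\<^sub>F F in finite_subsets_at_top UNIV.
      sqrt ((norm f)\<^sup>2 - (\<Sum>x\<in>F. (norm (ell2_apply f x))\<^sup>2)) = norm (chi F f - f)"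
  proof (rule eventually_finite_subsets_at_top_weakI)
    fix F :: "'a set" assume "finite F"
    then have "(norm f)\<^sup>2 - (\<Sum>x\<in>F. (norm (ell2_apply f x))\<^sup>2) = (norm (chi F f - f))\<^sup>2"
      using norm_square_chi[of f F]
      by (simp add: norm_chi_finite_square chi_compl norm_minus_commute)
    then show "sqrt ((norm f)\<^sup>2 - (\<Sum>x\<in>F. (norm (ell2_apply f x))\<^sup>2)) = norm (chi F f - f)"
      by simp
  qed
  ultimately have "((\<lambda>F. norm (chi F f - f)) \<longlongrightarrow> 0) (finite_subsets_at_top UNIV)"
    by (simp add: tendsto_cong)
  then show ?thesis by (rule LIM_zero_cancel[OF tendsto_norm_zero_cancel])
qed

text \<open>
  Block-diagonal contractions that agree with \<open>a\<close> on ever larger finite sets converge strongly to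
  \<open>a\<close>, whatever they do elsewhere: the error on \<open>f\<close> is at most twice the tail of \<open>f\<close>. This is convergence
  in the product topology of discrete blocks.
\<close>

lemma bdiag_tendsto:
  fixes a :: "'x \<Rightarrow> 'h::complex_hilbert \<Rightarrow>\<^sub>L 'h"
  assumes a: "\<And>x. norm (a x) \<le> 1" and A: "\<And>F x. norm (A F x) \<le> 1"
    and agree: "\<And>F x. finite F \<Longrightarrow> x \<in> F \<Longrightarrow> A F x = a x"
  shows "((\<lambda>F. bdiag (A F) f) \<longlongrightarrow> bdiag a f) (finite_subsets_at_top UNIV)"
proof -
  have lim: "((\<lambda>F. 2 * norm (chi F f - f)) \<longlongrightarrow> 0) (finite_subsets_at_top UNIV)"
    by (intro tendsto_mult_right_zero tendsto_norm_zero LIM_zero chi_tendsto)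
  have ev: "\<forall>\<^sub>F F in finite_subsets_at_top UNIV.
      norm (bdiag (A F) f - bdiag a f) \<le> 2 * norm (chi F f - f)"
  proof (intro eventually_finite_subsets_at_top_weakI norm_ell2_le)
    fix F :: "'x set" and x assume F: "finite F"
    have "norm (A F x \<eta> - a x \<eta>) \<le> 2 * norm \<eta>" for \<eta>
      using norm_triangle_ineq4[of "A F x \<eta>" "a x \<eta>"] norm_blinfun_le[OF A[of F x], of \<eta>]
        norm_blinfun_le[OF a[of x], of \<eta>] by linarith
    then show "norm (ell2_apply (bdiag (A F) f - bdiag a f) x)
        \<le> 2 * norm (ell2_apply (chi F f - f) x)"
      using agree[OF F] by (auto simp: bdiag_apply[OF A] bdiag_apply[OF a])
  qed simp
  show ?thesis by (rule LIM_zero_cancel[OF Lim_null_comparison[OF ev lim]])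
qed

section \<open>Approximation by operators of finite propagation\<close>

text \<open>
  A real bound for the propagation (\<open>propagation_le_iff\<close>), phrased on delta functions so that it
  passes through sums, products and weak limits by inspection of single values.
\<close>

definition prop_le :: "real \<Rightarrow> ('x::metric_space, 'h::complex_hilbert) operator \<Rightarrow> bool" where
  "prop_le s c \<longleftrightarrow> (\<forall>x y \<eta>. s < dist x y \<longrightarrow> ell2_apply (c (delta x \<eta>)) y = 0)"

lemma propagation_le_iff: "0 \<le> s \<Longrightarrow> propagation c \<le> ennreal s \<longleftrightarrow> prop_le s c"
proof -
  assume s: "0 \<le> s"
  have "entry c x y = 0 \<longleftrightarrow> (\<forall>\<eta>. ell2_apply (c (delta x \<eta>)) y = 0)" for x y
    by (metis blinfun_eqI entry_apply zero_blinfun.rep_eq)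
  then show ?thesis
    unfolding propagation_def Sup_le_iff prop_le_def
    using s by (auto simp: ennreal_le_iff not_le) (metis ennreal_le_iff not_le)+
qed

text \<open>
  Locality on all vectors: finitely supported functions are dense, and evaluation is continuous.
\<close>

lemma prop_leD:
  assumes c: "prop_le s c" and f: "\<And>x. dist x y \<le> s \<Longrightarrow> ell2_apply f x = 0"
  shows "ell2_apply (c f) y = 0"
proof -
  have "bounded_linear (\<lambda>f. ell2_apply (c f) y)"
  proof -
    have "bounded_linear (\<lambda>g :: ('a, 'b) ell2. ell2_apply g y)"
      by (rule bounded_linear_intro[where K = 1]) (simp_all add: norm_ell2_apply_le)
    then show ?thesis by (rule bounded_linear_compose) (rule blinfun.bounded_linear_right)
  qed
  then have "((\<lambda>F. ell2_apply (c (chi F f)) y) \<longlongrightarrow> ell2_apply (c f) y) (finite_subsets_at_top UNIV)"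
    by (rule bounded_linear.tendsto) (rule chi_tendsto)
  moreover have "\<forall>\<^sub>F F in finite_subsets_at_top UNIV. ell2_apply (c (chi F f)) y = 0"
  proof (rule eventually_finite_subsets_at_top_weakI)
    fix F :: "'a set" assume "finite F"
    have "ell2_apply (c (delta x (ell2_apply f x))) y = 0" for x
      using c f[of x] by (cases "dist x y \<le> s") (auto simp: prop_le_def)
    then show "ell2_apply (c (chi F f)) y = 0"
      using \<open>finite F\<close> by (simp add: chi_finite blinfun.sum_right)
  qed
  ultimately have "((\<lambda>F. 0) \<longlongrightarrow> ell2_apply (c f) y) (finite_subsets_at_top (UNIV :: 'a set))"
    by (rule Lim_transform_eventually)
  then show ?thesis
    using tendsto_unique[OF finite_subsets_at_top_neq_bot _ tendsto_const] by metis
qed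

lemma prop_le_mono: "prop_le s c \<Longrightarrow> s \<le> t \<Longrightarrow> prop_le t c"
  by (simp add: prop_le_def)

lemma prop_le_0 [simp]: "prop_le s 0"
  by (simp add: prop_le_def)

lemma prop_le_add: "prop_le s c \<Longrightarrow> prop_le s d \<Longrightarrow> prop_le s (c + d)"
  and prop_le_scaleR: "prop_le s c \<Longrightarrow> prop_le s (r *\<^sub>R c)"
  by (simp_all add: prop_le_def blinfun.add_left blinfun.scaleR_left)

lemma prop_le_compose:
  assumes "prop_le s c" "prop_le t d" shows "prop_le (s + t) (c o\<^sub>L d)"
  unfolding prop_le_def
proof (intro allI impI)
  fix x y :: 'a and \<eta> :: 'b assume "s + t < dist x y"
  then have "t < dist x z" if "dist z y \<le> s" for z
    using that dist_triangle[of x y z] by linarith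
  then have "ell2_apply (d (delta x \<eta>)) z = 0" if "dist z y \<le> s" for z
    using assms(2) that unfolding prop_le_def by blast
  then show "ell2_apply ((c o\<^sub>L d) (delta x \<eta>)) y = 0"
    by (simp add: prop_leD[OF assms(1)])
qed

lemma prop_le_adj:
  assumes "c \<in> \<B>" "prop_le s c" shows "prop_le s (adj c)"
  unfolding prop_le_def
proof (intro allI impI)
  fix x y :: 'a and \<eta> :: 'b assume xy: "s < dist x y"
  show "ell2_apply (adj c (delta x \<eta>)) y = 0"
  proof (rule cinner_eqI)
    fix z
    have "cinner (delta x \<eta>) (c (delta y z)) = cnj (cinner (c (delta y z)) (delta x \<eta>))"
      by (rule cinner_commute)
    also have "\<dots> = 0"
      using xy assms(2) by (simp add: cinner_delta prop_le_def dist_commute)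
    finally show "cinner (ell2_apply (adj c (delta x \<eta>)) y) z = cinner 0 z"
      by (simp add: cinner_delta[symmetric] cinner_adj'[OF assms(1)])
  qed
qed

text \<open>
  The quantitative form of membership in \<open>BD\<close> (\<open>BD_iff\<close>). Statements about families of operators
  fix one \<open>s\<close> for each \<open>e\<close>.
\<close>

definition approximable :: "real \<Rightarrow> real \<Rightarrow> ('x::metric_space, 'h::complex_hilbert) operator \<Rightarrow> bool" where
  "approximable e s b \<longleftrightarrow> (\<exists>c\<in>\<B>. prop_le s c \<and> norm (b - c) \<le> e)"

lemma approximable_mono: "approximable e s b \<Longrightarrow> e \<le> e' \<Longrightarrow> s \<le> s' \<Longrightarrow> approximable e' s' b"
  unfolding approximable_def using prop_le_mono by force

lemma approximable_add:
  assumes "approximable e s a" "approximable e' s b" shows "approximable (e + e') s (a + b)"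
proof -
  obtain c d where "c \<in> \<B>" "prop_le s c" "norm (a - c) \<le> e"
    and "d \<in> \<B>" "prop_le s d" "norm (b - d) \<le> e'"
    using assms unfolding approximable_def by blast
  moreover have "norm (a + b - (c + d)) \<le> norm (a - c) + norm (b - d)"
    using norm_triangle_ineq[of "a - c" "b - d"] by (simp add: algebra_simps)
  ultimately show ?thesis
    unfolding approximable_def by (intro bexI[of _ "c + d"]) (auto intro: prop_le_add cblin_add)
qed

lemma approximable_scaleR:
  assumes "approximable e s b" shows "approximable (\<bar>r\<bar> * e) s (r *\<^sub>R b)"
proof -
  obtain c where "c \<in> \<B>" "prop_le s c" "norm (b - c) \<le> e"
    using assms unfolding approximable_def by blast
  moreover have "norm (r *\<^sub>R b - r *\<^sub>R c) = \<bar>r\<bar> * norm (b - c)"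
    by (simp add: scaleR_diff_right[symmetric])
  ultimately show ?thesis
    unfolding approximable_def
    by (intro bexI[of _ "r *\<^sub>R c"]) (auto intro: prop_le_scaleR cblin_scaleR mult_left_mono)
qed

lemma approximable_diff:
  assumes "approximable e s a" "approximable e' s b" shows "approximable (e + e') s (a - b)"
  using approximable_add[OF assms(1) approximable_scaleR[OF assms(2), of "- 1"]] by simp

lemma approximable_near:
  assumes "approximable e s b" "norm (a - b) \<le> e'" shows "approximable (e + e') s a"
proof -
  obtain c where "c \<in> \<B>" "prop_le s c" "norm (b - c) \<le> e"
    using assms unfolding approximable_def by blast
  moreover have "norm (a - c) \<le> norm (a - b) + norm (b - c)"
    using norm_triangle_ineq[of "a - b" "b - c"] by simp
  ultimately show ?thesis
    using assms(2) unfolding approximable_def by force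
qed

lemma norm_compose_le: "norm a \<le> M \<Longrightarrow> norm b \<le> N \<Longrightarrow> norm (a o\<^sub>L b) \<le> M * N"
  by (rule order_trans[OF norm_blinfun_compose])
    (meson mult_mono norm_ge_zero order_trans)

lemma compose_diff_left: "(a - b) o\<^sub>L c = (a o\<^sub>L c) - (b o\<^sub>L c)"
  by (rule blinfun_eqI) (simp add: blinfun.diff_left)

lemma approximable_compose_right:
  assumes "approximable e s b" "d \<in> \<B>" "prop_le t d" "norm d \<le> K"
  shows "approximable (e * K) (s + t) (b o\<^sub>L d)"
proof -
  obtain c where "c \<in> \<B>" "prop_le s c" "norm (b - c) \<le> e"
    using assms unfolding approximable_def by blast
  then show ?thesis
    unfolding approximable_def using assms norm_compose_le[of "b - c" e d K]
    by (intro bexI[of _ "c o\<^sub>L d"])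
      (auto intro: prop_le_compose cblin_compose simp: compose_diff_left)
qed

lemma BD_iff: "b \<in> BD \<longleftrightarrow> (\<forall>e>0. \<exists>s. approximable e s b)"
proof
  assume b: "b \<in> BD"
  show "\<forall>e>0. \<exists>s. approximable e s b"
  proof (intro allI impI)
    fix e :: real assume "0 < e"
    then obtain c where c: "c \<in> \<B>" "propagation c < \<infinity>" "dist c b < e"
      using b unfolding BD_def closure_approachable by blast
    then obtain s where "0 \<le> s" "propagation c = ennreal s"
      by (cases "propagation c") auto
    then show "\<exists>s. approximable e s b"
      unfolding approximable_def using c propagation_le_iff[of s c]
      by (metis dist_commute dist_norm less_imp_le order_refl)
  qed
next
  assume b: "\<forall>e>0. \<exists>s. approximable e s b"
  show "b \<in> BD"
    unfolding BD_def closure_approachable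
  proof (intro allI impI)
    fix e :: real assume "0 < e"
    then obtain s where "approximable (e/2) s b" using b by (metis half_gt_zero)
    then obtain c where c: "c \<in> \<B>" "prop_le s c" "norm (b - c) \<le> e/2"
      unfolding approximable_def by blast
    then have "propagation c \<le> ennreal (max s 0)"
      using propagation_le_iff[of "max s 0" c] prop_le_mono[of s c "max s 0"] by simp
    then have "propagation c < \<infinity>"
      using le_less_trans[OF _ ennreal_less_top] by simp
    then show "\<exists>y\<in>{a \<in> \<B>. propagation a < \<infinity>}. dist y b < e"
      using c \<open>0 < e\<close> by (intro bexI[of _ c]) (auto simp: dist_norm norm_minus_commute)
  qed
qed

lemma BD_cblin: "b \<in> BD \<Longrightarrow> b \<in> \<B>"
  using closure_minimal[of "{a \<in> \<B>. propagation a < \<infinity>}" "\<B>"] closed_cblinfuns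
  unfolding BD_def by blast

lemma prop_le_BD: "b \<in> \<B> \<Longrightarrow> prop_le s b \<Longrightarrow> b \<in> BD"
  unfolding BD_iff approximable_def by (metis diff_self less_imp_le norm_zero)

lemma BD_limit:
  assumes "\<And>e. 0 < e \<Longrightarrow> \<exists>b'\<in>BD. norm (b - b') \<le> e" shows "b \<in> BD"
  unfolding BD_iff
proof (intro allI impI)
  fix e :: real assume "0 < e"
  then obtain b' where "b' \<in> BD" "norm (b - b') \<le> e/2"
    using assms[of "e/2"] by auto
  moreover obtain s where "approximable (e/2) s b'"
    using \<open>0 < e\<close> \<open>b' \<in> BD\<close> unfolding BD_iff by (metis half_gt_zero)
  ultimately show "\<exists>s. approximable e s b"
    using approximable_near[of "e/2" s b' b "e/2"] by auto
qed

lemma BD_add: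
  assumes "a \<in> BD" "b \<in> BD" shows "a + b \<in> BD"
  unfolding BD_iff
proof (intro allI impI)
  fix e :: real assume "0 < e"
  then obtain s t where "approximable (e/2) s a" "approximable (e/2) t b"
    using assms unfolding BD_iff by (metis half_gt_zero)
  then have "approximable (e/2 + e/2) (max s t) (a + b)"
    by (intro approximable_add) (erule approximable_mono; simp)+
  then show "\<exists>s. approximable e s (a + b)" by auto
qed

lemma BD_adj:
  assumes "b \<in> BD" shows "adj b \<in> BD"
  unfolding BD_iff
proof (intro allI impI)
  fix e :: real assume "0 < e"
  then obtain s where "approximable e s b" using assms unfolding BD_iff by blast
  then obtain c where c: "c \<in> \<B>" "prop_le s c" "norm (b - c) \<le> e"
    unfolding approximable_def by blast
  have "norm (adj b - adj c) \<le> norm (b - c)"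
    using norm_adj_le[of "b - c"] c(1) BD_cblin[OF assms] by (simp add: adj_diff cblin_diff)
  with c have "approximable e s (adj b)"
    unfolding approximable_def by (intro bexI[of _ "adj c"]) (auto simp: prop_le_adj cblin_adj)
  then show "\<exists>s. approximable e s (adj b)" ..
qed

lemma BD_compose_prop:
  assumes "b \<in> BD" "d \<in> \<B>" "prop_le t d" shows "b o\<^sub>L d \<in> BD"
  unfolding BD_iff
proof (intro allI impI)
  fix e :: real assume e: "0 < e"
  have K: "0 < norm d + 1" by (simp add: add_nonneg_pos)
  then obtain s where s: "approximable (e / (norm d + 1)) s b"
    using assms(1) e unfolding BD_iff by (metis divide_pos_pos)
  have "approximable (e / (norm d + 1) * (norm d + 1)) (s + t) (b o\<^sub>L d)"
    by (rule approximable_compose_right[OF s assms(2,3)]) simp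
  then show "\<exists>s. approximable e s (b o\<^sub>L d)" using K by auto
qed

text \<open>
  Balls of operators are compact in the weak operator topology: matrix coefficients range over
  closed discs, Tychonoff gives a limit point of the family of coefficients, and sesquilinearity
  passes to it.
\<close>

lemma form_limit_point:
  fixes c :: "'i \<Rightarrow> 'a::complex_hilbert \<Rightarrow>\<^sub>L 'a"
  assumes "F \<noteq> bot" and c: "\<And>i. c i \<in> \<B>" "\<And>i. norm (c i) \<le> M"
  obtains F' d where "F' \<noteq> bot" "F' \<le> F" "d \<in> \<B>"
    "\<And>h k. ((\<lambda>i. cinner (c i h) k) \<longlongrightarrow> cinner (d h) k) F'"
proof -
  define C :: "('a \<times> 'a \<Rightarrow> complex) set"
    where "C = Pi UNIV (\<lambda>(h, k). cball 0 (M * norm h * norm k))"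
  define G where "G i = (\<lambda>(h, k). cinner (c i h) k)" for i
  have bd: "norm (cinner (c i h) k) \<le> M * norm h * norm k" for i h k
    by (rule order_trans[OF norm_cinner_le mult_right_mono[OF norm_blinfun_le[OF c(2)]]]) simp
  have M: "0 \<le> M" using c(2) norm_ge_zero order_trans by blast
  have "compactin (product_topology (\<lambda>_. euclidean) UNIV)
      (PiE UNIV (\<lambda>(h, k). cball (0 :: complex) (M * norm (h :: 'a) * norm (k :: 'a))))"
    unfolding compactin_PiE by auto
  then have "compact C"
    by (simp add: euclidean_product_topology C_def PiE_UNIV_domain)
  moreover have "filtermap G F \<noteq> bot" using assms(1) by (simp add: filtermap_bot_iff)
  moreover have "\<forall>\<^sub>F g in filtermap G F. g \<in> C"
    by (simp add: eventually_filtermap C_def G_def bd Pi_def)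
  ultimately obtain g where g: "inf (nhds g) (filtermap G F) \<noteq> bot"
    unfolding compact_filter le_principal by blast
  \<comment> \<open>Along this finer filter the coefficients converge to the limit point.\<close>
  define F' where "F' = inf F (filtercomap G (nhds g))"
  have F': "F' \<noteq> bot"
  proof
    assume "F' = bot"
    then have "eventually (\<lambda>_. False) (inf F (filtercomap G (nhds g)))"
      by (simp add: F'_def)
    then obtain P Q where P: "eventually P F" and Q: "eventually Q (nhds g)"
      and PQ: "\<And>i. P i \<Longrightarrow> Q (G i) \<Longrightarrow> False"
      unfolding eventually_inf eventually_filtercomap by blast
    have "eventually (\<lambda>y. \<not> Q y) (filtermap G F)"
      unfolding eventually_filtermap using P by (rule eventually_mono) (use PQ in blast)
    with Q have "eventually (\<lambda>_. False) (inf (nhds g) (filtermap G F))"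
      unfolding eventually_inf by blast
    then show False using g by (simp add: eventually_False)
  qed
  have "filterlim G (nhds g) F'"
    unfolding F'_def by (rule filterlim_mono[OF filterlim_filtercomap order_refl]) simp
  then have lim: "((\<lambda>i. cinner (c i h) k) \<longlongrightarrow> g (h, k)) F'" for h k
    using continuous_on_tendsto_compose[OF continuous_on_product_coordinates[where i = "(h, k)"],
        of G g F'] by (simp add: G_def)
  note uniq = tendsto_unique[OF F' lim]
  obtain d where d: "d \<in> \<B>" "\<And>x y. cinner (d x) y = g (x, y)"
  proof (rule cblinfun_of_form[of "\<lambda>h k. g (h, k)" M])
    show "g (x + y, z) = g (x, z) + g (y, z)" for x y z
      by (rule uniq) (simp add: blinfun.add_right cinner_add_left tendsto_add lim)
    show "g (x, y + z) = g (x, y) + g (x, z)" for x y z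
      by (rule uniq) (simp add: cinner_add_right tendsto_add lim)
    show "g (t *\<^sub>C x, y) = t * g (x, y)" for t x y
      by (rule uniq) (simp add: cblinfunD[OF c(1)] cinner_scaleC_left tendsto_mult_left lim)
    show "g (x, t *\<^sub>C y) = cnj t * g (x, y)" for t x y
      by (rule uniq) (simp add: cinner_scaleC_right tendsto_mult_left lim)
    show "norm (g (x, y)) \<le> M * norm x * norm y" for x y
      by (rule tendsto_upperbound[OF tendsto_norm[OF lim] _ F']) (simp add: bd)
  qed (use M in auto)
  show thesis
    by (rule that[OF F' _ d(1)]) (simp_all add: F'_def d(2) lim[unfolded F'_def])
qed

text \<open>
  For fixed \<open>e\<close> and \<open>s\<close> approximability is closed under bounded strong limits: a weak limit point of
  the approximants has propagation at most \<open>s\<close>, and the norm is weakly lower semicontinuous. Distance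
  to a set is in general not attained in the limit; it is the weak compactness of the operators of
  propagation at most \<open>s\<close> that makes this work.
\<close>

lemma approximable_limit:
  fixes b :: "'i \<Rightarrow> ('x::metric_space, 'h::complex_hilbert) operator" and a :: "('x, 'h) operator"
  assumes F: "F \<noteq> bot" and approximable: "\<And>i. approximable e s (b i)" and bd: "\<And>i. norm (b i) \<le> K"
    and lim: "\<And>h. ((\<lambda>i. b i h) \<longlongrightarrow> a h) F"
  shows "approximable e s a"
proof -
  obtain c where c: "\<And>i. c i \<in> \<B>" "\<And>i. prop_le s (c i)" "\<And>i. norm (b i - c i) \<le> e"
    using approximable unfolding approximable_def by metis
  have cK: "norm (c i) \<le> K + e" for i
    using norm_triangle_ineq4[of "b i" "b i - c i"] bd[of i] c(3)[of i] by simp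
  obtain F' d where F': "F' \<noteq> bot" "F' \<le> F" and d: "d \<in> \<B>"
    "\<And>h k. ((\<lambda>i. cinner (c i h) k) \<longlongrightarrow> cinner (d h) k) F'"
    by (rule form_limit_point[where c = c, OF F c(1) cK]) blast
  have "prop_le s d"
    unfolding prop_le_def
  proof (intro allI impI)
    fix x y :: 'x and \<eta> :: 'h assume xy: "s < dist x y"
    show "ell2_apply (d (delta x \<eta>)) y = 0"
    proof (rule cinner_eqI)
      fix z
      have "cinner (c i (delta x \<eta>)) (delta y z) = 0" for i
        using c(2)[of i] xy by (simp add: cinner_delta prop_le_def)
      then have 0: "((\<lambda>i. 0) \<longlongrightarrow> cinner (d (delta x \<eta>)) (delta y z)) F'"
        using d(2)[of "delta x \<eta>" "delta y z"] by simp
      show "cinner (ell2_apply (d (delta x \<eta>)) y) z = cinner 0 z"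
        using tendsto_unique[OF F'(1) 0 tendsto_const] by (simp add: cinner_delta)
    qed
  qed
  moreover have "norm (a - d) \<le> e"
  proof (rule norm_blinfun_cinner_bound)
    show "0 \<le> e" using c(3) norm_ge_zero order_trans by blast
    fix h k
    have "((\<lambda>i. cinner (b i h) k) \<longlongrightarrow> cinner (a h) k) F'"
      by (intro tendsto_cinner tendsto_const tendsto_mono[OF F'(2) lim])
    then have "((\<lambda>i. cinner ((b i - c i) h) k) \<longlongrightarrow> cinner ((a - d) h) k) F'"
      by (simp add: blinfun.diff_left cinner_diff_left tendsto_diff d(2))
    moreover have "norm (cinner ((b i - c i) h) k) \<le> e * norm h * norm k" for i
      by (rule order_trans[OF norm_cinner_le mult_right_mono[OF norm_blinfun_le[OF c(3)]]]) simp
    ultimately show "norm (cinner ((a - d) h) k) \<le> e * norm h * norm k"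
      by (intro tendsto_upperbound[OF tendsto_norm _ F'(1)]) (auto simp: always_eventually)
  qed
  ultimately show ?thesis unfolding approximable_def using d(1) by blast
qed

section \<open>Automorphisms of the Roe algebra are implemented by unitaries\<close>

lemma prop_le_bdiag:
  assumes "\<And>x. norm (a x) \<le> K" "0 \<le> s" shows "prop_le s (bdiag a)"
  unfolding prop_le_def using assms(2) by (auto simp: bdiag_apply[OF assms(1)])

lemma finite_dist_bound:
  assumes "finite (F :: 'x::metric_space set)"
  obtains s where "\<And>x y. x \<in> F \<Longrightarrow> y \<in> F \<Longrightarrow> dist x y \<le> s"
  using finite_imp_bounded[OF assms] unfolding bounded_two_points by blast

text \<open>
  Cutting both vectors down to a finite set gives a rank-one operator of finite propagation, and
  these converge in norm.
\<close>

lemma rank_one_roe: "rank_one h k \<in> roe_algebra"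
  unfolding roe_algebra_def mem_Collect_eq
proof (intro conjI allI)
  show "rank_one h k \<in> BD"
    unfolding BD_iff
  proof (intro allI impI)
    fix e :: real assume e: "0 < e"
    have "((\<lambda>F. norm (chi F h - h) * norm k + norm h * norm (chi F k - k)) \<longlongrightarrow> 0 + 0)
        (finite_subsets_at_top UNIV)"
      by (intro tendsto_add tendsto_mult_right_zero tendsto_mult_left_zero tendsto_norm_zero
          LIM_zero chi_tendsto)
    then have "\<forall>\<^sub>F F in finite_subsets_at_top UNIV.
        norm (chi F h - h) * norm k + norm h * norm (chi F k - k) < e"
      using e by (intro order_tendstoD(2)) simp_all
    then have "\<forall>\<^sub>F F in finite_subsets_at_top UNIV. finite F \<and>
        norm (chi F h - h) * norm k + norm h * norm (chi F k - k) < e"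
      by (auto simp: eventually_finite_subsets_at_top_finite eventually_conj_iff)
    then obtain F where F: "finite F"
      "norm (chi F h - h) * norm k + norm h * norm (chi F k - k) < e"
      using eventually_happens'[OF finite_subsets_at_top_neq_bot] by blast
    obtain s where s: "\<And>x y. x \<in> F \<Longrightarrow> y \<in> F \<Longrightarrow> dist x y \<le> s"
      using finite_dist_bound[OF F(1)] by blast
    have "prop_le s (rank_one (chi F h) (chi F k))"
      unfolding prop_le_def
    proof (intro allI impI)
      fix x y :: 'a and \<eta> :: 'b assume "s < dist x y"
      then have "x \<notin> F \<or> y \<notin> F" using s[of x y] by auto
      then show "ell2_apply (rank_one (chi F h) (chi F k) (delta x \<eta>)) y = 0"
        by (auto simp: cinner_chi[symmetric])
    qed
    moreover have "norm (rank_one h k - rank_one (chi F h) (chi F k)) \<le> e"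
    proof -
      have "rank_one h k - rank_one (chi F h) (chi F k)
          = rank_one (h - chi F h) k + rank_one (chi F h) (k - chi F k)"
        by (rule blinfun_eqI)
          (simp add: blinfun.diff_left blinfun.add_left scaleC_diff_right cinner_diff_right
            scaleC_add_left[of "_ - _" "_", symmetric] algebra_simps
            scaleC_add_left[symmetric])
      also have "norm \<dots> \<le> norm (h - chi F h) * norm k + norm (chi F h) * norm (k - chi F k)"
        by (rule order_trans[OF norm_triangle_ineq add_mono[OF norm_rank_one_le norm_rank_one_le]])
      also have "\<dots> \<le> norm (chi F h - h) * norm k + norm h * norm (chi F k - k)"
        by (intro add_mono mult_mono norm_chi_le) (simp_all add: norm_minus_commute)
      finally show ?thesis using F(2) by linarith
    qed
    ultimately show "\<exists>s. approximable e s (rank_one h k)"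
      unfolding approximable_def by (intro exI[of _ s] bexI[of _ "rank_one (chi F h) (chi F k)"]) auto
  qed
  fix x y
  show "compact_operator (entry (rank_one h k) x y)"
  proof (rule compact_operator_finite_rank)
    have "cinner (delta x \<eta>) k = cinner \<eta> (ell2_apply k x)" for \<eta>
      by (metis cinner_commute cinner_delta)
    then show "entry (rank_one h k) x y \<eta>
        = (\<Sum>i\<in>{()}. cinner \<eta> (ell2_apply k x) *\<^sub>C ell2_apply h y)" for \<eta>
      by (simp add: entry_apply)
    show "norm (cinner \<eta> (ell2_apply k x)) \<le> norm (ell2_apply k x) * norm \<eta>" for \<eta>
      using norm_cinner_le[of \<eta> "ell2_apply k x"] by (simp add: mult.commute)
  qed simp
qed

lemma bdiag_roe:
  assumes "\<And>x. norm (a x) \<le> K" "\<And>x. a x \<in> \<B>" "\<And>x. compact_operator (a x)"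
  shows "bdiag a \<in> roe_algebra"
  unfolding roe_algebra_def mem_Collect_eq
proof (intro conjI allI)
  show "bdiag a \<in> BD"
    by (rule prop_le_BD[OF cblin_bdiag prop_le_bdiag[of _ _ 0]]) (use assms in auto)
  show "compact_operator (entry (bdiag a) x y)" for x y
  proof -
    have "entry (bdiag a) x y = (if x = y then a x else 0)"
      by (rule blinfun_eqI) (simp add: entry_apply bdiag_apply[OF assms(1)])
    then show ?thesis by (simp add: assms(3))
  qed
qed

lemma Ad_apply [simp]: "Ad u a h = u (a (adj u h))"
  by (simp add: Ad_def)

lemma Ad_add: "Ad u (a + b) = Ad u a + Ad u b"
  and Ad_diff: "Ad u (a - b) = Ad u a - Ad u b"
  by (rule blinfun_eqI, simp add: blinfun.add_left blinfun.add_right blinfun.diff_left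
      blinfun.diff_right)+

lemma norm_Ad_le: "unitary u \<Longrightarrow> norm (Ad u a) \<le> norm a"
  by (rule norm_blinfun_bound) (simp_all add: unitary_norm norm_blinfun
      unitary_norm[OF unitary_adj] order_trans[OF norm_blinfun])

lemma cblin_Ad: "unitary u \<Longrightarrow> a \<in> \<B> \<Longrightarrow> Ad u a \<in> \<B>"
  by (simp add: Ad_def cblin_compose unitary_cblin cblin_adj)

text \<open>
  Fix a unit vector \<open>e\<close> and a unit vector \<open>g\<close> in the range of the projection \<open>\<Phi> (rank_one e e)\<close>. Then
  \<open>h \<mapsto> \<Phi> (rank_one h e) g\<close> is isometric since \<open>rank_one e k \<circ> rank_one h e\<close> is the multiple
  \<open>cinner h k\<close> of \<open>rank_one e e\<close>; it intertwines \<open>a\<close> and \<open>\<Phi> a\<close> since \<open>a \<circ> rank_one h e = rank_one (a h) e\<close>;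
  and it is onto since \<open>\<Phi>\<close> is onto.
\<close>

lemma star_automorphism_roe_implemented:
  fixes \<Phi> :: "('x::metric_space, 'h::complex_hilbert) operator \<Rightarrow> ('x, 'h) operator"
  assumes \<Phi>: "star_automorphism roe_algebra \<Phi>" and \<eta>: "norm (\<eta> :: 'h) = 1"
  obtains u where "unitary u" "\<And>a. a \<in> roe_algebra \<Longrightarrow> \<Phi> a = Ad u a"
proof -
  note roe = rank_one_roe[where 'a='x and 'b='h]
  have bij: "bij_betw \<Phi> roe_algebra roe_algebra"
    and add: "\<And>a b. a \<in> roe_algebra \<Longrightarrow> b \<in> roe_algebra \<Longrightarrow> \<Phi> (a + b) = \<Phi> a + \<Phi> b"
    and scale: "\<And>a c. a \<in> roe_algebra \<Longrightarrow> \<Phi> (c *\<^sub>C a) = c *\<^sub>C \<Phi> a"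
    and mult: "\<And>a b. a \<in> roe_algebra \<Longrightarrow> b \<in> roe_algebra \<Longrightarrow> \<Phi> (a o\<^sub>L b) = \<Phi> a o\<^sub>L \<Phi> b"
    and star: "\<And>a. a \<in> roe_algebra \<Longrightarrow> \<Phi> (adj a) = adj (\<Phi> a)"
    using \<Phi> unfolding star_automorphism_def by auto
  have \<Phi>roe: "\<Phi> a \<in> roe_algebra" if "a \<in> roe_algebra" for a
    using bij that by (auto simp: bij_betw_def)
  have \<Phi>B: "\<Phi> a \<in> \<B>" if "a \<in> roe_algebra" for a
    using \<Phi>roe[OF that] BD_cblin by (auto simp: roe_algebra_def)
  define e where "e = delta (undefined :: 'x) \<eta>"
  have e: "cinner e e = 1" using \<eta> by (simp add: e_def cinner_self norm_delta)
  have R_add: "rank_one (h + h') e = rank_one h e + rank_one h' e" for h h'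
    by (rule blinfun_eqI) (simp add: blinfun.add_left scaleC_add_right)
  have R_scale: "rank_one (c *\<^sub>C h) e = c *\<^sub>C rank_one h e" for c h
    by (rule blinfun_eqI) (simp add: scaleC_blinfun.rep_eq scaleC_scaleC mult.commute)
  define q where "q = \<Phi> (rank_one e e)"
  have "\<Phi> (0 *\<^sub>C rank_one e e) = 0 *\<^sub>C \<Phi> (rank_one e e)" by (rule scale[OF roe])
  moreover have zero: "0 *\<^sub>C (a :: ('x, 'h) operator) = 0" for a
    by (rule blinfun_eqI) (simp add: scaleC_blinfun.rep_eq)
  ultimately have \<Phi>0: "\<Phi> 0 = 0" by simp
  have "(0 :: ('x, 'h) operator) \<in> roe_algebra"
    using roe[of 0 0] zero R_scale[of 0 0]
    by (metis blinfun_eqI cinner_zero(2) rank_one_apply scaleC_zero_left zero_blinfun.rep_eq)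
  moreover have "rank_one e e \<noteq> 0"
  proof
    assume "rank_one e e = 0"
    then have "rank_one e e e = 0" by simp
    then show False using e by auto
  qed
  ultimately have "q \<noteq> 0"
    using bij roe[of e e] \<Phi>0 unfolding bij_betw_def inj_on_def q_def by metis
  then obtain g0 where g0: "q g0 \<noteq> 0" by (metis blinfun_eqI zero_blinfun.rep_eq)
  define g where "g = (1 / norm (q g0)) *\<^sub>R q g0"
  have "rank_one e e o\<^sub>L rank_one e e = rank_one e e"
    by (rule blinfun_eqI) (simp add: cinner_scaleC_left e)
  then have "q o\<^sub>L q = q" unfolding q_def by (metis mult roe)
  then have qq: "q (q h) = q h" for h by (metis blinfun_apply_blinfun_compose)
  have qg: "q g = g" by (simp add: g_def blinfun.scaleR_right qq)
  have gg: "cinner g g = 1" using g0 by (simp add: cinner_self g_def)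
  define U where "U h = \<Phi> (rank_one h e) g" for h
  have inner_U: "cinner (U h) (U k) = cinner h k" for h k
  proof -
    have "rank_one e k o\<^sub>L rank_one h e = cinner h k *\<^sub>C rank_one e e"
      by (rule blinfun_eqI)
        (simp add: scaleC_blinfun.rep_eq cinner_scaleC_left scaleC_scaleC mult.commute)
    then have *: "\<Phi> (rank_one e k) o\<^sub>L \<Phi> (rank_one h e) = cinner h k *\<^sub>C q"
      using mult[OF roe roe, of e k h e] scale[OF roe] by (simp add: q_def)
    have "cinner (U h) (U k) = cinner (adj (\<Phi> (rank_one k e)) (U h)) g"
      unfolding U_def by (simp add: cinner_adj'[OF \<Phi>B[OF roe]])
    also have "\<dots> = cinner ((\<Phi> (rank_one e k) o\<^sub>L \<Phi> (rank_one h e)) g) g"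
      by (simp add: star[OF roe, symmetric] adj_rank_one U_def)
    finally show ?thesis
      unfolding * by (simp add: scaleC_blinfun.rep_eq qg cinner_scaleC_left gg)
  qed
  have U_norm: "norm (U h) = norm h" for h
  proof -
    have "complex_of_real ((norm (U h))\<^sup>2) = complex_of_real ((norm h)\<^sup>2)"
      unfolding cinner_self[symmetric] by (rule inner_U)
    then have "(norm (U h))\<^sup>2 = (norm h)\<^sup>2" using of_real_eq_iff by blast
    then show ?thesis by simp
  qed
  have U_scale: "U (c *\<^sub>C h) = c *\<^sub>C U h" for c h
    by (simp add: U_def R_scale scale[OF roe] scaleC_blinfun.rep_eq)
  have bl: "bounded_linear U"
    by (rule bounded_linear_intro[where K = 1])
      (simp_all add: U_norm scaleR_eq_scaleC U_scale, simp add: U_def R_add add roe blinfun.add_left)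
  note Uap = bounded_linear_Blinfun_apply[OF bl]
  have inter: "\<Phi> a (U h) = U (a h)" if a: "a \<in> roe_algebra" for a h
  proof -
    have "a \<in> \<B>" using a BD_cblin by (auto simp: roe_algebra_def)
    then have "a o\<^sub>L rank_one h e = rank_one (a h) e"
      by (intro blinfun_eqI) (simp add: cblinfunD)
    then have "\<Phi> (rank_one (a h) e) = \<Phi> a o\<^sub>L \<Phi> (rank_one h e)"
      using mult[OF a roe] by metis
    then show ?thesis by (simp add: U_def)
  qed
  \<comment> \<open>A preimage under \<open>\<Phi>\<close> of an operator taking \<open>g\<close> to \<open>k\<close> takes \<open>e\<close> to a preimage of \<open>k\<close>.\<close>
  have surj: "\<exists>h. U h = k" for k
  proof -
    obtain a where a: "a \<in> roe_algebra" "\<Phi> a = rank_one k g"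
      using bij roe[of k g] unfolding bij_betw_def by (metis imageE)
    have "U (a e) = \<Phi> a (U e)" using inter[OF a(1)] by simp
    also have "U e = g" using qg by (simp add: U_def q_def)
    finally show ?thesis using a(2) gg by (intro exI[of _ "a e"]) simp
  qed
  have un: "unitary (Blinfun U)"
    by (rule unitaryI) (simp_all add: Uap inner_U surj cblinfuns_def U_scale)
  moreover have "\<Phi> a = Ad (Blinfun U) a" if "a \<in> roe_algebra" for a
  proof (rule blinfun_eqI)
    fix h
    have "\<Phi> a (U (adj (Blinfun U) h)) = U (a (adj (Blinfun U) h))" by (rule inter[OF that])
    then show "\<Phi> a h = Ad (Blinfun U) a h"
      using unitary_adj_apply(2)[OF un, of h] by (simp add: Uap)
  qed
  ultimately show thesis by (rule that)
qed

text \<open>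
  Invariance is asked for both \<open>u\<close> and its adjoint, which makes every result below applicable to the
  inverse as well.
\<close>

definition roe_normalizer :: "('x::metric_space, 'h::complex_hilbert) operator \<Rightarrow> bool" where
  "roe_normalizer u \<longleftrightarrow>
     unitary u \<and> (\<forall>a\<in>roe_algebra. Ad u a \<in> roe_algebra \<and> Ad (adj u) a \<in> roe_algebra)"

lemma roe_normalizer_adj: "roe_normalizer u \<Longrightarrow> roe_normalizer (adj u)"
  by (simp add: roe_normalizer_def unitary_adj adj_adj unitary_cblin)

lemma roe_normalizer_unitary: "roe_normalizer u \<Longrightarrow> unitary u"
  by (simp add: roe_normalizer_def)

section \<open>Finite-rank truncations along an orthonormal basis\<close>

definition fin_proj :: "(nat \<Rightarrow> 'h::complex_inner) \<Rightarrow> nat \<Rightarrow> 'h \<Rightarrow>\<^sub>L 'h" where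
  "fin_proj \<xi> n = (\<Sum>j<n. rank_one (\<xi> j) (\<xi> j))"

lemma fin_proj_apply: "fin_proj \<xi> n \<eta> = (\<Sum>j<n. cinner \<eta> (\<xi> j) *\<^sub>C \<xi> j)"
  by (simp add: fin_proj_def blinfun.sum_left)

lemma cblin_fin_proj [simp]: "fin_proj \<xi> n \<in> \<B>"
  by (simp add: fin_proj_def cblin_sum)

lemma norm_basis:
  assumes "orthonormal_basis \<xi>" shows "norm (\<xi> j) = 1"
proof -
  have "complex_of_real ((norm (\<xi> j))\<^sup>2) = of_real 1"
    using assms unfolding cinner_self[symmetric] orthonormal_basis_def by simp
  then have "(norm (\<xi> j))\<^sup>2 = 1" using of_real_eq_iff by blast
  then show ?thesis using norm_ge_zero[of "\<xi> j"] by (simp add: power2_eq_1_iff)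
qed

text \<open>
  Bounded blocks are strong limits of such compact ones, by \<open>bdiag_fin_proj_tendsto\<close>.
\<close>

lemma compact_fin_proj_compose:
  assumes "orthonormal_basis \<xi>"
  shows "compact_operator (fin_proj \<xi> n o\<^sub>L a)"
proof (rule compact_operator_finite_rank)
  show "(fin_proj \<xi> n o\<^sub>L a) x = (\<Sum>j\<in>{..<n}. cinner (a x) (\<xi> j) *\<^sub>C \<xi> j)" for x
    by (simp add: fin_proj_apply)
  show "norm (cinner (a x) (\<xi> j)) \<le> norm a * norm x" for j x
    using norm_cinner_le[of "a x" "\<xi> j"] norm_blinfun[of a x] norm_basis[OF assms, of j] by simp
qed simp

lemma compact_fin_proj:
  assumes "orthonormal_basis \<xi>"
  shows "compact_operator (fin_proj \<xi> n)"
proof -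
  have "fin_proj \<xi> n o\<^sub>L id_blinfun = fin_proj \<xi> n" by (rule blinfun_eqI) simp
  then show ?thesis using compact_fin_proj_compose[OF assms, of n id_blinfun] by simp
qed

lemma norm_fin_proj_le:
  assumes \<xi>: "orthonormal_basis \<xi>" shows "norm (fin_proj \<xi> n) \<le> 1"
proof (rule norm_blinfun_bound)
  fix \<eta>
  let ?p = "fin_proj \<xi> n \<eta>"
  have "cinner ?p (\<xi> j) = cinner \<eta> (\<xi> j)" if "j < n" for j
  proof -
    have "cinner ?p (\<xi> j) = (\<Sum>i<n. if i = j then cinner \<eta> (\<xi> j) else 0)"
      unfolding fin_proj_apply cinner_sum_left cinner_scaleC_left
      using \<xi> by (intro sum.cong) (auto simp: orthonormal_basis_def)
    then show ?thesis using that by simp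
  qed
  then have "fin_proj \<xi> n ?p = ?p"
    unfolding fin_proj_apply[of _ _ ?p] by (simp add: fin_proj_apply)
  moreover have "cinner (fin_proj \<xi> n x) y = cinner x (fin_proj \<xi> n y)" for x y
    unfolding fin_proj_apply cinner_sum_left bounded_bilinear.sum_right[OF bounded_bilinear_cinner]
      cinner_scaleC_left cinner_scaleC_right
    by (intro sum.cong refl) (metis cinner_commute mult.commute)
  ultimately have "cinner ?p ?p = cinner \<eta> ?p" by simp
  then have "(norm ?p)\<^sup>2 \<le> norm \<eta> * norm ?p"
    using norm_cinner_le[of \<eta> ?p] unfolding cinner_self
    by (metis norm_of_real abs_of_nonneg zero_le_power2)
  then show "norm ?p \<le> 1 * norm \<eta>"
    by (cases "?p = 0") (simp_all add: power2_eq_square)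
qed simp

lemma fin_proj_tendsto:
  assumes \<xi>: "orthonormal_basis \<xi>" shows "(\<lambda>n. fin_proj \<xi> n \<eta>) \<longlonglongrightarrow> \<eta>"
proof -
  have sub: "complex_vector.subspace {v. \<exists>N. \<forall>n\<ge>N. fin_proj \<xi> n v = v}"
  proof (rule complex_vector.subspaceI)
    show "0 \<in> {v. \<exists>N. \<forall>n\<ge>N. fin_proj \<xi> n v = v}" by simp
    fix x y assume "x \<in> {v. \<exists>N. \<forall>n\<ge>N. fin_proj \<xi> n v = v}" "y \<in> {v. \<exists>N. \<forall>n\<ge>N. fin_proj \<xi> n v = v}"
    then obtain M N where "\<forall>n\<ge>M. fin_proj \<xi> n x = x" "\<forall>n\<ge>N. fin_proj \<xi> n y = y" by auto
    then have "\<forall>n\<ge>max M N. fin_proj \<xi> n (x + y) = x + y" by (simp add: blinfun.add_right)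
    then show "x + y \<in> {v. \<exists>N. \<forall>n\<ge>N. fin_proj \<xi> n v = v}" by blast
  next
    fix c x assume "x \<in> {v. \<exists>N. \<forall>n\<ge>N. fin_proj \<xi> n v = v}"
    then show "c *\<^sub>C x \<in> {v. \<exists>N. \<forall>n\<ge>N. fin_proj \<xi> n v = v}" by (auto simp: cblinfunD)
  qed
  have base: "fin_proj \<xi> n (\<xi> j) = \<xi> j" if "Suc j \<le> n" for n j
  proof -
    have "fin_proj \<xi> n (\<xi> j) = (\<Sum>i<n. if i = j then \<xi> j else 0)"
      unfolding fin_proj_apply
      using \<xi> by (intro sum.cong) (auto simp: orthonormal_basis_def)
    then show ?thesis using that by simp
  qed
  have span: "cspan (range \<xi>) \<subseteq> {v. \<exists>N. \<forall>n\<ge>N. fin_proj \<xi> n v = v}"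
    by (rule complex_vector.span_minimal[OF _ sub]) (use base in blast)
  show ?thesis
  proof (rule LIMSEQ_I)
    fix e :: real assume e: "0 < e"
    have "\<eta> \<in> closure (cspan (range \<xi>))" using \<xi> by (simp add: orthonormal_basis_def)
    then obtain v where v: "v \<in> cspan (range \<xi>)" "dist v \<eta> < e/2"
      using e unfolding closure_approachable by (metis half_gt_zero)
    with span obtain N where N: "\<And>n. n \<ge> N \<Longrightarrow> fin_proj \<xi> n v = v" by auto
    have "norm (fin_proj \<xi> n \<eta> - \<eta>) < e" if "n \<ge> N" for n
    proof -
      have "fin_proj \<xi> n \<eta> - \<eta> = fin_proj \<xi> n (\<eta> - v) + (v - \<eta>)"
        by (simp add: blinfun.diff_right N[OF that])
      then have "norm (fin_proj \<xi> n \<eta> - \<eta>) \<le> norm (fin_proj \<xi> n (\<eta> - v)) + norm (v - \<eta>)"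
        using norm_triangle_ineq by metis
      also have "norm (fin_proj \<xi> n (\<eta> - v)) \<le> 1 * norm (\<eta> - v)"
        by (rule norm_blinfun_le[OF norm_fin_proj_le[OF \<xi>]])
      finally show ?thesis using v(2) by (simp add: dist_norm norm_minus_commute)
    qed
    then show "\<exists>N. \<forall>n\<ge>N. norm (fin_proj \<xi> n \<eta> - \<eta>) < e" by blast
  qed
qed

lemma bounded_linear_delta: "bounded_linear (delta x :: 'h::complex_hilbert \<Rightarrow> ('x, 'h) ell2)"
proof (rule bounded_linear_intro[where K = 1])
  fix r and \<eta> \<eta>' :: 'h
  show "delta x (\<eta> + \<eta>') = delta x \<eta> + delta x \<eta>'" by (rule ell2_eqI) simp
  show "delta x (r *\<^sub>R \<eta>) = r *\<^sub>R delta x \<eta>" by (rule ell2_eqI) simp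
  show "norm (delta x \<eta>) \<le> norm \<eta> * 1" by (simp add: norm_delta)
qed

lemma bdiag_fin_proj_tendsto:
  assumes \<xi>: "orthonormal_basis \<xi>"
  shows "(\<lambda>n. bdiag (\<lambda>_. fin_proj \<xi> n) h) \<longlonglongrightarrow> (h :: ('x, 'h::complex_hilbert) ell2)"
proof -
  let ?P = "\<lambda>n. bdiag (\<lambda>_::'x. fin_proj \<xi> n)"
  note P = bdiag_apply[where a = "\<lambda>_. fin_proj \<xi> _", OF norm_fin_proj_le[OF \<xi>]]
  note normP = norm_bdiag_le[where a = "\<lambda>_. fin_proj \<xi> _", OF norm_fin_proj_le[OF \<xi>]]
  show ?thesis
  proof (rule LIMSEQ_I)
    fix e :: real assume e: "0 < e"
    have "\<forall>\<^sub>F F in finite_subsets_at_top UNIV. dist (chi F h) h < e/3"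
      using tendstoD[OF chi_tendsto[of h], of "e/3"] e by simp
    then have "\<forall>\<^sub>F F in finite_subsets_at_top UNIV. finite F \<and> dist (chi F h) h < e/3"
      by (auto simp: eventually_finite_subsets_at_top_finite eventually_conj_iff)
    then obtain F where F: "finite F" "norm (h - chi F h) < e/3"
      using eventually_happens'[OF finite_subsets_at_top_neq_bot]
      by (metis (lifting) dist_norm norm_minus_commute)
    have fin: "?P n (chi F h) = (\<Sum>x\<in>F. delta x (fin_proj \<xi> n (ell2_apply h x)))" for n
      by (rule ell2_eqI) (simp add: P F(1) chi_finite if_distrib[of "fin_proj _ _"] cong: if_cong)
    have "(\<lambda>n. ?P n (chi F h)) \<longlonglongrightarrow> chi F h"
      unfolding fin unfolding chi_finite[OF F(1)]
      by (intro tendsto_sum bounded_linear.tendsto[OF bounded_linear_delta] fin_proj_tendsto \<xi>)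
    then obtain N where N: "\<And>n. n \<ge> N \<Longrightarrow> norm (?P n (chi F h) - chi F h) < e/3"
      using LIMSEQ_D[of _ _ "e/3"] e by (metis divide_pos_pos zero_less_numeral)
    have "norm (?P n h - h) < e" if "n \<ge> N" for n
    proof -
      have "?P n h - h = ?P n (h - chi F h) + (?P n (chi F h) - chi F h) + (chi F h - h)"
        by (simp add: blinfun.diff_right)
      then have "norm (?P n h - h) \<le> norm (?P n (h - chi F h))
          + norm (?P n (chi F h) - chi F h) + norm (chi F h - h)"
        by (metis (no_types, lifting) norm_triangle_ineq add_right_mono order_trans)
      moreover have "norm (?P n (h - chi F h)) \<le> 1 * norm (h - chi F h)"
        by (rule norm_blinfun_le[OF normP])
      ultimately show ?thesis using N[OF that] F(2) by (simp add: norm_minus_commute)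
    qed
    then show "\<exists>N. \<forall>n\<ge>N. norm (?P n h - h) < e" by blast
  qed
qed

section \<open>Uniform approximability of conjugated block-diagonal operators\<close>

text \<open>
  Up to a small error the column at \<open>x\<close> has finitely many nonzero entries, and each of them is
  compact.
\<close>

lemma roe_column_near_compact:
  fixes d :: "('x::metric_space, 'h::complex_hilbert) operator"
  assumes ulf: "uniformly_locally_finite TYPE('x)" and d: "d \<in> roe_algebra" and e: "0 < e"
  obtains K where "compact K"
    "\<And>\<eta>. norm \<eta> \<le> 1 \<Longrightarrow> \<exists>z\<in>K. norm (d (delta x \<eta>) - z) \<le> e"
proof -
  have "d \<in> BD" using d by (simp add: roe_algebra_def)
  then obtain s c where c: "prop_le s c" "norm (d - c) \<le> e"
    using e unfolding BD_iff approximable_def by blast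
  define B where "B = cball x (max s 1)"
  have B: "finite B" using ulf by (simp add: uniformly_locally_finite_def B_def) (meson less_max_iff_disj zero_less_one)
  define C where "C y = delta y ` closure (entry d x y ` cball 0 1)" for y
  have C: "compact (C y)" for y
    unfolding C_def
    by (rule compact_continuous_image[OF linear_continuous_on[OF bounded_linear_delta]])
      (use d in \<open>simp add: roe_algebra_def compact_operator_def\<close>)
  obtain K where K: "compact K \<and> (\<forall>f. (\<forall>y\<in>B. f y \<in> C y) \<longrightarrow> (\<Sum>y\<in>B. f y) \<in> K)"
    using compact_finite_sums[OF B C] by (rule exE)
  show thesis
  proof (rule that[OF conjunct1[OF K]])
    fix \<eta> :: 'h assume \<eta>: "norm \<eta> \<le> 1"
    show "\<exists>z\<in>K. norm (d (delta x \<eta>) - z) \<le> e"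
    proof
      have "(\<Sum>y\<in>B. delta y (entry d x y \<eta>)) \<in> K"
      proof (rule mp[OF spec[OF conjunct2[OF K]]], intro ballI)
        fix y
        have "entry d x y \<eta> \<in> closure (entry d x y ` cball 0 1)"
          using \<eta> by (intro subsetD[OF closure_subset] imageI) simp
        then show "delta y (entry d x y \<eta>) \<in> C y" unfolding C_def by (rule imageI)
      qed
      then show "chi B (d (delta x \<eta>)) \<in> K" by (simp add: chi_finite[OF B] entry_apply)
      have "d (delta x \<eta>) - chi B (d (delta x \<eta>)) = chi (- B) ((d - c) (delta x \<eta>))"
        using c(1) by (intro ell2_eqI) (auto simp: B_def prop_le_def blinfun.diff_left not_le)
      then have "norm (d (delta x \<eta>) - chi B (d (delta x \<eta>))) \<le> norm ((d - c) (delta x \<eta>))"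
        by (metis norm_chi_le)
      also have "\<dots> \<le> e * norm (delta x \<eta>)" by (rule norm_blinfun_le[OF c(2)])
      also have "\<dots> \<le> e * 1" using \<eta> e by (intro mult_left_mono) (simp_all add: norm_delta)
      finally show "norm (d (delta x \<eta>) - chi B (d (delta x \<eta>))) \<le> e" by simp
    qed
  qed
qed

lemma disjoint_chi_tendsto_0:
  fixes D :: "nat \<Rightarrow> 'x set"
  assumes "disjoint_family D"
  shows "(\<lambda>k. norm (chi (D k) f)) \<longlonglongrightarrow> 0"
proof -
  have eq: "(\<Sum>k<m. (norm (chi (D k) f))\<^sup>2) = (norm (chi (\<Union>k<m. D k) f))\<^sup>2" for m
  proof (induction m)
    case (Suc m)
    have "D k \<inter> D m = {}" if "k < m" for k
      using assms that unfolding disjoint_family_on_def by simp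
    then have "(\<Union>k<m. D k) \<inter> D m = {}" by blast
    from norm_chi_square_add[OF this, of f] Suc show ?case
      by (simp add: lessThan_Suc Un_commute)
  qed simp
  have "summable (\<lambda>k. (norm (chi (D k) f))\<^sup>2)"
  proof (rule summableI_nonneg_bounded)
    show "(\<Sum>k<m. (norm (chi (D k) f))\<^sup>2) \<le> (norm f)\<^sup>2" for m
      unfolding eq by (intro power_mono norm_chi_le) simp
  qed simp
  then have "(\<lambda>k. sqrt ((norm (chi (D k) f))\<^sup>2)) \<longlonglongrightarrow> sqrt 0"
    by (intro tendsto_real_sqrt summable_LIMSEQ_zero)
  then show ?thesis by simp
qed

text \<open>
  The mass of a fixed vector in disjoint sets tends to zero, and on a compact set of vectors it does
  so uniformly.
\<close>

lemma disjoint_chi_compact: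
  fixes u :: "('x, 'h::complex_hilbert) operator" and D :: "nat \<Rightarrow> 'x set"
  assumes u: "norm u \<le> 1" and D: "disjoint_family D" and K: "compact K" and z: "\<And>k. z k \<in> K"
    and e: "0 < e"
  obtains k where "norm (chi (D k) (u (z k))) < e"
proof -
  obtain l r where l: "strict_mono r" "(z \<circ> r) \<longlonglongrightarrow> l"
    using K z unfolding compact_eq_seq_compact_metric seq_compact_def by metis
  have 1: "\<forall>\<^sub>F k in sequentially. norm (z (r k) - l) < e/2"
    using tendstoD[OF l(2), of "e/2"] e by (simp add: dist_norm)
  have "((\<lambda>k. norm (chi (D k) (u l))) \<circ> r) \<longlonglongrightarrow> 0"
    by (rule LIMSEQ_subseq_LIMSEQ[OF disjoint_chi_tendsto_0[OF D] l(1)])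
  then have 2: "\<forall>\<^sub>F k in sequentially. norm (chi (D (r k)) (u l)) < e/2"
    using order_tendstoD(2)[of _ 0 _ "e/2"] e by (simp add: o_def)
  obtain k where k: "norm (z (r k) - l) < e/2" "norm (chi (D (r k)) (u l)) < e/2"
    using eventually_happens'[OF _ eventually_conj[OF 1 2]] by auto
  have "norm (chi (D (r k)) (u (z (r k))))
      \<le> norm (chi (D (r k)) (u l)) + norm (chi (D (r k)) (u (z (r k) - l)))"
    using norm_triangle_ineq[of "chi (D (r k)) (u l)" "chi (D (r k)) (u (z (r k) - l))"]
    by (simp add: blinfun.diff_right)
  also have "norm (chi (D (r k)) (u (z (r k) - l))) \<le> 1 * norm (z (r k) - l)"
    by (rule order_trans[OF norm_chi_le norm_blinfun_le[OF u]])
  finally show thesis using k that[of "r k"] by simp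
qed

text \<open>
  If the image of the block at \<open>x\<close> did not decay, there would be disjoint finite sets \<open>D k\<close> and ranks
  such that the truncation of that rank on \<open>D k\<close> still sees mass more than \<open>e\<close> of some unit vector of the
  block. All these truncations together form one block-diagonal projection \<open>Q\<close> with finite-rank
  blocks, so \<open>Q\<close> and its conjugate \<open>d\<close> by the inverse of \<open>u\<close> lie in the Roe algebra. The columns of \<open>d\<close>
  are nearly compact, hence \<open>Q u = u d\<close> cannot keep mass on infinitely many disjoint sets.
\<close>

lemma column_decay:
  fixes u :: "('x::metric_space, 'h::complex_hilbert) operator"
  assumes ulf: "uniformly_locally_finite TYPE('x)" and \<xi>: "orthonormal_basis (\<xi> :: nat \<Rightarrow> 'h)"
    and u: "roe_normalizer u" and e: "0 < e"
  obtains B where "finite B" "\<And>\<eta>. norm (chi (- B) (u (delta x \<eta>))) \<le> e * norm \<eta>"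
proof (rule ccontr)
  assume "\<not> thesis"
  then have *: "\<exists>\<eta>. e * norm \<eta> < norm (chi (- B) (u (delta x \<eta>)))" if "finite B" for B
    using that \<open>\<And>B. \<lbrakk>finite B; \<And>\<eta>. norm (chi (- B) (u (delta x \<eta>))) \<le> e * norm \<eta>\<rbrakk> \<Longrightarrow> thesis\<close>
    by (meson not_le)
  define P where "P n = bdiag (\<lambda>_::'x. fin_proj \<xi> n)" for n
  have "\<exists>\<eta> B' n. norm \<eta> = 1 \<and> finite B' \<and> B' \<inter> B = {} \<and>
      e < norm (chi B' (P n (u (delta x \<eta>))))" if B: "finite B" for B
  proof -
    obtain \<eta>' where \<eta>': "e * norm \<eta>' < norm (chi (- B) (u (delta x \<eta>')))" using *[OF B] by blast
    then have nz: "\<eta>' \<noteq> 0" by auto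
    define \<eta> where "\<eta> = (1 / norm \<eta>') *\<^sub>R \<eta>'"
    define g where "g = u (delta x \<eta>)"
    have "chi (- B) g = (1 / norm \<eta>') *\<^sub>R chi (- B) (u (delta x \<eta>'))"
      unfolding g_def \<eta>_def
      by (simp add: linear_scale[OF bounded_linear.linear[OF bounded_linear_delta]]
          blinfun.scaleR_right del: chi_delta)
    then have "e < norm (chi (- B) g)"
      using \<eta>' nz by (simp add: field_simps)
    then have "\<forall>\<^sub>F F in finite_subsets_at_top UNIV. e < norm (chi F (chi (- B) g))"
      by (rule order_tendstoD(1)[OF tendsto_norm[OF chi_tendsto]])
    then have "\<forall>\<^sub>F F in finite_subsets_at_top UNIV. finite F \<and> e < norm (chi F (chi (- B) g))"
      by (auto simp: eventually_finite_subsets_at_top_finite eventually_conj_iff)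
    then obtain F where F: "finite F" "e < norm (chi F (chi (- B) g))"
      using eventually_happens'[OF finite_subsets_at_top_neq_bot] by blast
    have "(\<lambda>n. norm (chi (F - B) (P n g))) \<longlonglongrightarrow> norm (chi (F - B) g)"
      unfolding P_def by (intro tendsto_norm blinfun.tendsto tendsto_const bdiag_fin_proj_tendsto \<xi>)
    then have "\<forall>\<^sub>F n in sequentially. e < norm (chi (F - B) (P n g))"
      using F(2) by (intro order_tendstoD(1)) (simp_all add: Diff_eq)
    then obtain n where "e < norm (chi (F - B) (P n g))"
      using eventually_happens' by fastforce
    moreover have "norm \<eta> = 1" using nz by (simp add: \<eta>_def)
    ultimately show ?thesis
      using F(1) unfolding g_def by (intro exI[of _ \<eta>] exI[of _ "F - B"] exI[of _ n]) auto
  qed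
  then obtain H C N where HCN: "\<And>B. finite B \<Longrightarrow> norm (H B) = 1 \<and> finite (C B) \<and> C B \<inter> B = {} \<and>
      e < norm (chi (C B) (P (N B) (u (delta x (H B)))))"
    by metis
  \<comment> \<open>\<open>C B\<close> is a finite set disjoint from \<open>B\<close> that still carries mass; iterating it produces the disjoint sets.\<close>
  define S where "S = rec_nat {} (\<lambda>_ B. B \<union> C B)"
  have S: "S 0 = {}" "S (Suc k) = S k \<union> C (S k)" for k by (simp_all add: S_def)
  have fin: "finite (S k)" for k by (induction k) (use HCN S in auto)
  define D where "D k = C (S k)" for k
  have S_mono: "S j \<subseteq> S k" if "j \<le> k" for j k
    using that by (induction rule: dec_induct) (auto simp: S)
  have D_S: "D j \<subseteq> S k" if "j < k" for j k
    using S_mono[of "Suc j" k] that by (auto simp: S D_def)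
  have disj: "disjoint_family D"
    unfolding disjoint_family_on_def
  proof (intro ballI impI)
    fix m n :: nat assume "m \<noteq> n"
    then show "D m \<inter> D n = {}"
      using D_S[of m n] D_S[of n m] HCN[OF fin[of m]] HCN[OF fin[of n]]
      unfolding D_def by (cases m n rule: linorder_cases) blast+
  qed
  \<comment> \<open>The rank used at \<open>y\<close>; off all \<open>D k\<close> the rank is 0.\<close>
  define n where "n y = (if \<exists>k. y \<in> D k then N (S (THE k. y \<in> D k)) else 0)" for y
  have n: "n y = N (S k)" if "y \<in> D k" for y k
  proof -
    have "(THE k. y \<in> D k) = k"
      using that disj unfolding disjoint_family_on_def by (intro the_equality) auto
    then show ?thesis using that by (auto simp: n_def)
  qed
  define Q where "Q = bdiag (\<lambda>y. fin_proj \<xi> (n y))"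
  note nfp = norm_fin_proj_le[OF \<xi>]
  have Q: "Q \<in> roe_algebra"
    unfolding Q_def by (intro bdiag_roe[of _ 1] nfp cblin_fin_proj compact_fin_proj \<xi>)
  have cutQ: "chi (D k) (Q f) = chi (D k) (P (N (S k)) f)" for k f
    by (rule ell2_eqI)
      (simp add: Q_def P_def bdiag_apply[where a = "\<lambda>_. fin_proj \<xi> _", OF nfp]
        bdiag_apply[where a = "\<lambda>y. fin_proj \<xi> (n y)", OF nfp] n)
  have un: "unitary u" by (rule roe_normalizer_unitary[OF u])
  define d where "d = Ad (adj u) Q"
  have d: "d \<in> roe_algebra" using u Q by (simp add: d_def roe_normalizer_def)
  have Qu: "Q (u f) = u (d f)" for f
    using un by (simp add: d_def adj_adj unitary_cblin)
  obtain K where K: "compact K"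
    "\<And>\<eta>. norm \<eta> \<le> 1 \<Longrightarrow> \<exists>z\<in>K. norm (d (delta x \<eta>) - z) \<le> e/2"
    by (rule roe_column_near_compact[OF ulf d, of "e/2" x]) (use e in auto)
  have "\<exists>z\<in>K. norm (d (delta x (H (S k))) - z) \<le> e/2" for k
    using K(2) HCN[OF fin[of k]] by simp
  then obtain z where z: "\<And>k. z k \<in> K" "\<And>k. norm (d (delta x (H (S k))) - z k) \<le> e/2" by metis
  have "e/2 \<le> norm (chi (D k) (u (z k)))" for k
  proof -
    let ?w = "d (delta x (H (S k)))"
    have "e < norm (chi (D k) (u ?w))"
      using HCN[OF fin[of k]] by (simp add: D_def[symmetric] cutQ[symmetric] Qu)
    also have "\<dots> \<le> norm (chi (D k) (u (z k))) + norm (chi (D k) (u (?w - z k)))"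
      using norm_triangle_ineq[of "chi (D k) (u (z k))" "chi (D k) (u (?w - z k))"]
      by (simp add: blinfun.diff_right)
    also have "norm (chi (D k) (u (?w - z k))) \<le> e/2"
      by (rule order_trans[OF norm_chi_le]) (simp only: unitary_norm[OF un] z(2))
    finally show ?thesis by simp
  qed
  moreover obtain k where "norm (chi (D k) (u (z k))) < e/2"
    using disjoint_chi_compact[OF unitary_norm_le[OF un] disj K(1) z(1), of "e/2"] e
    by (meson half_gt_zero)
  ultimately show False by (meson not_le)
qed

definition block_contraction :: "('x \<Rightarrow> 'h \<Rightarrow>\<^sub>L 'h::complex_hilbert) \<Rightarrow> bool" where
  "block_contraction a \<longleftrightarrow> (\<forall>x. a x \<in> \<B> \<and> norm (a x) \<le> 1)"

lemma norm_bdiag_contraction: "block_contraction a \<Longrightarrow> norm (bdiag a) \<le> 1"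
  by (simp add: block_contraction_def norm_bdiag_le)

lemma cblin_bdiag_contraction: "block_contraction a \<Longrightarrow> bdiag a \<in> \<B>"
  by (auto simp: block_contraction_def intro: cblin_bdiag[of _ 1])

lemma norm_Ad_bdiag_le: "unitary u \<Longrightarrow> block_contraction a \<Longrightarrow> norm (Ad u (bdiag a)) \<le> 1"
  using norm_Ad_le norm_bdiag_contraction order_trans by blast

text \<open>
  By \<open>column_decay\<close> there is a finite set \<open>G\<close> with \<open>u \<chi>\<^sub>F\<close> close to \<open>\<chi>\<^sub>G u \<chi>\<^sub>F\<close> in norm. Operators living on
  \<open>G\<close> have propagation at most the diameter of \<open>G\<close>, whatever the blocks are.
\<close>

lemma approximable_local_blocks:
  fixes u :: "('x::metric_space, 'h::complex_hilbert) operator"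
  assumes ulf: "uniformly_locally_finite TYPE('x)" and \<xi>: "orthonormal_basis (\<xi> :: nat \<Rightarrow> 'h)"
    and u: "roe_normalizer u" and e: "0 < e" and F: "finite F"
  obtains s where "\<And>b. block_contraction b \<Longrightarrow> (\<And>x. x \<notin> F \<Longrightarrow> b x = 0) \<Longrightarrow> approximable e s (Ad u (bdiag b))"
proof -
  have un: "unitary u" by (rule roe_normalizer_unitary[OF u])
  note uB = unitary_cblin[OF un]
  define d where "d = e / (2 * (real (card F) + 1))"
  have d: "0 < d" using e by (simp add: d_def add_nonneg_pos)
  have "\<exists>B. finite B \<and> (\<forall>\<eta>. norm (chi (- B) (u (delta x \<eta>))) \<le> d * norm \<eta>)" for x
    using column_decay[OF ulf \<xi> u d] by metis
  then obtain B where B: "\<And>x. finite (B x)"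
    "\<And>x \<eta>. norm (chi (- B x) (u (delta x \<eta>))) \<le> d * norm \<eta>" by metis
  define G where "G = (\<Union>x\<in>F. B x)"
  have G: "finite G" using F B(1) by (simp add: G_def)
  define V where "V = u o\<^sub>L chi F"
  have VB: "V \<in> \<B>" using uB by (simp add: V_def cblin_compose)
  have V: "norm V \<le> 1"
    using norm_compose_le[OF unitary_norm_le[OF un] norm_chi_le_1] by (simp add: V_def)
  have VG: "norm (V - (chi G o\<^sub>L V)) \<le> e/2"
  proof (rule norm_blinfun_bound)
    fix h
    have "(V - (chi G o\<^sub>L V)) h = (\<Sum>x\<in>F. chi (- G) (u (delta x (ell2_apply h x))))"
      by (simp add: V_def blinfun.diff_left chi_compl chi_finite[OF F] blinfun.sum_right sum_subtractf)
    also have "norm \<dots> \<le> (\<Sum>x\<in>F. d * norm h)"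
    proof (rule sum_norm_le)
      fix x assume "x \<in> F"
      then have "norm (chi (- G) (u (delta x (ell2_apply h x))))
          \<le> norm (chi (- B x) (u (delta x (ell2_apply h x))))"
        by (intro norm_chi_mono) (auto simp: G_def)
      also have "\<dots> \<le> d * norm h"
        using order_trans[OF B(2) mult_left_mono[OF norm_ell2_apply_le]] d by simp
      finally show "norm (chi (- G) (u (delta x (ell2_apply h x)))) \<le> d * norm h" .
    qed
    also have "\<dots> = (real (card F) * d) * norm h" by simp
    also have "\<dots> \<le> e/2 * norm h"
    proof (rule mult_right_mono)
      have "2 * (real (card F) + 1) * d = e" by (simp add: d_def)
      then show "real (card F) * d \<le> e/2" using d by (simp add: algebra_simps)
    qed simp
    finally show "norm ((V - (chi G o\<^sub>L V)) h) \<le> e/2 * norm h" .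
  qed (use e in simp)
  obtain s where s: "\<And>x y. x \<in> G \<Longrightarrow> y \<in> G \<Longrightarrow> dist x y \<le> s"
    using finite_dist_bound[OF G] by blast
  show thesis
  proof (rule that)
    fix b :: "'x \<Rightarrow> 'h \<Rightarrow>\<^sub>L 'h" assume b: "block_contraction b" and bF: "\<And>x. x \<notin> F \<Longrightarrow> b x = 0"
    let ?b = "bdiag b"
    have bap: "ell2_apply (?b h) x = b x (ell2_apply h x)" for h x
      using b by (intro bdiag_apply[of _ 1]) (simp add: block_contraction_def)
    have bcut: "chi F (?b (chi F h)) = ?b h" for h
      by (rule ell2_eqI) (auto simp: bap bF)
    have "adj V = chi F o\<^sub>L adj u" by (simp add: V_def adj_compose uB adj_chi)
    then have AdV: "Ad u ?b = V o\<^sub>L ?b o\<^sub>L adj V"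
      by (intro blinfun_eqI) (simp add: V_def bcut)
    define W where "W = chi G o\<^sub>L V"
    have WB: "W \<in> \<B>" using VB by (simp add: W_def cblin_compose)
    have W: "norm W \<le> 1" using norm_compose_le[OF norm_chi_le_1 V] by (simp add: W_def)
    have bB: "?b \<in> \<B>" by (rule cblin_bdiag_contraction[OF b])
    define c where "c = W o\<^sub>L ?b o\<^sub>L adj W"
    have "c \<in> \<B>" using WB bB by (simp add: c_def cblin_compose cblin_adj)
    moreover have "prop_le s c"
      unfolding prop_le_def
    proof (intro allI impI)
      fix x y :: 'x and \<eta> :: 'h assume "s < dist x y"
      then have xy: "x \<notin> G \<or> y \<notin> G" using s[of x y] by auto
      have "adj W = adj V o\<^sub>L chi G" by (simp add: W_def adj_compose VB adj_chi)
      with xy show "ell2_apply (c (delta x \<eta>)) y = 0" by (auto simp: c_def W_def)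
    qed
    moreover have "norm (Ad u ?b - c) \<le> e"
    proof -
      have "Ad u ?b - c = (V - W o\<^sub>L ?b o\<^sub>L adj V) + (W o\<^sub>L ?b o\<^sub>L adj (V - W))"
        unfolding AdV c_def adj_diff[OF VB WB]
        by (rule blinfun_eqI) (simp add: blinfun.diff_left blinfun.add_left blinfun.diff_right)
      also have "norm \<dots> \<le> norm (V - W o\<^sub>L ?b o\<^sub>L adj V) + norm (W o\<^sub>L ?b o\<^sub>L adj (V - W))"
        by (rule norm_triangle_ineq)
      also have "norm (V - W o\<^sub>L ?b o\<^sub>L adj V) \<le> e/2 * 1 * 1"
        by (intro norm_compose_le VG[folded W_def] norm_bdiag_contraction[OF b]
            order_trans[OF norm_adj_le[OF VB] V])
      also have "norm (W o\<^sub>L ?b o\<^sub>L adj (V - W)) \<le> 1 * 1 * (e/2)"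
        by (intro norm_compose_le W norm_bdiag_contraction[OF b]
            order_trans[OF norm_adj_le[OF cblin_diff[OF VB WB]] VG[folded W_def]])
      finally show ?thesis by simp
    qed
    ultimately show "approximable e s (Ad u ?b)" unfolding approximable_def by blast
  qed
qed

definition compact_blocks :: "('x \<Rightarrow> 'h \<Rightarrow>\<^sub>L 'h::complex_hilbert) \<Rightarrow> bool" where
  "compact_blocks a \<longleftrightarrow> block_contraction a \<and> (\<forall>x. compact_operator (a x))"

text \<open>
  Failure of approximability is decided by finitely many blocks: otherwise approximable operators
  agreeing with \<open>a\<close> on larger and larger finite sets would converge to \<open>a\<close>. In other words, the
  approximable families form a closed subset of the product of discrete spaces of blocks.
\<close>

lemma compact_blocks_not_approximable_open:
  fixes u :: "('x::metric_space, 'h::complex_hilbert) operator"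
  assumes un: "unitary u" and a: "compact_blocks a" and F: "finite F"
    and na: "\<not> approximable e s (Ad u (bdiag a))"
  obtains F' where "F \<subseteq> F'" "finite F'"
    "\<And>a'. compact_blocks a' \<Longrightarrow> (\<And>x. x \<in> F' \<Longrightarrow> a' x = a x) \<Longrightarrow> \<not> approximable e s (Ad u (bdiag a'))"
proof (rule ccontr)
  note out = that
  assume no: "\<not> thesis"
  have *: "\<exists>a'. compact_blocks a' \<and> (\<forall>x\<in>F'. a' x = a x) \<and> approximable e s (Ad u (bdiag a'))"
    if F': "F \<subseteq> F'" "finite F'" for F'
  proof (rule ccontr)
    assume no': "\<not> ?thesis"
    have thesis
    proof (rule out[OF F'])
      fix a' :: "'x \<Rightarrow> 'h \<Rightarrow>\<^sub>L 'h" assume "compact_blocks a'" "\<And>x. x \<in> F' \<Longrightarrow> a' x = a x"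
      with no' show "\<not> approximable e s (Ad u (bdiag a'))" by blast
    qed
    with no show False by contradiction
  qed
  have "\<exists>a'. compact_blocks a' \<and> (finite G \<longrightarrow> (\<forall>x\<in>G. a' x = a x)) \<and> approximable e s (Ad u (bdiag a'))" for G
    using *[of "F \<union> G"] *[of F] F by (cases "finite G") auto
  then obtain A where A: "\<And>G. compact_blocks (A G)"
    "\<And>G x. finite G \<Longrightarrow> x \<in> G \<Longrightarrow> A G x = a x" "\<And>G. approximable e s (Ad u (bdiag (A G)))" by metis
  have bc: "block_contraction (A G)" "block_contraction a" for G
    using A(1) a by (simp_all add: compact_blocks_def)
  have "approximable e s (Ad u (bdiag a))"
  proof (rule approximable_limit[OF _ A(3)])
    show "norm (Ad u (bdiag (A G))) \<le> 1" for G by (rule norm_Ad_bdiag_le[OF un bc(1)])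
    show "((\<lambda>G. Ad u (bdiag (A G)) h) \<longlongrightarrow> Ad u (bdiag a) h) (finite_subsets_at_top UNIV)" for h
      unfolding Ad_apply using bc A(2)
      by (intro blinfun.tendsto tendsto_const bdiag_tendsto) (auto simp: block_contraction_def)
  qed simp
  with na show False by blast
qed

text \<open>
  The Baire category theorem for a product of discrete spaces, carried out by hand: every family of
  compact blocks is approximable for some natural number \<open>s\<close>, so one of the closed sets indexed by \<open>s\<close>
  contains a cylinder. Otherwise finite patterns could be extended successively so that the \<open>k\<close>-th
  pattern excludes approximability with bound \<open>k\<close>, and the limit family would contradict its own
  membership in \<open>BD\<close> after conjugation.
\<close>

lemma compact_blocks_approximable_cylinder:
  fixes u :: "('x::metric_space, 'h::complex_hilbert) operator"
  assumes u: "roe_normalizer u" and e: "0 < e"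
  obtains s F a where "finite F" "compact_blocks a"
    "\<And>b. compact_blocks b \<Longrightarrow> (\<And>x. x \<in> F \<Longrightarrow> b x = a x) \<Longrightarrow> approximable e s (Ad u (bdiag b))"
proof (rule ccontr)
  note out = that
  assume no: "\<not> thesis"
  have *: "\<exists>b. compact_blocks b \<and> (\<forall>x\<in>F. b x = a x) \<and> \<not> approximable e s (Ad u (bdiag b))"
    if F: "finite F" "compact_blocks a" for s F a
  proof (rule ccontr)
    assume no': "\<not> ?thesis"
    have thesis
    proof (rule out[OF F])
      fix b :: "'x \<Rightarrow> 'h \<Rightarrow>\<^sub>L 'h" assume "compact_blocks b" "\<And>x. x \<in> F \<Longrightarrow> b x = a x"
      with no' show "approximable e s (Ad u (bdiag b))" by blast
    qed
    with no show False by contradiction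
  qed
  have un: "unitary u" by (rule roe_normalizer_unitary[OF u])
  define good where "good p \<longleftrightarrow> finite (fst p) \<and> compact_blocks (snd p)"
    for p :: "'x set \<times> ('x \<Rightarrow> 'h \<Rightarrow>\<^sub>L 'h)"
  define extend where "extend k p p' \<longleftrightarrow> fst p \<subseteq> fst p' \<and> (\<forall>x\<in>fst p. snd p' x = snd p x) \<and>
      (\<forall>b. compact_blocks b \<and> (\<forall>x\<in>fst p'. b x = snd p' x) \<longrightarrow> \<not> approximable e (real k) (Ad u (bdiag b)))"
    for k :: nat and p p' :: "'x set \<times> ('x \<Rightarrow> 'h \<Rightarrow>\<^sub>L 'h)"
  have "\<exists>f. \<forall>k. good (f k) \<and> extend k (f k) (f (Suc k))"
  proof (rule dependent_nat_choice)
    show "\<exists>p. good p"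
      by (rule exI[of _ "({}, \<lambda>_. 0)"])
        (simp add: good_def compact_blocks_def block_contraction_def)
    fix p k assume "good p"
    then obtain b where b: "compact_blocks b" "\<forall>x\<in>fst p. b x = snd p x"
      "\<not> approximable e (real k) (Ad u (bdiag b))"
      using *[of "fst p" "snd p" "real k"] by (auto simp: good_def)
    obtain F' where "fst p \<subseteq> F'" "finite F'"
      "\<And>a'. compact_blocks a' \<Longrightarrow> (\<And>x. x \<in> F' \<Longrightarrow> a' x = b x) \<Longrightarrow> \<not> approximable e (real k) (Ad u (bdiag a'))"
      by (rule compact_blocks_not_approximable_open[OF un b(1) _ b(3), of "fst p"])
        (use \<open>good p\<close> in \<open>auto simp: good_def\<close>)
    then show "\<exists>p'. good p' \<and> extend k p p'"
      using b by (intro exI[of _ "(F', b)"]) (auto simp: good_def extend_def)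
  qed
  then obtain f where f: "\<And>k. good (f k)" "\<And>k. extend k (f k) (f (Suc k))" by blast
  define F where "F k = fst (f k)" for k
  define A where "A k = snd (f k)" for k
  have incr: "F k \<subseteq> F (Suc k)" "\<And>x. x \<in> F k \<Longrightarrow> A (Suc k) x = A k x" for k
    using f(2)[of k] by (auto simp: extend_def F_def A_def)
  have mono: "F j \<subseteq> F k \<and> (\<forall>x\<in>F j. A k x = A j x)" if "j \<le> k" for j k
    using that
  proof (induction rule: dec_induct)
    case (step n)
    then have "F j \<subseteq> F n" "\<forall>x\<in>F j. A n x = A j x" by blast+
    then show ?case using incr(1)[of n] incr(2)[of _ n] by (auto dest: subsetD)
  qed simp
  \<comment> \<open>The limit family takes the value settled when \<open>x\<close> first enters a pattern.\<close>
  define a where "a x = (if \<exists>k. x \<in> F k then A (LEAST k. x \<in> F k) x else 0)" for x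
  have aA: "a x = A k x" if "x \<in> F k" for x k
    using mono[of "LEAST k. x \<in> F k" k] that LeastI[of "\<lambda>k. x \<in> F k", OF that]
      Least_le[of "\<lambda>k. x \<in> F k", OF that] by (auto simp: a_def)
  have "compact_blocks (A k)" for k using f(1)[of k] by (simp add: good_def A_def)
  then have cba: "compact_blocks a"
    unfolding compact_blocks_def block_contraction_def a_def by auto
  have "Ad u (bdiag a) \<in> BD"
  proof -
    have "bdiag a \<in> roe_algebra"
      using cba by (intro bdiag_roe[of _ 1]) (auto simp: compact_blocks_def block_contraction_def)
    then show ?thesis using u by (auto simp: roe_normalizer_def roe_algebra_def)
  qed
  then obtain s where s: "approximable e s (Ad u (bdiag a))" using e unfolding BD_iff by blast
  obtain k :: nat where "s \<le> real k" using real_arch_simple by blast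
  then have "approximable e (real k) (Ad u (bdiag a))" using approximable_mono[OF s order_refl] by blast
  moreover have "\<not> approximable e (real k) (Ad u (bdiag a))"
    using f(2)[of k] cba aA[of _ "Suc k"] by (auto simp: extend_def F_def A_def)
  ultimately show False by blast
qed

lemma bdiag_restrict_add:
  assumes a: "\<And>x. norm (a x) \<le> 1" and b: "\<And>x. norm (b x) \<le> 1" and c: "\<And>x. norm (c x) \<le> 1"
    and "\<And>x. a x = b x + c x"
  shows "bdiag a = bdiag b + bdiag c"
  by (rule blinfun_eqI, rule ell2_eqI)
    (simp add: blinfun.add_left bdiag_apply[OF a] bdiag_apply[OF b] bdiag_apply[OF c] assms(4))

text \<open>
  A family supported off \<open>F\<close> is a difference of two members of the cylinder; the part supported on
  \<open>F\<close> is covered by \<open>approximable_local_blocks\<close>.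
\<close>

lemma compact_blocks_uniformly_approximable:
  fixes u :: "('x::metric_space, 'h::complex_hilbert) operator"
  assumes ulf: "uniformly_locally_finite TYPE('x)" and \<xi>: "orthonormal_basis (\<xi> :: nat \<Rightarrow> 'h)"
    and u: "roe_normalizer u" and e: "0 < e"
  obtains s where "\<And>b. compact_blocks b \<Longrightarrow> approximable e s (Ad u (bdiag b))"
proof -
  have e3: "0 < e/3" using e by simp
  obtain s F a where F: "finite F" and a: "compact_blocks a"
    and cyl: "\<And>b. compact_blocks b \<Longrightarrow> (\<And>x. x \<in> F \<Longrightarrow> b x = a x) \<Longrightarrow> approximable (e/3) s (Ad u (bdiag b))"
    using compact_blocks_approximable_cylinder[OF u e3] by metis
  obtain t where t: "\<And>b. block_contraction b \<Longrightarrow> (\<And>x. x \<notin> F \<Longrightarrow> b x = 0) \<Longrightarrow> approximable (e/3) t (Ad u (bdiag b))"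
    using approximable_local_blocks[OF ulf \<xi> u e3 F] by metis
  show thesis
  proof (rule that)
    fix b :: "'x \<Rightarrow> 'h \<Rightarrow>\<^sub>L 'h" assume b: "compact_blocks b"
    define a0 where "a0 x = (if x \<in> F then a x else 0)" for x
    define b0 where "b0 x = (if x \<in> F then b x else 0)" for x
    define b1 where "b1 x = (if x \<in> F then 0 else b x)" for x
    define c where "c x = (if x \<in> F then a x else b x)" for x
    have cb: "compact_blocks a0" "compact_blocks b0" "compact_blocks b1" "compact_blocks c"
      using a b unfolding compact_blocks_def block_contraction_def a0_def b0_def b1_def c_def by auto
    then have n: "\<And>x. norm (a0 x) \<le> 1" "\<And>x. norm (b0 x) \<le> 1" "\<And>x. norm (b1 x) \<le> 1"
      "\<And>x. norm (c x) \<le> 1" "\<And>x. norm (b x) \<le> 1"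
      using b unfolding compact_blocks_def block_contraction_def by blast+
    have "bdiag b = bdiag b0 + bdiag b1" "bdiag c = bdiag a0 + bdiag b1"
      by (rule bdiag_restrict_add; (rule n | simp add: b0_def b1_def c_def a0_def))+
    then have eq: "Ad u (bdiag b) = Ad u (bdiag b0) + (Ad u (bdiag c) - Ad u (bdiag a0))"
      by (simp add: Ad_add)
    have "approximable (e/3 + (e/3 + e/3)) (max s t) (Ad u (bdiag b))"
      unfolding eq
    proof (intro approximable_add approximable_diff)
      show "approximable (e/3) (max s t) (Ad u (bdiag b0))"
        using t[of b0] cb(2) approximable_mono[of "e/3" t _ "e/3" "max s t"]
        by (auto simp: compact_blocks_def b0_def)
      show "approximable (e/3) (max s t) (Ad u (bdiag c))" "approximable (e/3) (max s t) (Ad u (bdiag a0))"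
        using cyl[of c] cyl[of a0] cb approximable_mono[of "e/3" s _ "e/3" "max s t"]
        by (auto simp: c_def a0_def)
    qed
    then show "approximable e (max s t) (Ad u (bdiag b))" by simp
  qed
qed

text \<open>
  Composing with finite-rank truncations makes arbitrary blocks compact, with a bound that does not
  depend on the truncation, and the limit inherits it.
\<close>

theorem blocks_uniformly_approximable:
  fixes u :: "('x::metric_space, 'h::complex_hilbert) operator"
  assumes ulf: "uniformly_locally_finite TYPE('x)" and \<xi>: "orthonormal_basis (\<xi> :: nat \<Rightarrow> 'h)"
    and u: "roe_normalizer u" and e: "0 < e"
  obtains s where "\<And>b. block_contraction b \<Longrightarrow> approximable e s (Ad u (bdiag b))"
proof -
  obtain s where s: "\<And>b. compact_blocks b \<Longrightarrow> approximable e s (Ad u (bdiag b))"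
    using compact_blocks_uniformly_approximable[OF ulf \<xi> u e] by metis
  have un: "unitary u" by (rule roe_normalizer_unitary[OF u])
  note nfp = norm_fin_proj_le[OF \<xi>]
  show thesis
  proof (rule that)
    fix b :: "'x \<Rightarrow> 'h \<Rightarrow>\<^sub>L 'h" assume b: "block_contraction b"
    define c where "c n x = fin_proj \<xi> n o\<^sub>L b x" for n :: nat and x
    have bn: "norm (b x) \<le> 1" for x using b by (simp add: block_contraction_def)
    have cn: "norm (c n x) \<le> 1" for n x
      using norm_compose_le[OF nfp bn] by (simp add: c_def)
    have cc: "compact_blocks (c n)" for n
      using b cn compact_fin_proj_compose[OF \<xi>] unfolding compact_blocks_def block_contraction_def c_def
      by (auto intro: cblin_compose)
    show "approximable e s (Ad u (bdiag b))"
    proof (rule approximable_limit[OF _ s[OF cc]])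
      show "norm (Ad u (bdiag (c n))) \<le> 1" for n
        using cc by (intro norm_Ad_bdiag_le[OF un]) (simp add: compact_blocks_def)
      fix h
      have "bdiag (c n) f = bdiag (\<lambda>_. fin_proj \<xi> n) (bdiag b f)" for n f
        by (rule ell2_eqI)
          (simp add: bdiag_apply[where a = "c n", OF cn] bdiag_apply[where a = b, OF bn]
            bdiag_apply[where a = "\<lambda>_. fin_proj \<xi> n", OF nfp], simp add: c_def)
      then show "(\<lambda>n. Ad u (bdiag (c n)) h) \<longlonglongrightarrow> Ad u (bdiag b) h"
        by (simp only: Ad_apply)
          (intro blinfun.tendsto tendsto_const bdiag_fin_proj_tendsto \<xi>)
    qed simp
  qed
qed

section \<open>Concentration of blocks under property A\<close>

lemma bdiag_rank_one:
  fixes \<eta> \<eta>' :: "'h::complex_hilbert"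
  shows "bdiag (\<lambda>z. if z = x then rank_one \<eta>' \<eta> else 0) = rank_one (delta x \<eta>') (delta x \<eta>)"
proof (rule blinfun_eqI, rule ell2_eqI)
  fix h y
  have "norm (if z = x then rank_one \<eta>' \<eta> else 0) \<le> norm (rank_one \<eta>' \<eta>)" for z :: 'a
    by simp
  then have "ell2_apply (bdiag (\<lambda>z. if z = x then rank_one \<eta>' \<eta> else 0) h) y
      = (if y = x then rank_one \<eta>' \<eta> else 0) (ell2_apply h y)"
    by (rule bdiag_apply)
  then show "ell2_apply (bdiag (\<lambda>z. if z = x then rank_one \<eta>' \<eta> else 0) h) y
      = ell2_apply (rank_one (delta x \<eta>') (delta x \<eta>) h) y"
    by (simp add: cinner_delta)
qed

text \<open>
  Together with \<open>bdiag_rank_one\<close> this exhibits rank-one operators between vectors of \<open>u (\<delta>\<^sub>x \<otimes> H)\<close> as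
  conjugates of block-diagonal operators.
\<close>

lemma Ad_rank_one: "u \<in> \<B> \<Longrightarrow> Ad u (rank_one h k) = rank_one (u h) (u k)"
  by (rule blinfun_eqI) (simp add: cinner_adj' cblinfunD)

text \<open>
  Norm localisation for an operator \<open>c\<close> of finite propagation near the projection onto \<open>v\<close> yields a
  unit vector \<open>k\<close> of small support with \<open>\<bar>cinner k v\<bar>\<close> close to 1, so \<open>v\<close> has almost all of its mass on
  the support of \<open>k\<close>. The radius depends on \<open>s\<close> and \<open>t\<close> only, not on \<open>v\<close>.
\<close>

lemma unit_vector_concentrated:
  assumes PA: "property_A TYPE('x::metric_space) TYPE('h::complex_hilbert)"
    and t: "0 < t" "3 * t \<le> 1"
  shows "\<exists>r\<ge>0. \<forall>v :: ('x, 'h) ell2. norm v = 1 \<longrightarrow> approximable t s (rank_one v v) \<longrightarrow>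
    (\<exists>z. (norm (chi (- cball z r) v))\<^sup>2 \<le> 6 * t)"
proof -
  have "max s 1 > 0" "1 - t \<in> {0<..<1}" using t by auto
  with PA obtain r where r: "r > 0" and loc: "\<And>a :: ('x, 'h) operator.
      a \<in> \<B> \<Longrightarrow> propagation a \<le> ennreal (max s 1) \<Longrightarrow>
        \<exists>k. norm k = 1 \<and> bounded (support k) \<and> diameter (support k) \<le> r \<and>
             norm (a k) \<ge> (1 - t) * norm a"
    unfolding property_A_def by blast
  show ?thesis
  proof (intro exI[of _ r] conjI allI impI)
    fix v :: "('x, 'h) ell2" assume v: "norm v = 1" and "approximable t s (rank_one v v)"
    then obtain c where c: "c \<in> \<B>" "prop_le (max s 1) c" "norm (rank_one v v - c) \<le> t"
      using approximable_mono[of t s _ t "max s 1"] unfolding approximable_def by auto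
    obtain k where k: "norm k = 1" "bounded (support k)" "diameter (support k) \<le> r"
      "(1 - t) * norm c \<le> norm (c k)"
      using loc[OF c(1)] c(2) propagation_le_iff[of "max s 1" c] by auto
    have "rank_one v v v = v" using v by (simp add: cinner_self)
    then have "1 \<le> norm (rank_one v v)" using norm_blinfun[of "rank_one v v" v] v by simp
    then have "1 - t \<le> norm c"
      using c(3) norm_triangle_ineq2[of "rank_one v v" c] by linarith
    then have "(1 - t) * (1 - t) \<le> (1 - t) * norm c"
      using t by (intro mult_left_mono) auto
    then have "(1 - t) * (1 - t) \<le> norm (c k)" using k(4) by linarith
    moreover have "norm ((rank_one v v - c) k) \<le> t"
      using norm_blinfun_le[OF c(3), of k] k(1) by simp
    moreover have "norm (c k) \<le> norm (rank_one v v k) + norm ((rank_one v v - c) k)"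
      using norm_triangle_ineq4[of "rank_one v v k" "(rank_one v v - c) k"]
      by (simp add: blinfun.diff_left)
    moreover have "(1 - t) * (1 - t) = 1 - 2 * t + t * t" by (simp add: algebra_simps)
    ultimately have "1 - 3 * t \<le> norm (rank_one v v k)"
      using zero_le_square[of t] by linarith
    also have "\<dots> = norm (cinner k v)" using v by (simp add: norm_scaleC)
    also have "cinner k v = cinner k (chi (support k) v)"
    proof -
      have "chi (support k) k = k" by (rule ell2_eqI) (simp add: support_def)
      then show ?thesis by (metis cinner_chi)
    qed
    also have "norm \<dots> \<le> norm (chi (support k) v)" using norm_cinner_le k(1) by (metis mult_1)
    finally have low: "1 - 3 * t \<le> norm (chi (support k) v)" .
    obtain z where z: "z \<in> support k"
    proof -
      have "k \<noteq> 0" using k(1) by auto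
      then have "\<exists>z. ell2_apply k z \<noteq> 0" by (metis ell2_eqI zero_ell2.rep_eq)
      then show thesis using that by (auto simp: support_def)
    qed
    have "support k \<subseteq> cball z r"
      using diameter_bounded_bound[OF k(2) z] k(3) by fastforce
    then have "1 - 3 * t \<le> norm (chi (cball z r) v)"
      using low norm_chi_mono order_trans by blast
    then have "(1 - 3 * t)\<^sup>2 \<le> (norm (chi (cball z r) v))\<^sup>2"
      using t by (intro power_mono) auto
    moreover have "(1 - 3 * t)\<^sup>2 = 1 - 6 * t + 9 * t\<^sup>2"
      by (simp add: power2_eq_square algebra_simps)
    moreover have "(norm (chi (cball z r) v))\<^sup>2 + (norm (chi (- cball z r) v))\<^sup>2 = 1"
      using norm_square_chi[of v "cball z r"] v by simp
    ultimately have "(norm (chi (- cball z r) v))\<^sup>2 \<le> 6 * t"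
      using zero_le_power2[of t] by linarith
    then show "\<exists>z. (norm (chi (- cball z r) v))\<^sup>2 \<le> 6 * t" ..
  qed (use r in simp)
qed

text \<open>
  The block at \<open>x\<close> is moved into the ball of radius \<open>R\<close> around \<open>f x\<close>, up to a relative error \<open>e\<close>.
\<close>

definition concentrated ::
    "('x::metric_space, 'h::complex_hilbert) operator \<Rightarrow> real \<Rightarrow> real \<Rightarrow> ('x \<Rightarrow> 'x) \<Rightarrow> bool" where
  "concentrated u e R f \<longleftrightarrow> (\<forall>x \<eta>. norm (chi (- cball (f x) R) (u (delta x \<eta>))) \<le> e * norm \<eta>)"

text \<open>
  Each unit vector \<open>\<eta>\<close> has its own ball \<open>cball (Z x \<eta>) r\<close> by \<open>unit_vector_concentrated\<close>. If \<open>v\<close> and \<open>v'\<close> come from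
  the same \<open>x\<close>, then \<open>rank_one v' v\<close> maps the part of \<open>v\<close> in its ball to a vector with substantial mass in
  the ball of \<open>v'\<close>; being nearly of propagation \<open>s\<close>, it forces the two balls to be close. So the
  ball of one fixed \<open>\<eta>\<close>, enlarged, works for all.
\<close>

theorem roe_normalizer_concentrated:
  fixes u :: "('x::metric_space, 'h::complex_hilbert) operator"
  assumes ulf: "uniformly_locally_finite TYPE('x)" and PA: "property_A TYPE('x) TYPE('h)"
    and \<xi>: "orthonormal_basis (\<xi> :: nat \<Rightarrow> 'h)" and u: "roe_normalizer u" and e: "0 < e"
  obtains R f where "concentrated u e R f"
proof -
  have un: "unitary u" by (rule roe_normalizer_unitary[OF u])
  \<comment> \<open>\<open>6 * t \<le> e\<^sup>2\<close> gives the final error; \<open>6 * t \<le> 1/4\<close> leaves mass 3/4 in each ball, and \<open>9/16 > t\<close>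
    yields the contradiction for balls that are far apart.\<close>
  define t where "t = min (e\<^sup>2 / 6) (1/24)"
  have t: "0 < t" "3 * t \<le> 1" "6 * t \<le> e\<^sup>2" "6 * t \<le> 1/4"
    using e by (auto simp: t_def min_def)
  obtain s0 where s0: "\<And>b :: 'x \<Rightarrow> 'h \<Rightarrow>\<^sub>L 'h. block_contraction b \<Longrightarrow> approximable t s0 (Ad u (bdiag b))"
    using blocks_uniformly_approximable[OF ulf \<xi> u t(1)] by metis
  define s where "s = max s0 0"
  have approximable: "approximable t s (rank_one (u (delta x \<eta>')) (u (delta x \<eta>)))"
    if "norm \<eta> = 1" "norm \<eta>' = 1" for x and \<eta> \<eta>' :: 'h
  proof -
    have "block_contraction (\<lambda>z. if z = x then rank_one \<eta>' \<eta> else 0)"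
      using norm_rank_one_le[of \<eta>' \<eta>] that by (simp add: block_contraction_def)
    from s0[OF this] have "approximable t s0 (rank_one (u (delta x \<eta>')) (u (delta x \<eta>)))"
      by (simp add: bdiag_rank_one Ad_rank_one unitary_cblin[OF un])
    then show ?thesis by (rule approximable_mono) (simp_all add: s_def)
  qed
  obtain r where r: "0 \<le> r \<and> (\<forall>v :: ('x, 'h) ell2. norm v = 1 \<longrightarrow> approximable t s (rank_one v v) \<longrightarrow>
    (\<exists>z. (norm (chi (- cball z r) v))\<^sup>2 \<le> 6 * t))"
    using unit_vector_concentrated[OF PA t(1,2), of s] by (rule exE)
  have n1: "norm (u (delta x \<eta>)) = 1" if "norm \<eta> = 1" for x and \<eta> :: 'h
    using that by (simp add: unitary_norm[OF un] norm_delta)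
  have "\<exists>z. (norm (chi (- cball z r) (u (delta x \<eta>))))\<^sup>2 \<le> 6 * t"
    if "norm \<eta> = 1" for x and \<eta> :: 'h
    using mp[OF mp[OF spec[OF conjunct2[OF r]] n1[OF that]] approximable[OF that that]] .
  note ball = this
  define Z where "Z x \<eta> = (SOME z. (norm (chi (- cball z r) (u (delta x \<eta>))))\<^sup>2 \<le> 6 * t)" for x \<eta>
  have Z: "(norm (chi (- cball (Z x \<eta>) r) (u (delta x \<eta>))))\<^sup>2 \<le> 6 * t" if "norm \<eta> = 1" for x \<eta>
    unfolding Z_def by (rule someI_ex[OF ball[OF that]])
  have \<xi>0: "norm (\<xi> 0) = 1" by (rule norm_basis[OF \<xi>])
  have close: "dist (Z x (\<xi> 0)) (Z x \<eta>) \<le> 2 * r + s" if \<eta>: "norm \<eta> = 1" for x and \<eta> :: 'h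
  proof (rule ccontr)
    assume far: "\<not> ?thesis"
    define v where "v = u (delta x (\<xi> 0))"
    define v' where "v' = u (delta x \<eta>)"
    define A where "A = cball (Z x (\<xi> 0)) r"
    define A' where "A' = cball (Z x \<eta>) r"
    obtain c where c: "prop_le s c" "norm (rank_one v' v - c) \<le> t"
      using approximable[OF \<xi>0 \<eta>, of x] unfolding approximable_def v_def v'_def by blast
    have big: "3/4 \<le> (norm (chi A v))\<^sup>2" "3/4 \<le> (norm (chi A' v'))\<^sup>2"
      using norm_square_chi[of v A] norm_square_chi[of v' A'] Z[OF \<xi>0, of x] Z[OF \<eta>, of x] t(4)
        n1[OF \<xi>0, of x] n1[OF \<eta>, of x] by (simp_all add: A_def A'_def v_def v'_def)
    have n: "norm (chi A' v') \<le> 1" "norm (chi A v) \<le> 1"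
      using norm_chi_le n1[OF \<eta>, of x] n1[OF \<xi>0, of x] unfolding v'_def v_def by metis+
    have "chi A' (c (chi A v)) = 0"
    proof (rule ell2_eqI)
      fix p
      show "ell2_apply (chi A' (c (chi A v))) p = ell2_apply 0 p"
      proof (cases "p \<in> A'")
        case True
        have "ell2_apply (chi A v) q = 0" if "dist q p \<le> s" for q
        proof -
          have "dist (Z x (\<xi> 0)) (Z x \<eta>) \<le> dist (Z x (\<xi> 0)) q + dist q p + dist p (Z x \<eta>)"
            using dist_triangle[of "Z x (\<xi> 0)" "Z x \<eta>" q] dist_triangle[of q "Z x \<eta>" p] by linarith
          then have "q \<notin> A" using far that True by (auto simp: A_def A'_def dist_commute)
          then show ?thesis by simp
        qed
        then have "ell2_apply (c (chi A v)) p = 0" by (rule prop_leD[OF c(1)])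
        then show ?thesis by simp
      qed simp
    qed
    then have "norm (chi A' (rank_one v' v (chi A v))) = norm (chi A' ((rank_one v' v - c) (chi A v)))"
      by (simp only: blinfun.diff_left blinfun.diff_right diff_zero)
    moreover have "norm (chi A' ((rank_one v' v - c) (chi A v))) \<le> t * norm (chi A v)"
      by (rule order_trans[OF norm_chi_le norm_blinfun_le[OF c(2)]])
    moreover have "t * norm (chi A v) \<le> t * 1" using n(2) t(1) by (intro mult_left_mono) auto
    moreover have "cinner (chi A v) v = complex_of_real ((norm (chi A v))\<^sup>2)"
      using cinner_chi[of A "chi A v" v] by (simp add: cinner_self)
    then have "norm (chi A' (rank_one v' v (chi A v))) = (norm (chi A v))\<^sup>2 * norm (chi A' v')"
      by (simp add: cblinfunD norm_scaleC norm_power)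
    moreover have "3/4 * (3/4) \<le> (norm (chi A v))\<^sup>2 * norm (chi A' v')"
    proof (rule mult_mono)
      have "(norm (chi A' v'))\<^sup>2 \<le> norm (chi A' v') * 1"
        unfolding power2_eq_square using n(1) by (intro mult_left_mono) auto
      then show "3/4 \<le> norm (chi A' v')" using big(2) by linarith
    qed (use big(1) in auto)
    ultimately show False using t(4) by linarith
  qed
  have "concentrated u e (3 * r + s) (\<lambda>x. Z x (\<xi> 0))"
    unfolding concentrated_def
  proof (intro allI)
    fix x and \<eta> :: 'h
    show "norm (chi (- cball (Z x (\<xi> 0)) (3 * r + s)) (u (delta x \<eta>))) \<le> e * norm \<eta>"
    proof (cases "\<eta> = 0")
      case False
      define \<eta>1 where "\<eta>1 = (1 / norm \<eta>) *\<^sub>R \<eta>"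
      have \<eta>1: "norm \<eta>1 = 1" "\<eta> = norm \<eta> *\<^sub>R \<eta>1" using False by (simp_all add: \<eta>1_def)
      have "cball (Z x \<eta>1) r \<subseteq> cball (Z x (\<xi> 0)) (3 * r + s)"
      proof
        fix p assume "p \<in> cball (Z x \<eta>1) r"
        then show "p \<in> cball (Z x (\<xi> 0)) (3 * r + s)"
          using close[OF \<eta>1(1), of x] dist_triangle[of "Z x (\<xi> 0)" p "Z x \<eta>1"] by simp
      qed
      then have "norm (chi (- cball (Z x (\<xi> 0)) (3 * r + s)) (u (delta x \<eta>1)))
          \<le> norm (chi (- cball (Z x \<eta>1) r) (u (delta x \<eta>1)))"
        by (intro norm_chi_mono) auto
      also have "\<dots> \<le> e"
        by (rule power2_le_imp_le[OF order_trans[OF Z[OF \<eta>1(1)] t(3)]]) (use e in simp)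
      finally have "norm (chi (- cball (Z x (\<xi> 0)) (3 * r + s)) (u (delta x \<eta>1))) \<le> e" .
      moreover have "chi (- cball (Z x (\<xi> 0)) (3 * r + s)) (u (delta x \<eta>))
          = norm \<eta> *\<^sub>R chi (- cball (Z x (\<xi> 0)) (3 * r + s)) (u (delta x \<eta>1))"
        by (subst \<eta>1(2), simp add: linear_scale[OF bounded_linear.linear[OF bounded_linear_delta]]
            blinfun.scaleR_right del: chi_delta)
      ultimately show ?thesis
        by (simp add: mult.commute[of e] mult_left_mono)
    qed simp
  qed
  then show thesis by (rule that)
qed

lemma ulf_card_cball:
  assumes "uniformly_locally_finite TYPE('x::metric_space)"
  obtains N where "0 < N" "\<And>x :: 'x. finite (cball x r)" "\<And>x :: 'x. card (cball x r) \<le> N"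
proof -
  obtain N where N: "\<And>x :: 'x. finite (cball x (max r 1)) \<and> card (cball x (max r 1)) \<le> N"
    using assms unfolding uniformly_locally_finite_def
    by (metis max.strict_coboundedI2 zero_less_one)
  have sub: "cball x r \<subseteq> cball x (max r 1)" for x :: 'x by auto
  show thesis
  proof (rule that[of "Suc N"])
    fix x :: 'x
    show "finite (cball x r)" using N sub finite_subset by blast
    have "card (cball x r) \<le> card (cball x (max r 1))" using N sub by (intro card_mono) auto
    then show "card (cball x r) \<le> Suc N" using N[of x] by linarith
  qed simp
qed

text \<open>
An entry and the transposed entry of the adjoint are adjoint to each other.
\<close>

lemma entry_norm_dual:
  fixes a :: "('x, 'h::complex_hilbert) operator"
  assumes a: "a \<in> \<B>" and le: "\<And>\<eta>. norm (ell2_apply (adj a (delta z \<eta>)) x) \<le> e * norm \<eta>"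
  shows "norm (ell2_apply (a (delta x \<eta>)) z) \<le> e * norm \<eta>"
proof -
  define w where "w = ell2_apply (a (delta x \<eta>)) z"
  have "cinner w w = cinner (a (delta x \<eta>)) (delta z w)" by (simp add: cinner_delta w_def)
  also have "\<dots> = cinner (delta x \<eta>) (adj a (delta z w))" by (rule cinner_adj[OF a])
  also have "\<dots> = cnj (cinner (ell2_apply (adj a (delta z w)) x) \<eta>)"
    by (metis cinner_commute cinner_delta)
  finally have "norm (cinner w w) = norm (cinner (ell2_apply (adj a (delta z w)) x) \<eta>)" by simp
  also have "\<dots> \<le> norm (ell2_apply (adj a (delta z w)) x) * norm \<eta>" by (rule norm_cinner_le)
  also have "\<dots> \<le> e * norm w * norm \<eta>" by (rule mult_right_mono[OF le]) simp
  finally have sq: "norm w * norm w \<le> norm w * (e * norm \<eta>)"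
    by (simp add: cinner_self power2_eq_square ac_simps norm_mult)
  show ?thesis
  proof (cases "w = 0")
    case True
    have "0 \<le> e * norm \<eta>"
      using order_trans[OF norm_ge_zero le[of \<eta>]] .
    then show ?thesis using True by (simp add: w_def)
  next
    case False
    then show ?thesis using sq by (simp add: w_def)
  qed
qed

text \<open>
  At least 3/4 of the squared mass lies on \<open>B\<close>, so some point of \<open>B\<close> carries more than the fraction
  \<open>1 / (4 N)\<close> of it.
\<close>

lemma concentrated_entry_ge:
  assumes un: "unitary u" and conc: "concentrated u (1/2) R f"
    and \<eta>: "norm \<eta> = 1" and B: "finite B" "cball (f x) R \<subseteq> B" "card B \<le> N" and N: "0 < N"
  obtains z where "z \<in> B" "1 / (2 * sqrt (real N)) < norm (ell2_apply (u (delta x \<eta>)) z)"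
proof (rule ccontr)
  let ?v = "u (delta x \<eta>)"
  assume "\<not> thesis"
  then have small: "norm (ell2_apply ?v z) \<le> 1 / (2 * sqrt (real N))" if "z \<in> B" for z
    using that \<open>\<And>z. \<lbrakk>z \<in> B; 1 / (2 * sqrt (real N)) < norm (ell2_apply ?v z)\<rbrakk> \<Longrightarrow> thesis\<close>
    by (meson not_le)
  have "(norm (chi B ?v))\<^sup>2 = (\<Sum>z\<in>B. (norm (ell2_apply ?v z))\<^sup>2)"
    by (rule norm_chi_finite_square[OF B(1)])
  also have "\<dots> \<le> (\<Sum>z\<in>B. 1 / (4 * real N))"
  proof (rule sum_mono)
    fix z assume "z \<in> B"
    then have "(norm (ell2_apply ?v z))\<^sup>2 \<le> (1 / (2 * sqrt (real N)))\<^sup>2"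
      using small by (intro power_mono) auto
    then show "(norm (ell2_apply ?v z))\<^sup>2 \<le> 1 / (4 * real N)"
      by (simp add: power_divide power_mult_distrib)
  qed
  also have "\<dots> \<le> 1/4" using B(3) N by (simp add: field_simps)
  finally have 1: "(norm (chi B ?v))\<^sup>2 \<le> 1/4" .
  have "norm (chi (- B) ?v) \<le> norm (chi (- cball (f x) R) ?v)"
    using B(2) by (intro norm_chi_mono) auto
  also have "\<dots> \<le> 1/2" using conc \<eta> unfolding concentrated_def by (metis mult.right_neutral)
  finally have "(norm (chi (- B) ?v))\<^sup>2 \<le> (1/2)\<^sup>2" by (intro power_mono) auto
  with 1 norm_square_chi[of ?v B] show False
    using \<eta> by (simp add: unitary_norm[OF un] norm_delta power_divide)
qed

lemma concentrated_entry_le: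
  assumes "concentrated u e R f" "z \<notin> cball (f x) R"
  shows "norm (ell2_apply (u (delta x \<eta>)) z) \<le> e * norm \<eta>"
proof -
  have "norm (ell2_apply (u (delta x \<eta>)) z) = norm (ell2_apply (chi (- cball (f x) R) (u (delta x \<eta>))) z)"
    using assms(2) by simp
  also have "\<dots> \<le> norm (chi (- cball (f x) R) (u (delta x \<eta>)))" by (rule norm_ell2_apply_le)
  finally show ?thesis using assms(1) unfolding concentrated_def by (meson order_trans)
qed

text \<open>
  If \<open>f x\<close> is near \<open>y\<close>, the image of the block at \<open>x\<close> has an entry of size at least \<open>d\<close> at some point \<open>z\<close> of a
  ball around \<open>y\<close>, with \<open>d\<close> depending on the size of balls only. The adjoint of \<open>u\<close> is concentrated with
  error \<open>d\<close> along some \<open>g\<close>, so \<open>x\<close> lies in one of boundedly many balls of bounded size. The error has to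
  be adapted to \<open>d\<close>, which is why concentration is needed for arbitrarily small errors.
\<close>

lemma concentrated_fibres_bounded:
  fixes u :: "('x::metric_space, 'h::complex_hilbert) operator"
  assumes ulf: "uniformly_locally_finite TYPE('x)" and PA: "property_A TYPE('x) TYPE('h)"
    and \<xi>: "orthonormal_basis (\<xi> :: nat \<Rightarrow> 'h)" and u: "roe_normalizer u"
    and conc: "concentrated u (1/2) R f"
  obtains N where "\<And>y. finite {x. dist (f x) y \<le> t}" "\<And>y. card {x. dist (f x) y \<le> t} \<le> N"
proof -
  have un: "unitary u" by (rule roe_normalizer_unitary[OF u])
  obtain N1 where N1: "0 < N1" "\<And>x :: 'x. finite (cball x (t + R))" "\<And>x :: 'x. card (cball x (t + R)) \<le> N1"
    using ulf_card_cball[OF ulf, of "t + R"] by blast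
  define d where "d = 1 / (2 * sqrt (real N1))"
  have d: "0 < d" using N1(1) by (simp add: d_def)
  obtain R' g where g: "concentrated (adj u) d R' g"
    using roe_normalizer_concentrated[OF ulf PA \<xi> roe_normalizer_adj[OF u] d] by blast
  obtain N2 where "0 < N2" and N2: "\<And>x :: 'x. finite (cball x R')" "\<And>x :: 'x. card (cball x R') \<le> N2"
    using ulf_card_cball[OF ulf, of R'] by blast
  have sub: "{x. dist (f x) y \<le> t} \<subseteq> (\<Union>z\<in>cball y (t + R). cball (g z) R')" for y
  proof
    fix x assume "x \<in> {x. dist (f x) y \<le> t}"
    then have xy: "dist y (f x) \<le> t" by (simp add: dist_commute)
    have "cball (f x) R \<subseteq> cball y (t + R)"
    proof
      fix p assume "p \<in> cball (f x) R"
      then show "p \<in> cball y (t + R)" using xy dist_triangle[of y p "f x"] by simp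
    qed
    then obtain z where z: "z \<in> cball y (t + R)" "d < norm (ell2_apply (u (delta x (\<xi> 0))) z)"
      using concentrated_entry_ge[OF un conc norm_basis[OF \<xi>] N1(2) _ N1(3,1), of x y 0]
      unfolding d_def by metis
    have "x \<in> cball (g z) R'"
    proof (rule ccontr)
      assume "x \<notin> cball (g z) R'"
      then have "norm (ell2_apply (u (delta x (\<xi> 0))) z) \<le> d * norm (\<xi> 0)"
        by (rule entry_norm_dual[OF unitary_cblin[OF un] concentrated_entry_le[OF g]])
      then show False using z(2) norm_basis[OF \<xi>, of 0] by simp
    qed
    then show "x \<in> (\<Union>z\<in>cball y (t + R). cball (g z) R')" using z(1) by blast
  qed
  have fin: "finite (\<Union>z\<in>cball y (t + R). cball (g z) R')" for y using N1(2) N2(1) by blast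
  have "card (\<Union>z\<in>cball y (t + R). cball (g z) R') \<le> N1 * N2" for y
  proof -
    have "card (\<Union>z\<in>cball y (t + R). cball (g z) R') \<le> (\<Sum>z\<in>cball y (t + R). card (cball (g z) R'))"
      by (rule card_UN_le[OF N1(2)])
    also have "\<dots> \<le> (\<Sum>z\<in>cball y (t + R). N2)" by (rule sum_mono) (rule N2(2))
    also have "\<dots> \<le> N1 * N2" using N1(3)[of y] by simp
    finally show ?thesis .
  qed
  then have "card {x. dist (f x) y \<le> t} \<le> N1 * N2" for y
    using card_mono[OF fin sub] order_trans by blast
  moreover have "finite {x. dist (f x) y \<le> t}" for y using finite_subset[OF sub fin] .
  ultimately show thesis using that by blast
qed

text \<open>
  The image of the block at \<open>y\<close> under the adjoint has a large entry at some \<open>x\<close>. Hence \<open>u\<close> has a large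
  entry from \<open>x\<close> to \<open>y\<close>, and \<open>y\<close> is close to \<open>f' x\<close>, where \<open>f'\<close> belongs to a smaller error. Finally \<open>f\<close> and \<open>f'\<close>
  are close, because a unit vector cannot have most of its mass in each of two disjoint balls.
\<close>

lemma concentrated_cobounded:
  fixes u :: "('x::metric_space, 'h::complex_hilbert) operator"
  assumes ulf: "uniformly_locally_finite TYPE('x)" and PA: "property_A TYPE('x) TYPE('h)"
    and \<xi>: "orthonormal_basis (\<xi> :: nat \<Rightarrow> 'h)" and u: "roe_normalizer u"
    and conc: "concentrated u (1/2) R f"
  obtains R0 where "\<And>y. \<exists>x. dist (f x) y \<le> R0"
proof -
  have un: "unitary u" by (rule roe_normalizer_unitary[OF u])
  note adjn = roe_normalizer_adj[OF u]
  obtain R1 g where g: "concentrated (adj u) (1/2) R1 g"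
    using roe_normalizer_concentrated[OF ulf PA \<xi> adjn, of "1/2"] by auto
  obtain N where N: "0 < N" "\<And>x :: 'x. finite (cball x R1)" "\<And>x :: 'x. card (cball x R1) \<le> N"
    using ulf_card_cball[OF ulf, of R1] by blast
  define d where "d = 1 / (2 * sqrt (real N))"
  have "1 \<le> sqrt (real N)" using N(1) by simp
  then have d: "0 < d" "d \<le> 1/2" using N(1) by (simp_all add: d_def field_simps)
  obtain R' f' where f': "concentrated u d R' f'"
    using roe_normalizer_concentrated[OF ulf PA \<xi> u d(1)] by blast
  have \<xi>0: "norm (\<xi> 0) = 1" by (rule norm_basis[OF \<xi>])
  have ff': "dist (f x) (f' x) \<le> R + R'" for x
  proof (rule ccontr)
    let ?v = "u (delta x (\<xi> 0))"
    assume far: "\<not> ?thesis"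
    have "- cball (f x) R \<union> - cball (f' x) R' = UNIV"
    proof -
      have False if "p \<in> cball (f x) R" "p \<in> cball (f' x) R'" for p
        using that far dist_triangle[of "f x" "f' x" p] by (simp add: dist_commute)
      then show ?thesis by blast
    qed
    from norm_square_le_chi_cover[OF this, of ?v]
    have "1 \<le> (norm (chi (- cball (f x) R) ?v))\<^sup>2 + (norm (chi (- cball (f' x) R') ?v))\<^sup>2"
      by (simp add: unitary_norm[OF un] norm_delta \<xi>0)
    moreover have "norm (chi (- cball (f x) R) ?v) \<le> 1/2"
      using conc \<xi>0 unfolding concentrated_def by (metis mult.right_neutral)
    then have "(norm (chi (- cball (f x) R) ?v))\<^sup>2 \<le> (1/2)\<^sup>2" by (intro power_mono) auto
    moreover have "norm (chi (- cball (f' x) R') ?v) \<le> d * norm (\<xi> 0)"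
      using f' unfolding concentrated_def by blast
    then have "norm (chi (- cball (f' x) R') ?v) \<le> 1/2" using \<xi>0 d(2) by simp
    then have "(norm (chi (- cball (f' x) R') ?v))\<^sup>2 \<le> (1/2)\<^sup>2" by (intro power_mono) auto
    ultimately show False by (simp add: power_divide)
  qed
  have "\<exists>x. dist (f x) y \<le> R + R' + R'" for y
  proof -
    obtain x where x: "d < norm (ell2_apply (adj u (delta y (\<xi> 0))) x)"
      using concentrated_entry_ge[OF unitary_adj[OF un] g \<xi>0 N(2) order_refl N(3,1)]
      unfolding d_def by metis
    have "y \<in> cball (f' x) R'"
    proof (rule ccontr)
      assume y: "y \<notin> cball (f' x) R'"
      have "norm (ell2_apply (adj u (delta y (\<xi> 0))) x) \<le> d * norm (\<xi> 0)"
      proof (rule entry_norm_dual[OF cblin_adj[OF unitary_cblin[OF un]]])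
        show "norm (ell2_apply (adj (adj u) (delta x \<eta>)) y) \<le> d * norm \<eta>" for \<eta>
          using concentrated_entry_le[OF f' y] by (simp add: adj_adj unitary_cblin[OF un])
      qed
      then show False using x \<xi>0 by simp
    qed
    then have "dist (f x) y \<le> R + R' + R'"
      using ff'[of x] dist_triangle[of "f x" y "f' x"] by simp
    then show ?thesis by blast
  qed
  then show thesis by (rule that)
qed

section \<open>Comparing two unitaries modulo operators of finite propagation\<close>

text \<open>
  Averaging over independent signs kills the mixed terms of a product of two sums. Convexity enters
  only through midpoints, and the summands \<open>A\<close>, \<open>B\<close> and \<open>C\<close> make the induction go through one sign at a
  time.
\<close>

lemma sign_average:
  fixes q y :: "'i \<Rightarrow> 'a::real_normed_vector \<Rightarrow>\<^sub>L 'a"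
  assumes mid: "\<And>a b. K a \<Longrightarrow> K b \<Longrightarrow> K ((1/2) *\<^sub>R (a + b))"
    and "finite F"
    and "\<And>l :: 'i \<Rightarrow> real. (\<And>x. \<bar>l x\<bar> = 1) \<Longrightarrow>
      K ((A + (\<Sum>x\<in>F. l x *\<^sub>R q x) o\<^sub>L (B + (\<Sum>x\<in>F. l x *\<^sub>R y x))) + C)"
  shows "K ((A o\<^sub>L B) + (\<Sum>x\<in>F. q x o\<^sub>L y x) + C)"
  using assms(2,3)
proof (induction F arbitrary: C rule: finite_induct)
  case empty
  from empty[of "\<lambda>_. 1"] show ?case by simp
next
  case (insert i F)
  have "K ((A o\<^sub>L B) + (\<Sum>x\<in>F. q x o\<^sub>L y x) + ((q i o\<^sub>L y i) + C))"
  proof (rule insert.IH)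
    fix l :: "'i \<Rightarrow> real" assume l: "\<And>x. \<bar>l x\<bar> = 1"
    define A' where "A' = A + (\<Sum>x\<in>F. l x *\<^sub>R q x)"
    define B' where "B' = B + (\<Sum>x\<in>F. l x *\<^sub>R y x)"
    have upd: "(\<Sum>x\<in>insert i F. (l(i := t)) x *\<^sub>R z x) = t *\<^sub>R z i + (\<Sum>x\<in>F. l x *\<^sub>R z x)"
      for t and z :: "'i \<Rightarrow> 'a \<Rightarrow>\<^sub>L 'a"
      using insert.hyps by (simp, intro sum.cong) auto
    have 1: "K ((A' + q i o\<^sub>L (B' + y i)) + C)"
      using insert.prems[of "l(i := 1)"] l unfolding upd
      by (simp add: A'_def B'_def ac_simps)
    have 2: "K ((A' - q i o\<^sub>L (B' - y i)) + C)"
      using insert.prems[of "l(i := - 1)"] l unfolding upd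
      by (simp add: A'_def B'_def algebra_simps)
    have "(1/2) *\<^sub>R (((A' + q i o\<^sub>L (B' + y i)) + C) + ((A' - q i o\<^sub>L (B' - y i)) + C))
        = (A' o\<^sub>L B') + ((q i o\<^sub>L y i) + C)"
    proof (rule blinfun_eqI)
      fix h
      have half: "(1/2) *\<^sub>R (a + a) = a" for a :: 'a by (simp add: scaleR_2[symmetric])
      have "((A' + q i o\<^sub>L (B' + y i)) + C) h + ((A' - q i o\<^sub>L (B' - y i)) + C) h
          = ((A' o\<^sub>L B') + ((q i o\<^sub>L y i) + C)) h + ((A' o\<^sub>L B') + ((q i o\<^sub>L y i) + C)) h"
        by (simp add: blinfun.add_left blinfun.add_right blinfun.diff_left blinfun.diff_right)
      then show "((1/2) *\<^sub>R (((A' + q i o\<^sub>L (B' + y i)) + C) + ((A' - q i o\<^sub>L (B' - y i)) + C))) h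
          = ((A' o\<^sub>L B') + ((q i o\<^sub>L y i) + C)) h"
        by (simp only: blinfun.scaleR_left blinfun.add_left[of "_ + C" "_ + C"] half)
    qed
    then show "K ((A + (\<Sum>x\<in>F. l x *\<^sub>R q x) o\<^sub>L (B + (\<Sum>x\<in>F. l x *\<^sub>R y x))) + ((q i o\<^sub>L y i) + C))"
      using mid[OF 1 2] by (simp add: A'_def B'_def)
  qed
  then show ?case using insert.hyps by (simp add: ac_simps)
qed

lemma approximable_mid: "approximable e s a \<Longrightarrow> approximable e s b \<Longrightarrow> approximable e s ((1/2) *\<^sub>R (a + b))"
  using approximable_scaleR[OF approximable_add, of e s a e b "1/2"] by simp

lemma norm_sum_square_le:
  fixes v :: "'i \<Rightarrow> 'a::real_normed_vector"
  assumes "finite I" "card I \<le> N"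
  shows "(norm (\<Sum>i\<in>I. v i))\<^sup>2 \<le> real N * (\<Sum>i\<in>I. (norm (v i))\<^sup>2)"
proof -
  have "(norm (\<Sum>i\<in>I. v i))\<^sup>2 \<le> (\<Sum>i\<in>I. norm (v i))\<^sup>2"
    by (intro power_mono norm_sum) simp
  also have "\<dots> \<le> (\<Sum>i\<in>I. (norm (v i))\<^sup>2) * real (card I)"
    by (rule sum_squared_le_sum_of_squares)
  also have "\<dots> \<le> (\<Sum>i\<in>I. (norm (v i))\<^sup>2) * real N"
    using assms(2) by (intro mult_left_mono sum_nonneg) auto
  finally show ?thesis by (simp add: mult.commute)
qed

lemma norm_square_le_finite_chi:
  assumes "\<And>S. finite S \<Longrightarrow> (norm (chi S f))\<^sup>2 \<le> C"
  shows "(norm f)\<^sup>2 \<le> C"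
proof -
  have "((\<lambda>S. (norm (chi S f))\<^sup>2) \<longlongrightarrow> (norm f)\<^sup>2) (finite_subsets_at_top UNIV)"
    by (intro tendsto_power tendsto_norm chi_tendsto)
  then show ?thesis
    by (rule tendsto_upperbound[OF _ eventually_finite_subsets_at_top_weakI
        finite_subsets_at_top_neq_bot]) (use assms in auto)
qed

text \<open>
  At each point at most \<open>N\<close> summands are nonzero, so the square of their sum is at most \<open>N\<close> times the sum
  of their squares; summation over all points gives the bound.
\<close>

lemma norm_block_column_sum_le:
  fixes g :: "('x, 'h::complex_hilbert) ell2" and v :: "'x \<Rightarrow> ('x, 'h) ell2"
  assumes F: "finite F" and fin: "\<And>p. finite {x. p \<in> D x}" and card: "\<And>p. card {x. p \<in> D x} \<le> N"
    and v: "\<And>x. norm (v x) \<le> norm (ell2_apply g x)" and l: "\<And>x. \<bar>l x\<bar> = (1::real)"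
  shows "norm (\<Sum>x\<in>F. l x *\<^sub>R chi (D x) (v x)) \<le> sqrt (real N) * norm g"
proof -
  let ?f = "\<Sum>x\<in>F. l x *\<^sub>R chi (D x) (v x)"
  have pt: "(norm (ell2_apply ?f p))\<^sup>2 \<le> real N * (\<Sum>x\<in>F. (norm (ell2_apply (v x) p))\<^sup>2)" for p
  proof -
    let ?I = "F \<inter> {x. p \<in> D x}"
    have "ell2_apply ?f p = (\<Sum>x\<in>?I. l x *\<^sub>R ell2_apply (v x) p)"
      using F by (simp add: if_distrib[of "\<lambda>t. _ *\<^sub>R t"] sum.inter_restrict cong: if_cong)
    also have "(norm \<dots>)\<^sup>2 \<le> real N * (\<Sum>x\<in>?I. (norm (l x *\<^sub>R ell2_apply (v x) p))\<^sup>2)"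
      using F card_mono[OF fin[of p], of ?I] card[of p]
      by (intro norm_sum_square_le) (auto intro: order_trans)
    also have "(\<Sum>x\<in>?I. (norm (l x *\<^sub>R ell2_apply (v x) p))\<^sup>2) = (\<Sum>x\<in>?I. (norm (ell2_apply (v x) p))\<^sup>2)"
      by (simp add: l)
    also have "\<dots> \<le> (\<Sum>x\<in>F. (norm (ell2_apply (v x) p))\<^sup>2)"
      using F by (intro sum_mono2) auto
    finally show ?thesis by (simp add: mult_left_mono)
  qed
  have "(norm ?f)\<^sup>2 \<le> real N * (norm g)\<^sup>2"
  proof (rule norm_square_le_finite_chi)
    fix S :: "'x set" assume S: "finite S"
    have "(norm (chi S ?f))\<^sup>2 = (\<Sum>p\<in>S. (norm (ell2_apply ?f p))\<^sup>2)"
      by (rule norm_chi_finite_square[OF S])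
    also have "\<dots> \<le> (\<Sum>p\<in>S. real N * (\<Sum>x\<in>F. (norm (ell2_apply (v x) p))\<^sup>2))"
      by (rule sum_mono) (rule pt)
    also have "\<dots> = real N * (\<Sum>x\<in>F. \<Sum>p\<in>S. (norm (ell2_apply (v x) p))\<^sup>2)"
      unfolding sum_distrib_left[symmetric] by (subst sum.swap) simp
    also have "\<dots> \<le> real N * (\<Sum>x\<in>F. (norm (ell2_apply g x))\<^sup>2)"
    proof (intro mult_left_mono sum_mono)
      fix x
      have "(\<Sum>p\<in>S. (norm (ell2_apply (v x) p))\<^sup>2) \<le> (norm (v x))\<^sup>2"
        by (rule sum_le_norm_ell2[OF S])
      also have "\<dots> \<le> (norm (ell2_apply g x))\<^sup>2" by (intro power_mono v) simp
      finally show "(\<Sum>p\<in>S. (norm (ell2_apply (v x) p))\<^sup>2) \<le> (norm (ell2_apply g x))\<^sup>2" .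
    qed simp
    also have "\<dots> \<le> real N * (norm g)\<^sup>2"
      by (intro mult_left_mono sum_le_norm_ell2 F) simp
    finally show "(norm (chi S ?f))\<^sup>2 \<le> real N * (norm g)\<^sup>2" .
  qed
  also have "\<dots> = (sqrt (real N) * norm g)\<^sup>2" by (simp add: power_mult_distrib)
  finally show ?thesis by (rule power2_le_imp_le) simp
qed

text \<open>
  Iterating the equation \<open>T = S + T J\<close> expresses \<open>T\<close> as the norm-convergent series of the \<open>S J\<^sup>n\<close>, all of
  which are in \<open>BD\<close>.
\<close>

lemma BD_solve_geometric:
  assumes S: "S \<in> BD" and J: "J \<in> \<B>" "prop_le t J" "norm J \<le> 1/2"
    and T: "norm T \<le> 1" "T = S + (T o\<^sub>L J)"
  shows "T \<in> BD"
proof (rule BD_limit)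
  fix e :: real assume e: "0 < e"
  have "\<exists>B\<in>BD. norm (T - B) \<le> (1/2) ^ n" for n
  proof (induction n)
    case 0
    have "0 \<in> BD" by (rule prop_le_BD[of _ 0]) simp_all
    then show ?case using T(1) by (intro bexI[of _ 0]) auto
  next
    case (Suc n)
    then obtain B where B: "B \<in> BD" "norm (T - B) \<le> (1/2) ^ n" by blast
    have "T - (S + (B o\<^sub>L J)) = (T - B) o\<^sub>L J"
      by (subst T(2), rule blinfun_eqI) (simp add: blinfun.diff_left blinfun.add_left)
    then have "norm (T - (S + (B o\<^sub>L J))) \<le> (1/2) ^ n * (1/2)"
      using norm_compose_le[OF B(2) J(3)] by metis
    moreover have "S + (B o\<^sub>L J) \<in> BD" by (intro BD_add S BD_compose_prop[OF B(1) J(1,2)])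
    ultimately show ?case by (intro bexI[of _ "S + (B o\<^sub>L J)"]) auto
  qed
  moreover obtain n where "(1/2 :: real) ^ n < e" using real_arch_pow_inv[of e "1/2"] e by auto
  ultimately show "\<exists>b'\<in>BD. norm (T - b') \<le> e" by (meson less_imp_le order_trans)
qed

text \<open>
  The operator moves the block at \<open>x\<close> exactly into the ball of radius \<open>r\<close> around \<open>f x\<close>, in contrast to
  \<open>concentrated\<close>.
\<close>

definition covers ::
    "('x::metric_space, 'h::complex_hilbert) operator \<Rightarrow> real \<Rightarrow> ('x \<Rightarrow> 'x) \<Rightarrow> bool" where
  "covers w r f \<longleftrightarrow> (\<forall>x y \<eta>. r < dist (f x) y \<longrightarrow> ell2_apply (w (delta x \<eta>)) y = 0)"

lemma covers_adj:
  assumes "w \<in> \<B>" "covers w r f" "r < dist (f x) y"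
  shows "ell2_apply (adj w (delta y \<eta>)) x = 0"
proof -
  have "norm (ell2_apply (adj w (delta y \<eta>)) x) \<le> 0 * norm \<eta>"
  proof (rule entry_norm_dual[OF cblin_adj[OF assms(1)]])
    show "norm (ell2_apply (adj (adj w) (delta x \<eta>)) y) \<le> 0 * norm \<eta>" for \<eta>
      using assms(2,3) by (simp add: covers_def adj_adj[OF assms(1)])
  qed
  then show ?thesis by simp
qed

text \<open>
  Entries of the conjugate from \<open>y\<close> to \<open>p\<close> pass through some \<open>x\<close> with \<open>f x\<close> within distance \<open>r\<close> of both.
\<close>

lemma covers_conjugate_blocks:
  assumes w: "w \<in> \<B>" "covers w r f" and m: "\<And>x. norm (m x) \<le> K"
  shows "prop_le (2 * r) (Ad w (bdiag m))"
  unfolding prop_le_def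
proof (intro allI impI)
  fix y p :: 'a and \<eta> :: 'b assume far: "2 * r < dist y p"
  show "ell2_apply (Ad w (bdiag m) (delta y \<eta>)) p = 0"
  proof (rule cinner_eqI)
    fix z
    have "cinner (ell2_apply (bdiag m (adj w (delta y \<eta>))) x) (ell2_apply (adj w (delta p z)) x) = 0" for x
    proof (cases "r < dist (f x) y")
      case True
      then show ?thesis by (simp add: bdiag_apply[OF m] covers_adj[OF w])
    next
      case False
      then have "r < dist (f x) p" using far dist_triangle[of y p "f x"] by (simp add: dist_commute)
      then show ?thesis by (simp add: covers_adj[OF w])
    qed
    then have "cinner (bdiag m (adj w (delta y \<eta>))) (adj w (delta p z)) = 0"
      unfolding cinner_ell2.rep_eq by simp
    then show "cinner (ell2_apply (Ad w (bdiag m) (delta y \<eta>)) p) z = cinner 0 z"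
      by (simp add: cinner_delta[symmetric] cinner_adj[OF w(1)])
  qed
qed

text \<open>
  With \<open>q x\<close> and \<open>y x\<close> as below, \<open>\<Sum> q x \<circ> y x\<close> over a finite set \<open>F\<close> is the given operator restricted to the
  blocks in \<open>F\<close>. It is an average over signs of products of a conjugated block-diagonal contraction,
  which is uniformly approximable, and an operator \<open>Y\<close> of propagation at most \<open>R + r\<close> and norm at most
  \<open>K\<close>. All bounds are independent of \<open>F\<close>, so they pass to the limit.
\<close>

lemma diagonal_blocks_BD:
  fixes u w :: "('x::metric_space, 'h::complex_hilbert) operator"
  assumes un: "unitary u" and wn: "unitary w"
    and uapp: "\<And>e. 0 < e \<Longrightarrow> \<exists>s. \<forall>b. block_contraction b \<longrightarrow> approximable e s (Ad u (bdiag b))"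
    and fin: "\<And>p. finite {x. dist (f x) p \<le> R}" and card: "\<And>p. card {x. dist (f x) p \<le> R} \<le> N"
    and cov: "covers w r f"
  shows "u o\<^sub>L bdiag (\<lambda>x. entry (Ad (adj u) (chi (cball (f x) R))) x x) o\<^sub>L adj w \<in> BD"
  unfolding BD_iff
proof (intro allI impI)
  fix e :: real assume e: "0 < e"
  note uB = unitary_cblin[OF un] and wB = unitary_cblin[OF wn]
  define l where "l x = entry (Ad (adj u) (chi (cball (f x) R))) x x" for x
  have lap: "l x \<eta> = ell2_apply (adj u (chi (cball (f x) R) (u (delta x \<eta>)))) x" for x \<eta>
    by (simp add: l_def entry_apply adj_adj[OF uB])
  have nl: "norm (l x) \<le> 1" for x
  proof (rule norm_blinfun_bound)
    fix \<eta>
    have "norm (l x \<eta>) \<le> norm (adj u (chi (cball (f x) R) (u (delta x \<eta>))))"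
      unfolding lap by (rule norm_ell2_apply_le)
    also have "\<dots> \<le> norm (u (delta x \<eta>))"
      by (simp add: unitary_norm[OF unitary_adj[OF un]] norm_chi_le)
    finally show "norm (l x \<eta>) \<le> 1 * norm \<eta>" by (simp add: unitary_norm[OF un] norm_delta)
  qed simp
  \<comment> \<open>The summand 1 only keeps \<open>K\<close> positive.\<close>
  define K where "K = sqrt (real N) + 1"
  have K: "0 < K" "sqrt (real N) \<le> K" by (simp_all add: K_def add_nonneg_pos)
  obtain s where s: "\<And>b. block_contraction b \<Longrightarrow> approximable (e / K) s (Ad u (bdiag b))"
    using uapp[of "e / K"] e K by auto
  define q where "q x = Ad u (chi {x})" for x
  define y where "y x = (chi (cball (f x) R) o\<^sub>L u o\<^sub>L chi {x} o\<^sub>L adj w)" for x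
  have yB: "y x \<in> \<B>" for x by (simp add: y_def cblin_compose cblin_adj uB wB)
  have yap: "y x h = chi (cball (f x) R) (u (delta x (ell2_apply (adj w h) x)))" for x h
    by (simp add: y_def chi_finite)
  have sum: "approximable e (s + (R + r)) (\<Sum>x\<in>F. q x o\<^sub>L y x)" if F: "finite F" for F
  proof -
    have "approximable e (s + (R + r)) (((0 :: ('x, 'h) operator) o\<^sub>L (0 :: ('x, 'h) operator)) + (\<Sum>x\<in>F. q x o\<^sub>L y x) + 0)"
    proof (rule sign_average[where K = "approximable e (s + (R + r))", OF approximable_mid F])
      fix c :: "'x \<Rightarrow> real" assume c: "\<And>x. \<bar>c x\<bar> = 1"
      define b :: "'x \<Rightarrow> 'h \<Rightarrow>\<^sub>L 'h" where "b x = (if x \<in> F then c x *\<^sub>R id_blinfun else 0)" for x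
      have b: "block_contraction b"
        using c by (auto simp: block_contraction_def b_def cblin_scaleR norm_blinfun_id_le)
      have bn: "norm (b x) \<le> 1" for x using b by (simp add: block_contraction_def)
      have "(\<Sum>x\<in>F. c x *\<^sub>R q x) = Ad u (bdiag b)"
      proof (rule blinfun_eqI)
        fix h
        have "bdiag b (adj u h) = (\<Sum>x\<in>F. c x *\<^sub>R chi {x} (adj u h))"
          by (rule ell2_eqI)
            (simp add: bdiag_apply[OF bn], simp add: b_def F blinfun.scaleR_left if_distrib[of "\<lambda>t. _ *\<^sub>R t"] cong: if_cong)
        then show "(\<Sum>x\<in>F. c x *\<^sub>R q x) h = Ad u (bdiag b) h"
          by (simp add: q_def blinfun.sum_left blinfun.sum_right blinfun.scaleR_left blinfun.scaleR_right)
      qed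
      then have qapp: "approximable (e / K) s (\<Sum>x\<in>F. c x *\<^sub>R q x)" using s[OF b] by simp
      define Y where "Y = (\<Sum>x\<in>F. c x *\<^sub>R y x)"
      have YB: "Y \<in> \<B>" by (simp add: Y_def cblin_sum cblin_scaleR yB)
      have Yap: "Y h = (\<Sum>x\<in>F. c x *\<^sub>R chi (cball (f x) R) (u (delta x (ell2_apply (adj w h) x))))" for h
        by (simp add: Y_def blinfun.sum_left blinfun.scaleR_left yap)
      have Yn: "norm Y \<le> K"
      proof (rule norm_blinfun_bound)
        fix h
        have "norm (Y h) \<le> sqrt (real N) * norm (adj w h)"
          unfolding Yap
          by (rule norm_block_column_sum_le[OF F _ _ _ c])
            (use fin card in \<open>simp_all add: unitary_norm[OF un] norm_delta\<close>)
        also have "\<dots> \<le> K * norm h"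
          using K(2) by (simp add: unitary_norm[OF unitary_adj[OF wn]] mult_right_mono)
        finally show "norm (Y h) \<le> K * norm h" .
      qed (use K in simp)
      have Yp: "prop_le (R + r) Y"
        unfolding prop_le_def
      proof (intro allI impI)
        fix z p :: 'x and \<eta> :: 'h assume far: "R + r < dist z p"
        have "ell2_apply (chi (cball (f x) R) (u (delta x (ell2_apply (adj w (delta z \<eta>)) x)))) p = 0" for x
        proof (cases "r < dist (f x) z")
          case True
          then show ?thesis by (simp add: covers_adj[OF wB cov])
        next
          case False
          then have "R < dist (f x) p" using far dist_triangle[of z p "f x"] by (simp add: dist_commute)
          then show ?thesis by simp
        qed
        then show "ell2_apply (Y (delta z \<eta>)) p = 0" unfolding Yap by simp
      qed
      have "approximable (e / K * K) (s + (R + r)) ((\<Sum>x\<in>F. c x *\<^sub>R q x) o\<^sub>L Y)"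
        by (rule approximable_compose_right[OF qapp YB Yp Yn])
      then show "approximable e (s + (R + r))
          ((0 + (\<Sum>x\<in>F. c x *\<^sub>R q x) o\<^sub>L (0 + (\<Sum>x\<in>F. c x *\<^sub>R y x))) + 0)"
        using K(1) by (simp add: Y_def)
    qed
    then show ?thesis by simp
  qed
  define lF where "lF F x = (if x \<in> F then l x else 0)" for F x
  have nlF: "norm (lF F x) \<le> 1" for F x using nl by (simp add: lF_def)
  have qy: "(\<Sum>x\<in>F. q x o\<^sub>L y x) = u o\<^sub>L bdiag (lF F) o\<^sub>L adj w" if F: "finite F" for F
  proof (rule blinfun_eqI)
    fix h
    let ?g = "adj w h"
    have "bdiag (lF F) ?g = (\<Sum>x\<in>F. delta x (l x (ell2_apply ?g x)))"
      by (rule ell2_eqI) (simp add: bdiag_apply[OF nlF], simp add: lF_def F)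
    moreover have "chi {x} (adj u (y x h)) = delta x (l x (ell2_apply ?g x))" for x
      by (simp add: chi_finite yap lap)
    ultimately show "(\<Sum>x\<in>F. q x o\<^sub>L y x) h = (u o\<^sub>L bdiag (lF F) o\<^sub>L adj w) h"
      by (simp add: q_def blinfun.sum_left blinfun.sum_right)
  qed
  have "approximable e (s + (R + r)) (u o\<^sub>L bdiag l o\<^sub>L adj w)"
  proof (rule approximable_limit)
    let ?T = "\<lambda>F. u o\<^sub>L bdiag (lF (if finite F then F else {})) o\<^sub>L adj w"
    show "approximable e (s + (R + r)) (?T F)" for F
      using sum[of "if finite F then F else {}"] qy[of "if finite F then F else {}"] by simp
    have "norm (?T F) \<le> 1 * 1 * 1" for F
      by (intro norm_compose_le unitary_norm_le un unitary_adj wn norm_bdiag_le nlF)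
    then show "norm (?T F) \<le> 1" for F by simp
    show "((\<lambda>F. ?T F h) \<longlongrightarrow> (u o\<^sub>L bdiag l o\<^sub>L adj w) h) (finite_subsets_at_top UNIV)" for h
      unfolding blinfun_apply_blinfun_compose
      by (intro blinfun.tendsto tendsto_const bdiag_tendsto nl nlF) (simp add: lF_def)
  qed simp
  then show "\<exists>s. approximable e s (u o\<^sub>L bdiag (\<lambda>x. entry (Ad (adj u) (chi (cball (f x) R))) x x) o\<^sub>L adj w)"
    unfolding l_def by blast
qed

text \<open>
  The compression \<open>l x\<close> of the projection onto the ball around \<open>f x\<close>, pulled back by \<open>u\<close>, to the block at \<open>x\<close>
  differs from the identity by at most \<open>1/2\<close>, by concentration. So \<open>T = u w\<^sup>*\<close> satisfies \<open>T = S + T J\<close>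
  where \<open>S\<close> is the operator of \<open>diagonal_blocks_BD\<close> and \<open>J\<close> is the conjugate by \<open>w\<close> of the small operator
  with blocks \<open>1 - l x\<close>.
\<close>

theorem covering_unitary_mod_BD:
  fixes u w :: "('x::metric_space, 'h::complex_hilbert) operator"
  assumes un: "unitary u" and wn: "unitary w"
    and uapp: "\<And>e. 0 < e \<Longrightarrow> \<exists>s. \<forall>b. block_contraction b \<longrightarrow> approximable e s (Ad u (bdiag b))"
    and conc: "concentrated u (1/2) R f"
    and fin: "\<And>p. finite {x. dist (f x) p \<le> R}" and card: "\<And>p. card {x. dist (f x) p \<le> R} \<le> N"
    and cov: "covers w r f"
  shows "u o\<^sub>L adj w \<in> BD"
proof -
  note uB = unitary_cblin[OF un] and wB = unitary_cblin[OF wn]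
  define l where "l x = entry (Ad (adj u) (chi (cball (f x) R))) x x" for x
  define m where "m x = id_blinfun - l x" for x
  have lap: "l x \<eta> = ell2_apply (adj u (chi (cball (f x) R) (u (delta x \<eta>)))) x" for x \<eta>
    by (simp add: l_def entry_apply adj_adj[OF uB])
  have mn: "norm (m x) \<le> 1/2" for x
  proof (rule norm_blinfun_bound)
    fix \<eta>
    have "m x \<eta> = ell2_apply (adj u (chi (- cball (f x) R) (u (delta x \<eta>)))) x"
      by (simp add: m_def blinfun.diff_left lap chi_compl blinfun.diff_right un)
    then have "norm (m x \<eta>) \<le> norm (adj u (chi (- cball (f x) R) (u (delta x \<eta>))))"
      by (metis norm_ell2_apply_le)
    also have "\<dots> \<le> 1/2 * norm \<eta>"
      using conc unfolding unitary_norm[OF unitary_adj[OF un]] concentrated_def by blast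
    finally show "norm (m x \<eta>) \<le> 1/2 * norm \<eta>" .
  qed simp
  have lB: "l x \<in> \<B>" for x
    unfolding cblinfuns_def mem_Collect_eq lap delta_scaleC
    by (simp add: cblinfunD uB cblin_adj)
  have ln: "norm (l x) \<le> 2" for x
  proof -
    have "l x = id_blinfun - m x" by (simp add: m_def)
    then have "norm (l x) \<le> norm (id_blinfun :: 'h \<Rightarrow>\<^sub>L 'h) + norm (m x)"
      by (metis norm_triangle_ineq4)
    then show ?thesis using mn[of x] norm_blinfun_id_le[where 'a='h] by linarith
  qed
  have Jn: "norm (Ad w (bdiag m)) \<le> 1/2"
    by (rule order_trans[OF norm_Ad_le[OF wn] norm_bdiag_le[OF mn]])
  have JB: "Ad w (bdiag m) \<in> \<B>"
    by (intro cblin_Ad wn cblin_bdiag[OF mn]) (simp add: m_def cblin_diff lB)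
  have "bdiag l g + bdiag m g = g" for g
    by (rule ell2_eqI) (simp add: bdiag_apply[OF mn] bdiag_apply[OF ln], simp add: m_def blinfun.diff_left)
  then have T: "u o\<^sub>L adj w = (u o\<^sub>L bdiag l o\<^sub>L adj w) + ((u o\<^sub>L adj w) o\<^sub>L Ad w (bdiag m))"
    by (intro blinfun_eqI) (simp add: blinfun.add_left wn blinfun.add_right[symmetric])
  show ?thesis
  proof (rule BD_solve_geometric[OF _ JB covers_conjugate_blocks[OF wB cov mn] Jn _ T])
    show "u o\<^sub>L bdiag l o\<^sub>L adj w \<in> BD"
      unfolding l_def by (rule diagonal_blocks_BD[OF un wn uapp fin card cov])
    show "norm (u o\<^sub>L adj w) \<le> 1"
      using norm_compose_le[OF unitary_norm_le[OF un] unitary_norm_le[OF unitary_adj[OF wn]]] by simp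
  qed
qed

section \<open>Unitaries permuting orthonormal bases\<close>

lemma norm_orthonormal_sum:
  fixes e :: "'i \<Rightarrow> 'a::complex_inner"
  assumes e: "\<And>i j. cinner (e i) (e j) = (if i = j then 1 else 0)" and F: "finite F"
  shows "(norm (\<Sum>i\<in>F. c i *\<^sub>C e i))\<^sup>2 = (\<Sum>i\<in>F. (norm (c i))\<^sup>2)"
proof -
  have "cinner (\<Sum>i\<in>F. c i *\<^sub>C e i) (\<Sum>i\<in>F. c i *\<^sub>C e i) = (\<Sum>i\<in>F. c i * cnj (c i))"
    by (simp add: cinner_sum_left bounded_bilinear.sum_right[OF bounded_bilinear_cinner]
        cinner_scaleC_left cinner_scaleC_right e F if_distrib[of "\<lambda>t. _ * t"] mult.commute
        cong: if_cong)
  then have "complex_of_real ((norm (\<Sum>i\<in>F. c i *\<^sub>C e i))\<^sup>2) = complex_of_real (\<Sum>i\<in>F. (norm (c i))\<^sup>2)"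
    by (simp only: cinner_self of_real_sum complex_norm_square)
  then show ?thesis using of_real_eq_iff by blast
qed

lemma bessel:
  fixes e :: "'i \<Rightarrow> 'a::complex_inner"
  assumes e: "\<And>i j. cinner (e i) (e j) = (if i = j then 1 else 0)" and F: "finite F"
  shows "(\<Sum>i\<in>F. (norm (cinner h (e i)))\<^sup>2) \<le> (norm h)\<^sup>2"
proof -
  define p where "p = (\<Sum>i\<in>F. cinner h (e i) *\<^sub>C e i)"
  have "cinner h p = (\<Sum>i\<in>F. cinner h (e i) * cnj (cinner h (e i)))"
    by (simp add: p_def bounded_bilinear.sum_right[OF bounded_bilinear_cinner] cinner_scaleC_right
        mult.commute)
  also have "\<dots> = complex_of_real (\<Sum>i\<in>F. (norm (cinner h (e i)))\<^sup>2)"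
    by (simp only: of_real_sum complex_norm_square)
  also have "\<dots> = complex_of_real ((norm p)\<^sup>2)"
    unfolding p_def by (subst norm_orthonormal_sum[OF e F]) simp
  finally have "norm (complex_of_real ((norm p)\<^sup>2)) \<le> norm h * norm p"
    using norm_cinner_le[of h p] by simp
  then have "norm p * norm p \<le> norm h * norm p" by (simp add: power2_eq_square norm_mult)
  then have "norm p \<le> norm h" by (cases "p = 0") simp_all
  then have "(norm p)\<^sup>2 \<le> (norm h)\<^sup>2" by (intro power_mono) auto
  then show ?thesis unfolding p_def by (subst (asm) norm_orthonormal_sum[OF e F])
qed

text \<open>
  The unitary is defined by its sesquilinear form \<open>\<Sum> cinner h (e i) * cnj (cinner k (e' i))\<close>, which
  converges absolutely by the Bessel and Cauchy-Schwarz inequalities. That its adjoint is inverse to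
  it is checked against basis vectors, hence totality in the form of orthogonal complements.
\<close>

lemma unitary_between_orthonormal_bases:
  fixes e e' :: "'i \<Rightarrow> 'a::complex_hilbert"
  assumes e: "\<And>i j. cinner (e i) (e j) = (if i = j then 1 else 0)"
    and total: "\<And>h. (\<And>i. cinner h (e i) = 0) \<Longrightarrow> h = 0"
    and e': "\<And>i j. cinner (e' i) (e' j) = (if i = j then 1 else 0)"
    and total': "\<And>h. (\<And>i. cinner h (e' i) = 0) \<Longrightarrow> h = 0"
  obtains w where "unitary w" "\<And>i. w (e i) = e' i"
proof -
  define t where "t h k i = cinner h (e i) * cnj (cinner k (e' i))" for h k i
  have fin: "(\<Sum>i\<in>F. norm (t h k i)) \<le> norm h * norm k" if F: "finite F" for F h k
  proof -
    have "(\<Sum>i\<in>F. norm (t h k i)) = (\<Sum>i\<in>F. \<bar>norm (cinner h (e i))\<bar> * \<bar>norm (cinner k (e' i))\<bar>)"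
      by (simp add: t_def norm_mult)
    also have "\<dots> \<le> L2_set (\<lambda>i. norm (cinner h (e i))) F * L2_set (\<lambda>i. norm (cinner k (e' i))) F"
      by (rule L2_set_mult_ineq)
    also have "\<dots> \<le> norm h * norm k"
      unfolding L2_set_def
      by (intro mult_mono real_le_lsqrt bessel[OF e F] bessel[OF e' F] sum_nonneg) (auto simp: sum_nonneg)
    finally show ?thesis .
  qed
  have abs: "(\<lambda>i. norm (t h k i)) summable_on UNIV" for h k
    using fin by (intro nonneg_bdd_above_summable_on bdd_aboveI2[where M = "norm h * norm k"]) auto
  have summ: "t h k summable_on UNIV" for h k
    by (rule Infinite_Sum.abs_summable_summable[OF abs])
  define B where "B h k = (\<Sum>\<^sub>\<infinity>i. t h k i)" for h k
  obtain w where w: "w \<in> \<B>" "\<And>h k. cinner (w h) k = B h k"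
  proof (rule cblinfun_of_form[of B 1])
    have "t (x + y) z = (\<lambda>i. t x z i + t y z i)" for x y z
      by (rule ext) (simp add: t_def cinner_add_left algebra_simps)
    then show "B (x + y) z = B x z + B y z" for x y z
      unfolding B_def by (simp add: infsum_add[OF summ summ])
    have "t x (y + z) = (\<lambda>i. t x y i + t x z i)" for x y z
      by (rule ext) (simp add: t_def cinner_add_left algebra_simps)
    then show "B x (y + z) = B x y + B x z" for x y z
      unfolding B_def by (simp add: infsum_add[OF summ summ])
    have "t (c *\<^sub>C x) y = (\<lambda>i. c * t x y i)" for c x y
      by (rule ext) (simp add: t_def cinner_scaleC_left)
    then show "B (c *\<^sub>C x) y = c * B x y" for c x y
      unfolding B_def by (simp add: infsum_cmult_right')
    have "t x (c *\<^sub>C y) = (\<lambda>i. cnj c * t x y i)" for c x y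
      by (rule ext) (simp add: t_def cinner_scaleC_left)
    then show "B x (c *\<^sub>C y) = cnj c * B x y" for c x y
      unfolding B_def by (simp add: infsum_cmult_right')
    show "norm (B x y) \<le> 1 * norm x * norm y" for x y
    proof -
      have "norm (B x y) \<le> (\<Sum>\<^sub>\<infinity>i. norm (t x y i))"
        unfolding B_def by (rule norm_infsum_bound[OF abs])
      also have "\<dots> \<le> norm x * norm y"
        by (rule infsum_le_finite_sums[OF abs]) (rule fin)
      finally show ?thesis by simp
    qed
  qed auto
  have we: "w (e j) = e' j" for j
  proof (rule cinner_eqI)
    fix k
    have "B (e j) k = (\<Sum>\<^sub>\<infinity>i\<in>{j}. t (e j) k i)"
      unfolding B_def by (rule infsum_cong_neutral) (auto simp: t_def e)
    then show "cinner (w (e j)) k = cinner (e' j) k"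
      unfolding w(2) by (simp add: t_def e cinner_commute[symmetric])
  qed
  have ae: "adj w (e' j) = e j" for j
  proof (rule cinner_eqI_right)
    fix h
    have "B h (e' j) = (\<Sum>\<^sub>\<infinity>i\<in>{j}. t h (e' j) i)"
      unfolding B_def by (rule infsum_cong_neutral) (auto simp: t_def e')
    then show "cinner h (adj w (e' j)) = cinner h (e j)"
      unfolding cinner_adj[OF w(1), symmetric] w(2) by (simp add: t_def e')
  qed
  have "adj w (w h) = h" for h
  proof -
    have "adj w (w h) - h = 0"
      by (rule total) (simp add: cinner_diff_left cinner_adj'[OF w(1)] we,
          simp add: cinner_adj[OF w(1)] ae)
    then show ?thesis by simp
  qed
  moreover have "w (adj w h) = h" for h
  proof -
    have "w (adj w h) - h = 0"
      by (rule total') (simp add: cinner_diff_left cinner_adj[OF w(1)] ae,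
          simp add: cinner_adj'[OF w(1)] we)
    then show ?thesis by simp
  qed
  ultimately have "unitary w" using w(1) by (auto simp: unitary_def intro: blinfun_eqI)
  then show thesis using we by (rule that)
qed

lemma orthonormal_basis_cinner:
  "orthonormal_basis \<xi> \<Longrightarrow> cinner (\<xi> i) (\<xi> j) = (if i = j then 1 else 0)"
  by (simp add: orthonormal_basis_def)

lemma orthonormal_basis_total:
  assumes "orthonormal_basis \<xi>" and "\<And>n. cinner \<eta> (\<xi> n) = 0" shows "\<eta> = 0"
proof -
  have "fin_proj \<xi> n \<eta> = 0" for n by (simp add: fin_proj_apply assms(2))
  then have "(\<lambda>n. 0) \<longlonglongrightarrow> \<eta>" using fin_proj_tendsto[OF assms(1), of \<eta>] by simp
  then show ?thesis using LIMSEQ_unique[OF tendsto_const] by blast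
qed

lemma delta_basis_cinner:
  assumes "orthonormal_basis \<xi>"
  shows "cinner (delta x (\<xi> n)) (delta y (\<xi> m)) = (if (x, n) = (y, m) then 1 else 0)"
  using orthonormal_basis_cinner[OF assms] by (simp add: cinner_delta)

lemma delta_basis_total:
  fixes h :: "('x, 'h::complex_hilbert) ell2"
  assumes \<xi>: "orthonormal_basis \<xi>" and "\<And>x n. cinner h (delta x (\<xi> n)) = 0" shows "h = 0"
proof (rule ell2_eqI)
  fix x
  have "ell2_apply h x = 0"
    by (rule orthonormal_basis_total[OF \<xi>]) (use assms(2) in \<open>simp add: cinner_delta\<close>)
  then show "ell2_apply h x = ell2_apply 0 x" by simp
qed

lemma entry_zero_on_basis:
  fixes a :: "('x, 'h::complex_hilbert) operator"
  assumes a: "a \<in> \<B>" and \<xi>: "orthonormal_basis \<xi>"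
    and 0: "\<And>n. ell2_apply (a (delta x (\<xi> n))) y = 0"
  shows "ell2_apply (a (delta x \<eta>)) y = 0"
proof -
  have "(\<lambda>n. entry a x y (fin_proj \<xi> n \<eta>)) \<longlonglongrightarrow> entry a x y \<eta>"
    by (intro blinfun.tendsto tendsto_const fin_proj_tendsto \<xi>)
  moreover have "entry a x y (fin_proj \<xi> n \<eta>) = 0" for n
    by (simp add: fin_proj_apply blinfun.sum_right)
      (simp add: entry_apply delta_scaleC cblinfunD[OF a] 0)
  ultimately have "(\<lambda>n. 0) \<longlonglongrightarrow> entry a x y \<eta>" by simp
  then have "entry a x y \<eta> = 0" by (rule LIMSEQ_unique[OF _ tendsto_const])
  then show ?thesis by (simp add: entry_apply)
qed

text \<open>
  Nonempty fibres are countably infinite on both sides, so they can be matched one by one.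
\<close>

lemma fibrewise_bijection:
  fixes F :: "'a \<Rightarrow> 'c" and G :: "'b \<Rightarrow> 'c"
  assumes "\<And>z. F -` {z} = {} \<and> G -` {z} = {} \<or>
      countable (F -` {z}) \<and> infinite (F -` {z}) \<and> countable (G -` {z}) \<and> infinite (G -` {z})"
  obtains \<sigma> where "bij \<sigma>" "\<And>p. G (\<sigma> p) = F p"
proof -
  have "\<exists>\<tau>. bij_betw \<tau> (F -` {z}) (G -` {z})" for z
  proof (cases "F -` {z} = {} \<and> G -` {z} = {}")
    case True
    then show ?thesis by (auto simp: bij_betw_def)
  next
    case False
    then have inf: "countable (F -` {z})" "infinite (F -` {z})" "countable (G -` {z})" "infinite (G -` {z})"
      using assms[of z] by auto
    show ?thesis
      using bij_betw_trans[OF to_nat_on_infinite[OF inf(1,2)] bij_betw_from_nat_into[OF inf(3,4)]] by blast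
  qed
  then obtain \<tau> where \<tau>: "\<And>z. bij_betw (\<tau> z) (F -` {z}) (G -` {z})" by metis
  define \<sigma> where "\<sigma> p = \<tau> (F p) p" for p
  have G\<sigma>: "G (\<sigma> p) = F p" for p
    using bij_betwE[OF \<tau>[of "F p"]] by (auto simp: \<sigma>_def)
  have "inj \<sigma>"
  proof (rule injI)
    fix p p' assume eq: "\<sigma> p = \<sigma> p'"
    then have "F p = F p'" using G\<sigma> by metis
    then show "p = p'"
      using eq bij_betw_imp_inj_on[OF \<tau>[of "F p"]] by (auto simp: \<sigma>_def inj_on_def)
  qed
  moreover have "q \<in> range \<sigma>" for q
  proof -
    have "q \<in> \<tau> (G q) ` (F -` {G q})" using bij_betw_imp_surj_on[OF \<tau>[of "G q"]] by simp
    then obtain p where "F p = G q" "q = \<tau> (G q) p" by auto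
    then show ?thesis by (metis \<sigma>_def rangeI)
  qed
  ultimately have "bij \<sigma>" by (auto simp: bij_def)
  then show thesis using G\<sigma> by (rule that)
qed

text \<open>
  Retract the space onto the range of \<open>f\<close> by a map \<open>g\<close> that moves points by at most \<open>r\<close>. The fibres of
  \<open>f\<close> and \<open>g\<close> over a point in the range of \<open>f\<close> are finite and nonempty, and after multiplication with \<open>nat\<close>
  both become countably infinite. A bijection that respects the two maps moves \<open>(x, n)\<close> to a
  point whose first coordinate is retracted to \<open>f x\<close>.
\<close>

lemma covering_bijection:
  fixes f :: "'x::metric_space \<Rightarrow> 'x"
  assumes ball: "\<And>y :: 'x. finite (cball y r)" and fib: "\<And>y. finite (f -` {y})"
    and cob: "\<And>y. \<exists>x. dist (f x) y \<le> r"
  obtains \<sigma> :: "'x \<times> nat \<Rightarrow> 'x \<times> nat" where "bij \<sigma>" "\<And>p. dist (f (fst p)) (fst (\<sigma> p)) \<le> r"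
proof -
  have r: "0 \<le> r" using cob zero_le_dist order_trans by blast
  define g where "g y = (if y \<in> range f then y else f (SOME x. dist (f x) y \<le> r))" for y
  have g_dist: "dist (g y) y \<le> r" for y
    using someI_ex[OF cob[of y]] r by (simp add: g_def)
  have g_range: "g y \<in> range f" for y by (simp add: g_def)
  have g_id: "g z = z" if "z \<in> range f" for z using that by (simp add: g_def)
  have prod: "countable (S \<times> (UNIV :: nat set))" "infinite (S \<times> (UNIV :: nat set))"
    if "finite S" "S \<noteq> {}" for S :: "'x set"
    using that by (auto simp: finite_cartesian_product_iff countable_finite)
  define F :: "'x \<times> nat \<Rightarrow> 'x" where "F p = f (fst p)" for p
  define G :: "'x \<times> nat \<Rightarrow> 'x" where "G p = g (fst p)" for p
  have eq: "F -` {z} = f -` {z} \<times> UNIV" "G -` {z} = g -` {z} \<times> UNIV" for z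
    by (auto simp: F_def G_def)
  have fibres: "F -` {z} = {} \<and> G -` {z} = {} \<or>
      countable (F -` {z}) \<and> infinite (F -` {z}) \<and> countable (G -` {z}) \<and> infinite (G -` {z})" for z
  proof (cases "z \<in> range f")
    case False
    then have "f -` {z} = {}" "g -` {z} = {}" using g_range by auto
    then show ?thesis unfolding eq by simp
  next
    case True
    have "g -` {z} \<subseteq> cball z r"
    proof
      fix y assume "y \<in> g -` {z}"
      then show "y \<in> cball z r" using g_dist[of y] by simp
    qed
    then have "finite (g -` {z})" using ball finite_subset by blast
    moreover have "g -` {z} \<noteq> {}" using g_id[OF True] by auto
    moreover have "f -` {z} \<noteq> {}" using True by auto
    ultimately show ?thesis
      unfolding eq using prod[of "f -` {z}"] prod[of "g -` {z}"] fib[of z] by simp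
  qed
  obtain \<sigma> :: "'x \<times> nat \<Rightarrow> 'x \<times> nat" where \<sigma>: "bij \<sigma>" "\<And>p. G (\<sigma> p) = F p"
    by (rule fibrewise_bijection[OF fibres]) simp
  have "dist (f (fst p)) (fst (\<sigma> p)) \<le> r" for p
    using g_dist[of "fst (\<sigma> p)"] \<sigma>(2)[of p] by (simp add: F_def G_def)
  with \<sigma>(1) show thesis by (rule that)
qed

definition permutes_bases ::
    "('x, 'h::complex_hilbert) operator \<Rightarrow> ('x \<times> nat \<Rightarrow> 'x \<times> nat) \<Rightarrow> (nat \<Rightarrow> 'h) \<Rightarrow> (nat \<Rightarrow> 'h) \<Rightarrow> bool" where
  "permutes_bases w \<sigma> \<xi> \<zeta> \<longleftrightarrow>
     (\<forall>x n. w (delta x (\<xi> n)) = delta (fst (\<sigma> (x, n))) (\<zeta> (snd (\<sigma> (x, n)))))"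

lemma permuting_unitary:
  fixes \<xi> \<zeta> :: "nat \<Rightarrow> 'h::complex_hilbert" and \<sigma> :: "'x \<times> nat \<Rightarrow> 'x \<times> nat"
  assumes \<xi>: "orthonormal_basis \<xi>" and \<zeta>: "orthonormal_basis \<zeta>" and \<sigma>: "bij \<sigma>"
  obtains w :: "('x, 'h) operator" where "unitary w" "permutes_bases w \<sigma> \<xi> \<zeta>"
proof -
  define e where "e p = delta (fst p) (\<xi> (snd p))" for p :: "'x \<times> nat"
  define e' where "e' p = delta (fst (\<sigma> p)) (\<zeta> (snd (\<sigma> p)))" for p
  obtain w :: "('x, 'h) operator" where w: "unitary w" "\<And>p. w (e p) = e' p"
  proof (rule unitary_between_orthonormal_bases[of e e'])
    show "cinner (e p) (e q) = (if p = q then 1 else 0)" for p q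
      by (simp only: e_def delta_basis_cinner[OF \<xi>] prod.collapse)
    show "cinner (e' p) (e' q) = (if p = q then 1 else 0)" for p q
      using inj_eq[OF bij_is_inj[OF \<sigma>]] by (simp only: e'_def delta_basis_cinner[OF \<zeta>] prod.collapse)
    show "h = 0" if "\<And>p. cinner h (e p) = 0" for h
      by (rule delta_basis_total[OF \<xi>]) (use that[of "(_, _)"] in \<open>simp add: e_def\<close>)
    show "h = 0" if "\<And>p. cinner h (e' p) = 0" for h
    proof (rule delta_basis_total[OF \<zeta>])
      fix x n
      obtain p where "\<sigma> p = (x, n)" using bij_is_surj[OF \<sigma>] by (metis surjD)
      then show "cinner h (delta x (\<zeta> n)) = 0" using that[of p] by (simp add: e'_def)
    qed
  qed blast
  have "permutes_bases w \<sigma> \<xi> \<zeta>"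
    unfolding permutes_bases_def using w(2)[of "(_, _)"] by (simp add: e_def e'_def)
  with w(1) show thesis by (rule that)
qed

lemma permutes_bases_inv:
  assumes "unitary w" "permutes_bases w \<sigma> \<xi> \<zeta>" "bij \<sigma>"
  shows "permutes_bases (adj w) (inv \<sigma>) \<zeta> \<xi>"
  unfolding permutes_bases_def
proof (intro allI)
  fix y m
  obtain x n where xn: "inv \<sigma> (y, m) = (x, n)" by (cases "inv \<sigma> (y, m)")
  then have "\<sigma> (x, n) = (y, m)" using bij_inv_eq_iff[OF assms(3)] by metis
  then have "w (delta x (\<xi> n)) = delta y (\<zeta> m)" using assms(2) by (simp add: permutes_bases_def)
  then show "adj w (delta y (\<zeta> m)) = delta (fst (inv \<sigma> (y, m))) (\<xi> (snd (inv \<sigma> (y, m))))"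
    using unitary_adj_apply(1)[OF assms(1), of "delta x (\<xi> n)"] xn by simp
qed

text \<open>
Vanishing of an entry can be tested on a basis.
\<close>

lemma permutes_bases_covers:
  assumes "w \<in> \<B>" "orthonormal_basis \<xi>" "permutes_bases w \<sigma> \<xi> \<zeta>"
    and "\<And>p. dist (f (fst p)) (fst (\<sigma> p)) \<le> r"
  shows "covers w r f"
  unfolding covers_def
proof (intro allI impI)
  fix x y \<eta> assume xy: "r < dist (f x) y"
  show "ell2_apply (w (delta x \<eta>)) y = 0"
  proof (rule entry_zero_on_basis[OF assms(1,2)])
    fix n
    have "y \<noteq> fst (\<sigma> (x, n))" using assms(4)[of "(x, n)"] xy by auto
    then show "ell2_apply (w (delta x (\<xi> n))) y = 0"
      using assms(3) by (simp add: permutes_bases_def)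
  qed
qed

text \<open>
  The eigenvalues on the block at \<open>y\<close> are collected from the finitely many blocks that \<open>\<sigma>\<close> sends there;
  each contributes finitely many eigenvalues of modulus at least \<open>e\<close>, so they again form a null
  sequence.
\<close>

lemma Ad_ell_infty:
  fixes w :: "('x::metric_space, 'h::complex_hilbert) operator"
  assumes w: "unitary w" and perm: "permutes_bases w \<sigma> \<xi> \<zeta>" and \<sigma>: "bij \<sigma>"
    and fin: "\<And>y. finite {x. \<exists>n m. \<sigma> (x, n) = (y, m)}" and a: "a \<in> ell_infty \<xi>"
  shows "Ad w a \<in> ell_infty \<zeta>"
proof -
  have aB: "a \<in> \<B>" using a by (simp add: ell_infty_def)
  obtain L where L: "\<And>x. L x \<longlonglongrightarrow> 0" "\<And>x n. a (delta x (\<xi> n)) = L x n *\<^sub>C delta x (\<xi> n)"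
    using a unfolding ell_infty_def mem_Collect_eq by metis
  have "\<exists>l. l \<longlonglongrightarrow> 0 \<and> (\<forall>m. Ad w a (delta y (\<zeta> m)) = l m *\<^sub>C delta y (\<zeta> m))" for y
  proof (intro exI conjI allI)
    define l where "l m = L (fst (inv \<sigma> (y, m))) (snd (inv \<sigma> (y, m)))" for m
    show "Ad w a (delta y (\<zeta> m)) = l m *\<^sub>C delta y (\<zeta> m)" for m
    proof -
      have adj: "adj w (delta y (\<zeta> m)) = delta (fst (inv \<sigma> (y, m))) (\<xi> (snd (inv \<sigma> (y, m))))"
        using permutes_bases_inv[OF w perm \<sigma>] by (simp add: permutes_bases_def)
      have "Ad w a (delta y (\<zeta> m)) = l m *\<^sub>C w (adj w (delta y (\<zeta> m)))"
        unfolding Ad_apply adj L(2) l_def by (rule cblinfunD[OF unitary_cblin[OF w]])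
      then show ?thesis using w by simp
    qed
    show "l \<longlonglongrightarrow> 0"
    proof (rule tendstoI)
      fix e :: real assume e: "0 < e"
      define G where "G = {x. \<exists>n m. \<sigma> (x, n) = (y, m)}"
      have LG: "finite {n. \<not> dist (L x n) 0 < e}" for x
        using tendstoD[OF L(1)[of x] e] unfolding cofinite_eq_sequentially[symmetric] eventually_cofinite .
      have "{m. \<not> dist (l m) 0 < e} \<subseteq> (snd \<circ> \<sigma>) ` (SIGMA x:G. {n. \<not> dist (L x n) 0 < e})"
      proof
        fix m assume m: "m \<in> {m. \<not> dist (l m) 0 < e}"
        obtain x n where xn: "inv \<sigma> (y, m) = (x, n)" by (cases "inv \<sigma> (y, m)")
        then have \<sigma>xn: "\<sigma> (x, n) = (y, m)" using bij_inv_eq_iff[OF \<sigma>] by metis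
        then have "(x, n) \<in> (SIGMA x:G. {n. \<not> dist (L x n) 0 < e})"
          using m xn by (auto simp: G_def l_def)
        then show "m \<in> (snd \<circ> \<sigma>) ` (SIGMA x:G. {n. \<not> dist (L x n) 0 < e})"
          using \<sigma>xn by (intro image_eqI[of _ _ "(x, n)"]) auto
      qed
      moreover have "finite (SIGMA x:G. {n. \<not> dist (L x n) 0 < e})"
        using fin[of y] LG by (intro finite_SigmaI) (auto simp: G_def)
      ultimately have "finite {m. \<not> dist (l m) 0 < e}" using finite_subset finite_imageI by blast
      then show "\<forall>\<^sub>F m in sequentially. dist (l m) 0 < e"
        unfolding cofinite_eq_sequentially[symmetric] eventually_cofinite .
    qed
  qed
  then show ?thesis
    using cblin_Ad[OF w aB] unfolding ell_infty_def by blast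
qed

section \<open>Diagonal operators\<close>

lemma compact_operator_limit:
  fixes a :: "'a::complex_inner \<Rightarrow>\<^sub>L 'b::complex_hilbert"
  assumes "\<And>e. 0 < e \<Longrightarrow> \<exists>b. compact_operator b \<and> norm (a - b) \<le> e"
  shows "compact_operator a"
  unfolding compact_operator_def compact_eq_totally_bounded
proof (intro conjI allI impI)
  show "complete (closure (a ` cball 0 1))" by (simp add: complete_eq_closed)
  fix e :: real assume e: "0 < e"
  obtain b where b: "compact_operator b" "norm (a - b) \<le> e/4" using assms[of "e/4"] e by auto
  then obtain T where T: "finite T" "closure (b ` cball 0 1) \<subseteq> (\<Union>x\<in>T. ball x (e/4))"
    using e unfolding compact_operator_def compact_eq_totally_bounded
    by (meson divide_pos_pos zero_less_numeral)
  have "a ` cball 0 1 \<subseteq> (\<Union>x\<in>T. cball x (e/2))"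
  proof (rule image_subsetI)
    fix h :: 'a assume h: "h \<in> cball 0 1"
    have "b h \<in> closure (b ` cball 0 1)" using h by (intro subsetD[OF closure_subset] imageI)
    then obtain x where x: "x \<in> T" "dist x (b h) < e/4" using T(2) by auto
    have "norm ((a - b) h) \<le> e/4 * norm h" by (rule norm_blinfun_le[OF b(2)])
    also have "\<dots> \<le> e/4 * 1" using h e by (intro mult_left_mono) auto
    finally have "dist (b h) (a h) \<le> e/4" by (simp add: dist_norm norm_minus_commute blinfun.diff_left)
    then have "dist x (a h) \<le> e/2" using x(2) dist_triangle[of x "a h" "b h"] by linarith
    then show "a h \<in> (\<Union>x\<in>T. cball x (e/2))" using x(1) by auto
  qed
  then have "closure (a ` cball 0 1) \<subseteq> (\<Union>x\<in>T. cball x (e/2))"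
    by (rule closure_minimal) (use T(1) in auto)
  also have "\<dots> \<subseteq> (\<Union>x\<in>T. ball x e)" using e by (intro UN_mono) auto
  finally show "\<exists>k. finite k \<and> closure (a ` cball 0 1) \<subseteq> (\<Union>x\<in>k. ball x e)" using T(1) by blast
qed

text \<open>
  Truncation to the first \<open>N\<close> basis vectors has finite rank, and what remains has norm at most the
  supremum of the remaining eigenvalues.
\<close>

lemma compact_operator_diagonal:
  fixes \<xi> :: "nat \<Rightarrow> 'h::complex_hilbert"
  assumes \<xi>: "orthonormal_basis \<xi>" and a: "a \<in> \<B>" and l: "l \<longlonglongrightarrow> 0"
    and a\<xi>: "\<And>n. a (\<xi> n) = l n *\<^sub>C \<xi> n"
  shows "compact_operator a"
proof (rule compact_operator_limit)
  fix e :: real assume e: "0 < e"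
  obtain N where N: "\<And>n. n \<ge> N \<Longrightarrow> norm (l n) \<le> e"
    using LIMSEQ_D[OF l e] by (metis diff_zero less_imp_le)
  have fin: "a (fin_proj \<xi> n \<eta>) = (\<Sum>j<n. (cinner \<eta> (\<xi> j) * l j) *\<^sub>C \<xi> j)" for n \<eta>
    by (simp add: fin_proj_apply blinfun.sum_right cblinfunD[OF a] a\<xi> scaleC_scaleC)
  have "compact_operator (a o\<^sub>L fin_proj \<xi> N)"
  proof (rule compact_operator_finite_rank)
    show "(a o\<^sub>L fin_proj \<xi> N) \<eta> = (\<Sum>j\<in>{..<N}. cinner \<eta> (\<xi> j) *\<^sub>C a (\<xi> j))" for \<eta>
      by (simp add: fin_proj_apply blinfun.sum_right cblinfunD[OF a])
    show "norm (cinner \<eta> (\<xi> j)) \<le> 1 * norm \<eta>" for \<eta> j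
      using norm_cinner_le[of \<eta> "\<xi> j"] by (simp add: norm_basis[OF \<xi>])
  qed simp
  moreover have "norm (a - (a o\<^sub>L fin_proj \<xi> N)) \<le> e"
  proof (rule norm_blinfun_bound)
    fix \<eta>
    have "norm (a (fin_proj \<xi> n \<eta>) - a (fin_proj \<xi> N \<eta>)) \<le> e * norm \<eta>" if n: "n \<ge> N" for n
    proof -
      have "{..<n} = {..<N} \<union> {N..<n}" using n by auto
      then have "a (fin_proj \<xi> n \<eta>) - a (fin_proj \<xi> N \<eta>) = (\<Sum>j\<in>{N..<n}. (cinner \<eta> (\<xi> j) * l j) *\<^sub>C \<xi> j)"
        unfolding fin by (simp add: sum.union_disjoint ivl_disj_int)
      then have "(norm (a (fin_proj \<xi> n \<eta>) - a (fin_proj \<xi> N \<eta>)))\<^sup>2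
          = (\<Sum>j\<in>{N..<n}. (norm (cinner \<eta> (\<xi> j) * l j))\<^sup>2)"
        using norm_orthonormal_sum[OF orthonormal_basis_cinner[OF \<xi>], of "{N..<n}"] by simp
      also have "\<dots> \<le> (\<Sum>j\<in>{N..<n}. (norm (cinner \<eta> (\<xi> j)))\<^sup>2 * e\<^sup>2)"
        using N by (intro sum_mono) (auto simp: norm_mult power_mult_distrib intro!: mult_left_mono power_mono)
      also have "\<dots> \<le> (norm \<eta>)\<^sup>2 * e\<^sup>2"
        unfolding sum_distrib_right[symmetric]
        by (intro mult_right_mono bessel[OF orthonormal_basis_cinner[OF \<xi>]]) auto
      finally have "(norm (a (fin_proj \<xi> n \<eta>) - a (fin_proj \<xi> N \<eta>)))\<^sup>2 \<le> (e * norm \<eta>)\<^sup>2"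
        by (simp add: power_mult_distrib mult.commute)
      then show ?thesis by (rule power2_le_imp_le) (use e in simp)
    qed
    moreover have "(\<lambda>n. norm (a (fin_proj \<xi> n \<eta>) - a (fin_proj \<xi> N \<eta>)))
        \<longlonglongrightarrow> norm (a \<eta> - a (fin_proj \<xi> N \<eta>))"
      by (intro tendsto_norm tendsto_diff blinfun.tendsto tendsto_const fin_proj_tendsto \<xi>)
    ultimately show "norm ((a - (a o\<^sub>L fin_proj \<xi> N)) \<eta>) \<le> e * norm \<eta>"
      by (simp add: blinfun.diff_left) (meson LIMSEQ_le_const2)
  qed (use e in simp)
  ultimately show "\<exists>b. compact_operator b \<and> norm (a - b) \<le> e" by blast
qed

lemma ell_infty_subset_roe:
  fixes \<xi> :: "nat \<Rightarrow> 'h::complex_hilbert"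
  assumes \<xi>: "orthonormal_basis \<xi>" and a: "(a :: ('x::metric_space, 'h) operator) \<in> ell_infty \<xi>"
  shows "a \<in> roe_algebra"
proof -
  have aB: "a \<in> \<B>" using a by (simp add: ell_infty_def)
  obtain L where L: "\<And>x. L x \<longlonglongrightarrow> 0" "\<And>x n. a (delta x (\<xi> n)) = L x n *\<^sub>C delta x (\<xi> n)"
    using a unfolding ell_infty_def mem_Collect_eq by metis
  have off: "ell2_apply (a (delta x \<eta>)) y = 0" if "x \<noteq> y" for x y \<eta>
    by (rule entry_zero_on_basis[OF aB \<xi>]) (use that in \<open>simp add: L(2)\<close>)
  have "a \<in> BD"
    by (rule prop_le_BD[OF aB, of 0]) (simp add: prop_le_def off)
  moreover have "compact_operator (entry a x y)" for x y
  proof (cases "x = y")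
    case True
    show ?thesis
      unfolding True
    proof (rule compact_operator_diagonal[OF \<xi> _ L(1)])
      show "entry a y y \<in> \<B>"
        unfolding cblinfuns_def by (simp add: entry_apply delta_scaleC cblinfunD[OF aB])
      show "entry a y y (\<xi> n) = L y n *\<^sub>C \<xi> n" for n by (simp add: entry_apply L(2))
    qed
  next
    case False
    then have "entry a x y = 0" by (intro blinfun_eqI) (simp add: entry_apply off)
    then show ?thesis by simp
  qed
  ultimately show ?thesis by (simp add: roe_algebra_def)
qed

lemma Ad_inverse:
  assumes "unitary w" shows "Ad w (Ad (adj w) a) = a" "Ad (adj w) (Ad w a) = a"
  by (rule blinfun_eqI, simp add: assms adj_adj[OF unitary_cblin[OF assms]])+

section \<open>Automorphisms and diagonal subalgebras\<close>

theorem theorem3: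
  fixes \<xi> \<zeta> :: "nat \<Rightarrow> 'h::complex_hilbert"
    and \<Phi> :: "('x::metric_space, 'h) operator \<Rightarrow> ('x, 'h) operator"
  assumes "separable_space (euclidean :: 'h topology)"
    and "infinite_dimensional TYPE('h)"
    and "uniformly_locally_finite TYPE('x)"
    and "property_A TYPE('x) TYPE('h)"
    and "orthonormal_basis \<xi>"
    and "orthonormal_basis \<zeta>"
    and "star_automorphism roe_algebra \<Phi>"
  shows "\<exists>v. unitary v \<and> v \<in> BD \<and> (Ad v \<circ> \<Phi>) ` ell_infty \<xi> = ell_infty \<zeta>"
proof -
  note ulf = assms(3) and PA = assms(4) and \<xi> = assms(5) and \<zeta> = assms(6)
  obtain u where un: "unitary u" and \<Phi>: "\<And>a. a \<in> roe_algebra \<Longrightarrow> \<Phi> a = Ad u a"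
    using star_automorphism_roe_implemented[OF assms(7) norm_basis[OF \<xi>, of 0]] by metis
  have bij: "bij_betw \<Phi> roe_algebra roe_algebra"
    using assms(7) by (simp add: star_automorphism_def)
  have u: "roe_normalizer u"
    unfolding roe_normalizer_def
  proof (intro conjI ballI un)
    fix a :: "('x, 'h) operator" assume a: "a \<in> roe_algebra"
    show "Ad u a \<in> roe_algebra" using bij_betwE[OF bij] a \<Phi>[OF a] by metis
    obtain b where b: "b \<in> roe_algebra" "a = \<Phi> b"
      using bij_betw_imp_surj_on[OF bij] a by (metis imageE)
    then show "Ad (adj u) a \<in> roe_algebra" using \<Phi>[OF b(1)] by (simp add: Ad_inverse(2)[OF un])
  qed
  have uapp: "\<exists>s. \<forall>b. block_contraction b \<longrightarrow> approximable e s (Ad u (bdiag b))" if "0 < e" for e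
    using blocks_uniformly_approximable[OF ulf \<xi> u that] by metis
  obtain R f where conc: "concentrated u (1/2) R f"
    by (rule roe_normalizer_concentrated[OF ulf PA \<xi> u, of "1/2"]) simp_all
  obtain N where N: "\<And>y. finite {x. dist (f x) y \<le> R}" "\<And>y. card {x. dist (f x) y \<le> R} \<le> N"
    using concentrated_fibres_bounded[OF ulf PA \<xi> u conc, of R] by blast
  obtain r where r: "\<And>y. \<exists>x. dist (f x) y \<le> r"
    using concentrated_cobounded[OF ulf PA \<xi> u conc] by blast
  have fin: "finite {x. dist (f x) y \<le> t}" for y t
    using concentrated_fibres_bounded[OF ulf PA \<xi> u conc, of t] by blast
  have ball: "finite (cball y r)" for y :: 'x
    using ulf_card_cball[OF ulf, of r] by blast
  have "finite (f -` {y})" for y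
    by (rule finite_subset[OF _ fin[of y 0]]) auto
  then obtain \<sigma> :: "'x \<times> nat \<Rightarrow> 'x \<times> nat" where \<sigma>: "bij \<sigma>" "\<And>p. dist (f (fst p)) (fst (\<sigma> p)) \<le> r"
    using covering_bijection[OF ball _ r] by blast
  obtain w :: "('x, 'h) operator" where w: "unitary w" "permutes_bases w \<sigma> \<xi> \<zeta>"
    using permuting_unitary[OF \<xi> \<zeta> \<sigma>(1)] by blast
  have cov: "covers w r f" by (rule permutes_bases_covers[OF unitary_cblin[OF w(1)] \<xi> w(2) \<sigma>(2)])
  note uB = unitary_cblin[OF un] and wB = unitary_cblin[OF w(1)]
  define v where "v = w o\<^sub>L adj u"
  have "adj (u o\<^sub>L adj w) = v" by (simp add: v_def adj_compose uB wB cblin_adj adj_adj)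
  then have vBD: "v \<in> BD"
    using BD_adj[OF covering_unitary_mod_BD[OF un w(1) uapp conc N cov]] by simp
  have adjv: "adj v = u o\<^sub>L adj w" by (simp add: v_def adj_compose uB wB cblin_adj adj_adj)
  have v: "unitary v"
    unfolding unitary_def adjv
    by (intro conjI BD_cblin[OF vBD] blinfun_eqI) (simp_all add: v_def un w(1))
  have Adv: "Ad v (\<Phi> a) = Ad w a" if "a \<in> ell_infty \<xi>" for a
    by (rule blinfun_eqI)
      (simp add: \<Phi>[OF ell_infty_subset_roe[OF \<xi> that]] adjv un, simp add: v_def un)
  have "(Ad v \<circ> \<Phi>) ` ell_infty \<xi> = Ad w ` ell_infty \<xi>"
    by (rule image_cong) (simp_all add: Adv)
  also have "\<dots> = ell_infty \<zeta>"
  proof (intro equalityI subsetI)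
    fix b assume "b \<in> Ad w ` ell_infty \<xi>"
    then obtain a where a: "a \<in> ell_infty \<xi>" "b = Ad w a" by blast
    have "finite {x. \<exists>n m. \<sigma> (x, n) = (y, m)}" for y
    proof (rule finite_subset[OF _ fin[of y r]], rule subsetI)
      fix x assume "x \<in> {x. \<exists>n m. \<sigma> (x, n) = (y, m)}"
      then obtain n m where "\<sigma> (x, n) = (y, m)" by blast
      then show "x \<in> {x. dist (f x) y \<le> r}" using \<sigma>(2)[of "(x, n)"] by simp
    qed
    then show "b \<in> ell_infty \<zeta>" unfolding a(2) by (rule Ad_ell_infty[OF w \<sigma>(1) _ a(1)])
  next
    fix b :: "('x, 'h) operator" assume b: "b \<in> ell_infty \<zeta>"
    have "finite {y. \<exists>m n. inv \<sigma> (y, m) = (x, n)}" for x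
    proof (rule finite_subset[OF _ ball[of "f x"]], rule subsetI)
      fix y assume "y \<in> {y. \<exists>m n. inv \<sigma> (y, m) = (x, n)}"
      then obtain m n where "inv \<sigma> (y, m) = (x, n)" by blast
      then have "\<sigma> (x, n) = (y, m)" using bij_inv_eq_iff[OF \<sigma>(1)] by metis
      then show "y \<in> cball (f x) r" using \<sigma>(2)[of "(x, n)"] by simp
    qed
    then have "Ad (adj w) b \<in> ell_infty \<xi>"
      by (rule Ad_ell_infty[OF unitary_adj[OF w(1)] permutes_bases_inv[OF w \<sigma>(1)]
            bij_imp_bij_inv[OF \<sigma>(1)] _ b])
    then show "b \<in> Ad w ` ell_infty \<xi>"
      using Ad_inverse(1)[OF w(1), of b] by (metis image_eqI)
  qed
  finally show ?thesis using v vBD by blast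
qed

end
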